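(* Let $X\subset\mathbb{C}$. Then for each of the eight types (I)–(VIII) listed in the context there exists an analytic family $\{\Phi^\gamma\}_{\gamma\in\Gamma}$ in $\mathrm{HIFS}(X)$, with $\gamma\mapsto\Phi^\gamma$ continuous with respect to the $\lambda$-topology, which is of that type.
   Context: **CIFSs.** $X\subset\mathbb{C}=\mathbb{R}^2$ is a nonempty compact connected set with $X=\overline{\mathrm{Int}(X)}$, with the Euclidean metric, satisfying the cone condition (iii) below. $\mathrm{CIFS}(X)$ is the set of conformal iterated function systems $\Phi=\{\varphi_i:X\to X\}_{i\in\mathbb{N}}$: the $\varphi_i$ are injective, there is $s\in(0,1)$ with $|\varphi_i(x)-\varphi_i(y)|\le s|x-y|$ for all $i$ and $x,y\in X$, and (i) $\varphi_i(\mathrm{Int}X)\subset\mathrm{Int}X$ for all $i$ and $\varphi_i(\mathrm{Int}X)\cap\varphi_j(\mathrm{Int}X)=\emptyset$ for $i\ne j$; (ii) there is an open connected $V\supset X$ such that all $\varphi_i$ extend to $C^1$ conformal diffeomorphisms of $V$ into $V$; (iii) there are $\beta,l>0$ such that every $x\in X$ is the vertex of an open cone contained in $\mathrm{Int}(X)$ with central angle of measure $\beta$ and altitude $l$; (iv) there are $L\ge1$, $\alpha>0$ with $\bigl||\varphi_i'(y)|-|\varphi_i'(x)|\bigr|\le L\,(\inf_V|\varphi_i'|)\,|y-x|^\alpha$ for all $x,y\in V$ and all $i$. **Pressure and regularity.** For $\omega\in\mathbb{N}^n$ put $\varphi_\omega=\varphi_{\omega_1}\circ\cdots\circ\varphi_{\omega_n}$,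 and let $\|\cdot\|$ be the supremum norm over $X$. For $t\ge0$, $P_\Phi(t)=\lim_{n\to\infty}\frac1n\log\sum_{\omega\in\mathbb{N}^n}\|\varphi_\omega'\|^t$, and $\theta_\Phi=\inf\{t\ge0:P_\Phi(t)<\infty\}$. The limit set is $J_\Phi=\bigcup_{\omega\in\mathbb{N}^\infty}\bigcap_{n\ge1}\varphi_{\omega_1\cdots\omega_n}(X)$ and $h_\Phi$ is its Hausdorff dimension. $\Phi$ is *regular* if $P_\Phi(t)=0$ for some $t\ge 0$, otherwise *irregular*; *strongly regular* if $0<P_\Phi(t)<\infty$ for some $t\ge 0$; *cofinitely regular* if every nonempty cofinite subsystem $\{\varphi_i\}_{i\in I'}$ ($I'\subset\mathbb{N}$ cofinite) is regular (equivalently, $P_\Phi(\theta_\Phi)=\infty$); *critically regular* if it is regular and $P_\Phi(\theta_\Phi)=0$. $\mathrm{IR}(X)$, $\mathrm{SR}(X)$, $\mathrm{CFR}(X)$, $\mathrm{CR}(X)\subset\mathrm{CIFS}(X)$ are the subsets of irregular, strongly, cofinitely, critically regular systems, and $\mathrm{FSR}(X)=\mathrm{SR}(X)\setminus\mathrm{CFR}(X)$. **$\lambda$-topology on $\mathrm{CIFS}(X)$.** Let $\rho_\infty(\Phi,\Psi)=\sum_{i\ge1}2^{-i}\min\{1,\|\varphi_i-\psi_i\|+\|\varphi_i'-\psi_i'\|\}$. A sequence $\Phi^n=\{\varphi_i^n\}$ $\lambda$-converges to $\Phi$ if $\rho_\infty(\Phi^n,\Phi)\to0$ and there are $C>0$,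 $N\in\mathbb{N}$ with $\bigl|\log\|\varphi_i'\|-\log\|(\varphi_i^n)'\|\bigr|\le C$ for all $i\in\mathbb{N}$ and $n\ge N$. A set $F\subset\mathrm{CIFS}(X)$ is closed in the $\lambda$-topology iff the limit of every $\lambda$-converging sequence of elements of $F$ belongs to $F$. **Analytic families.** $\mathrm{HIFS}(X)$ is the set of $\Phi\in\mathrm{CIFS}(X)$ for which there is an open connected neighborhood $V$ of $X$ in $\mathbb{C}$ such that every $\varphi_i$ extends to a holomorphic diffeomorphism of $V$ into $V$. A family $\{\Phi^\gamma\}_{\gamma\in\Gamma}=\{\{\varphi_i^\gamma\}_{i}\}_{\gamma\in\Gamma}$ in $\mathrm{HIFS}(X)$ is *analytic* if $\Gamma$ is a connected finite-dimensional complex manifold and for each $\gamma_0\in\Gamma$ there are a neighborhood $\Gamma_0$ of $\gamma_0$ and a bounded connected open neighborhood $V_0$ of $X$ in $\mathbb{C}$ such that for each $i$ and each $\gamma\in\Gamma$, $\varphi_i^\gamma$ extends to a holomorphic diffeomorphism of $V_0$ into $V_0$, and for each $i$ the map $(\gamma,x)\mapsto\varphi_i^\gamma(x)$ is holomorphic on $\Gamma_0\times V_0$. **Parameter sets.** $\mathrm{CFR}_\Gamma=\mathrm{CFR}_\Gamma(X)=\{\gamma\in\Gamma:\Phi^\gamma\in\mathrm{CFR}(X)\}$, and similarly $\mathrm{FSR}_\Gamma$, $\mathrm{CR}_\Gamma$, $\mathrm{IR}_\Gamma$; boundaries are taken in $\Gamma$. $\mathrm{RAH}(\Gamma)$ is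 the set of $\gamma_0\in\Gamma$ such that $\gamma\mapsto h_{\Phi^\gamma}$ is real-analytic in a neighborhood of $\gamma_0$; $\mathrm{NPHH}(\Gamma)$ is the set of $\gamma_0\in\Gamma$ such that $\gamma\mapsto h_{\Phi^\gamma}$ is not pluriharmonic in any neighborhood of $\gamma_0$. **Types.** For a $\lambda$-continuous analytic family, $\theta_{\Phi^\gamma}$ is a constant $\theta$ (known fact). The types are: (I) $\Gamma=\mathrm{CFR}_\Gamma=\mathrm{RAH}(\Gamma)$ and $\gamma\mapsto h_{\Phi^\gamma}$ is identically a constant larger than $\theta$. (II) $\Gamma=\mathrm{CFR}_\Gamma=\mathrm{RAH}(\Gamma)=\mathrm{NPHH}(\Gamma)$. (III) $\Gamma=\mathrm{FSR}_\Gamma=\mathrm{RAH}(\Gamma)$ and $\gamma\mapsto h_{\Phi^\gamma}$ is identically a constant larger than $\theta$. (IV) $\Gamma=\mathrm{FSR}_\Gamma=\mathrm{RAH}(\Gamma)=\mathrm{NPHH}(\Gamma)$. (V) $\Gamma=\mathrm{FSR}_\Gamma\cup\mathrm{CR}_\Gamma=\mathrm{NPHH}(\Gamma)$, $\mathrm{FSR}_\Gamma\ne\emptyset$, $\mathrm{CR}_\Gamma\neq\emptyset$, $\mathrm{CR}_\Gamma=\partial(\mathrm{FSR}_\Gamma)$, $\mathrm{FSR}_\Gamma\subset\mathrm{RAH}(\Gamma)$. (VI) $\Gamma=\mathrm{CR}_\Gamma=\mathrm{RAH}(\Gamma)$ and $h_{\Phi^\gamma}=\theta$ for all $\gamma$.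 (VII) $\mathrm{FSR}_\Gamma,\mathrm{CR}_\Gamma,\mathrm{IR}_\Gamma\ne\emptyset$, $\mathrm{CFR}_\Gamma=\emptyset$, $\emptyset\ne\partial(\mathrm{IR}_\Gamma)\subset\mathrm{CR}_\Gamma=\partial(\mathrm{FSR}_\Gamma)$, $\mathrm{FSR}_\Gamma\cup\mathrm{IR}_\Gamma\subset\mathrm{RAH}(\Gamma)$, $\partial(\mathrm{IR}_\Gamma)\subset\Gamma\setminus\mathrm{RAH}(\Gamma)$, $\mathrm{NPHH}(\Gamma)=\mathrm{FSR}_\Gamma\cup\mathrm{CR}_\Gamma$. (VIII) $\Gamma=\mathrm{IR}_\Gamma=\mathrm{RAH}(\Gamma)$ and $h_{\Phi^\gamma}=\theta$ for all $\gamma$. *)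

theory Defs
  imports "HOL-Analysis.Analysis"
begin

section \<open>Conformal iterated function systems\<close>

text \<open>Open cone (open isosceles triangle) with vertex \<open>x\<close>, unit axis direction \<open>u\<close>,
  full opening angle \<open>\<beta>\<close> and altitude \<open>l\<close>.\<close>

definition open_cone :: "complex \<Rightarrow> complex \<Rightarrow> real \<Rightarrow> real \<Rightarrow> complex set" where
  "open_cone x u \<beta> l =
     {y. (y - x) \<bullet> u < l \<and> cos (\<beta> / 2) * norm (y - x) < (y - x) \<bullet> u}"

definition cone_condition :: "complex set \<Rightarrow> bool" where
  "cone_condition X \<longleftrightarrow>
     (\<exists>\<beta> l. 0 < \<beta> \<and> \<beta> < pi \<and> 0 < l \<and>
        (\<forall>x\<in>X. \<exists>u. norm u = 1 \<and> open_cone x u \<beta> l \<subseteq> interior X))"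

definition cifs_space :: "complex set \<Rightarrow> bool" where
  "cifs_space X \<longleftrightarrow> X \<noteq> {} \<and> compact X \<and> connected X \<and> X = closure (interior X)
     \<and> cone_condition X"

definition C1_conformal_diffeo_into ::
    "complex set \<Rightarrow> (complex \<Rightarrow> complex) \<Rightarrow> (complex \<Rightarrow> complex \<Rightarrow>\<^sub>L complex) \<Rightarrow> bool" where
  "C1_conformal_diffeo_into V f D \<longleftrightarrow>
     inj_on f V \<and> f ` V \<subseteq> V \<and> continuous_on V D \<and>
     (\<forall>x\<in>V. (f has_derivative blinfun_apply (D x)) (at x)) \<and>
     (\<forall>x\<in>V. \<exists>c T. 0 < c \<and> orthogonal_transformation T \<and> blinfun_apply (D x) = (\<lambda>v. c *\<^sub>R T v))"

text \<open>A system is a sequence of maps \<open>X \<rightarrow> X\<close>, made extensional so that it carries no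
  information outside \<open>X\<close>.  Indices start at \<open>0\<close>.  The norm of a bounded linear map is its
  operator norm, so \<open>norm (D i x)\<close> is \<open>|\<phi>\<^sub>i'(x)|\<close>.\<close>

type_synonym system = "nat \<Rightarrow> complex \<Rightarrow> complex"

definition CIFS :: "complex set \<Rightarrow> system set" where
  "CIFS X = {\<phi>.
     (\<forall>i. \<phi> i \<in> X \<rightarrow>\<^sub>E X \<and> inj_on (\<phi> i) X) \<and>
     (\<exists>s. 0 < s \<and> s < 1 \<and> (\<forall>i. \<forall>x\<in>X. \<forall>y\<in>X. dist (\<phi> i x) (\<phi> i y) \<le> s * dist x y)) \<and>
     (\<forall>i. \<phi> i ` interior X \<subseteq> interior X) \<and>
     (\<forall>i j. i \<noteq> j \<longrightarrow> \<phi> i ` interior X \<inter> \<phi> j ` interior X = {}) \<and>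
     (\<exists>V e D. open V \<and> connected V \<and> X \<subseteq> V \<and>
        (\<forall>i. (\<forall>x\<in>X. e i x = \<phi> i x) \<and> C1_conformal_diffeo_into V (e i) (D i)) \<and>
        (\<exists>L \<alpha>. 1 \<le> L \<and> 0 < \<alpha> \<and>
           (\<forall>i. \<forall>x\<in>V. \<forall>y\<in>V.
              \<bar>norm (D i y) - norm (D i x)\<bar>
                \<le> L * (INF z\<in>V. norm (D i z)) * dist y x powr \<alpha>)))}"

text \<open>For \<open>x \<in> X\<close> the derivative relative to \<open>X\<close> is unique, because \<open>X\<close> contains a
  cone with vertex \<open>x\<close>; hence it coincides with the derivative at \<open>x\<close> of any extension that is
  differentiable near \<open>X\<close>.\<close>

definition deriv_on :: "complex set \<Rightarrow> (complex \<Rightarrow> complex) \<Rightarrow> complex \<Rightarrow> complex \<Rightarrow> complex" where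
  "deriv_on X f x = frechet_derivative f (at x within X)"

definition deriv_sup_norm :: "complex set \<Rightarrow> (complex \<Rightarrow> complex) \<Rightarrow> real" where
  "deriv_sup_norm X f = (SUP x\<in>X. onorm (deriv_on X f x))"


section \<open>Pressure\<close>

primrec word_map :: "system \<Rightarrow> nat list \<Rightarrow> complex \<Rightarrow> complex" where
  "word_map \<phi> [] = id"
| "word_map \<phi> (i # w) = \<phi> i \<circ> word_map \<phi> w"

definition ln_ext :: "ennreal \<Rightarrow> ereal" where
  "ln_ext z = (if z = \<infinity> then \<infinity> else if z = 0 then - \<infinity> else ereal (ln (enn2real z)))"

text \<open>\<open>I\<close> is the index set of a subsystem; the full system has \<open>I = UNIV\<close>.\<close>

definition partition_sum :: "complex set \<Rightarrow> nat set \<Rightarrow> system \<Rightarrow> nat \<Rightarrow> real \<Rightarrow> ennreal" where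
  "partition_sum X I \<phi> n t =
     (\<Sum>\<^sub>\<infinity>w\<in>{w. length w = n \<and> set w \<subseteq> I}. ennreal (deriv_sup_norm X (word_map \<phi> w) powr t))"

definition pressure :: "complex set \<Rightarrow> nat set \<Rightarrow> system \<Rightarrow> real \<Rightarrow> ereal" where
  "pressure X I \<phi> t = lim (\<lambda>n. ereal (1 / real n) * ln_ext (partition_sum X I \<phi> n t))"

definition theta :: "complex set \<Rightarrow> system \<Rightarrow> real" where
  "theta X \<phi> = Inf {t. 0 \<le> t \<and> pressure X UNIV \<phi> t < \<infinity>}"


section \<open>Limit set and Hausdorff dimension\<close>

definition limit_set :: "complex set \<Rightarrow> system \<Rightarrow> complex set" where
  "limit_set X \<phi> = (\<Union>\<omega>::nat \<Rightarrow> nat. \<Inter>n\<in>{1..}. word_map \<phi> (map \<omega> [0..<n]) ` X)"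

text \<open>Boundedness of the covering sets must be required explicitly since \<open>diameter\<close> is
  unspecified on unbounded sets.\<close>

definition hausdorff_premeasure :: "real \<Rightarrow> real \<Rightarrow> 'a::metric_space set \<Rightarrow> ennreal" where
  "hausdorff_premeasure \<delta> s A =
     (INF U\<in>{U :: nat \<Rightarrow> 'a set. A \<subseteq> (\<Union>i. U i) \<and> (\<forall>i. bounded (U i) \<and> diameter (U i) \<le> \<delta>)}.
        \<Sum>i. ennreal (diameter (U i) powr s))"

definition hausdorff_outer_measure :: "real \<Rightarrow> 'a::metric_space set \<Rightarrow> ennreal" where
  "hausdorff_outer_measure s A = (SUP \<delta>\<in>{0<..}. hausdorff_premeasure \<delta> s A)"

text \<open>The infimum over \<open>s > 0\<close> avoids the convention for \<open>0 powr 0\<close> and has the same value as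
  the infimum over \<open>s \<ge> 0\<close>.\<close>

definition hausdorff_dim :: "'a::metric_space set \<Rightarrow> real" where
  "hausdorff_dim A = Inf {s. 0 < s \<and> hausdorff_outer_measure s A = 0}"

definition h_dim :: "complex set \<Rightarrow> system \<Rightarrow> real" where
  "h_dim X \<phi> = hausdorff_dim (limit_set X \<phi>)"


section \<open>Regularity classes\<close>

definition regular :: "complex set \<Rightarrow> nat set \<Rightarrow> system \<Rightarrow> bool" where
  "regular X I \<phi> \<longleftrightarrow> (\<exists>t\<ge>0. pressure X I \<phi> t = 0)"

definition IR :: "complex set \<Rightarrow> system set" where
  "IR X = {\<phi>\<in>CIFS X. \<not> regular X UNIV \<phi>}"

definition SR :: "complex set \<Rightarrow> system set" where
  "SR X = {\<phi>\<in>CIFS X. \<exists>t\<ge>0. 0 < pressure X UNIV \<phi> t \<and> pressure X UNIV \<phi> t < \<infinity>}"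

definition CFR :: "complex set \<Rightarrow> system set" where
  "CFR X = {\<phi>\<in>CIFS X. \<forall>I. I \<noteq> {} \<and> finite (- I) \<longrightarrow> regular X I \<phi>}"

definition CR :: "complex set \<Rightarrow> system set" where
  "CR X = {\<phi>\<in>CIFS X. regular X UNIV \<phi> \<and> pressure X UNIV \<phi> (theta X \<phi>) = 0}"

definition FSR :: "complex set \<Rightarrow> system set" where
  "FSR X = SR X - CFR X"


section \<open>The lambda-topology\<close>

text \<open>With indices starting at \<open>0\<close> the weight \<open>2\<^sup>-\<^sup>i\<close> becomes \<open>(1/2) ^ Suc i\<close>.\<close>

definition rho_infty :: "complex set \<Rightarrow> system \<Rightarrow> system \<Rightarrow> real" where
  "rho_infty X \<phi> \<psi> =
     (\<Sum>i. (1/2) ^ Suc i *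
        min 1 ((SUP x\<in>X. norm (\<phi> i x - \<psi> i x)) +
               (SUP x\<in>X. onorm (\<lambda>v. deriv_on X (\<phi> i) x v - deriv_on X (\<psi> i) x v))))"

definition lambda_converges :: "complex set \<Rightarrow> (nat \<Rightarrow> system) \<Rightarrow> system \<Rightarrow> bool" where
  "lambda_converges X \<Psi> \<phi> \<longleftrightarrow>
     (\<lambda>n. rho_infty X (\<Psi> n) \<phi>) \<longlonglongrightarrow> 0 \<and>
     (\<exists>C>0. \<exists>N. \<forall>i. \<forall>n\<ge>N.
        \<bar>ln (deriv_sup_norm X (\<phi> i)) - ln (deriv_sup_norm X (\<Psi> n i))\<bar> \<le> C)"

definition lambda_closed :: "complex set \<Rightarrow> system set \<Rightarrow> bool" where
  "lambda_closed X F \<longleftrightarrow> F \<subseteq> CIFS X \<and>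
     (\<forall>\<Psi> \<phi>. (\<forall>n. \<Psi> n \<in> F) \<and> \<phi> \<in> CIFS X \<and> lambda_converges X \<Psi> \<phi> \<longrightarrow> \<phi> \<in> F)"

definition lambda_topology :: "complex set \<Rightarrow> system topology" where
  "lambda_topology X = topology (\<lambda>U. U \<subseteq> CIFS X \<and> lambda_closed X (CIFS X - U))"

lemma lambda_converges_subseq:
  assumes "lambda_converges X \<Psi> \<phi>" "strict_mono r"
  shows "lambda_converges X (\<Psi> \<circ> r) \<phi>"
proof -
  have "(\<lambda>n. rho_infty X (\<Psi> n) \<phi>) \<longlonglongrightarrow> 0"
    using assms(1) by (simp add: lambda_converges_def)
  from LIMSEQ_subseq_LIMSEQ[OF this assms(2)]
  have 1: "(\<lambda>n. rho_infty X ((\<Psi> \<circ> r) n) \<phi>) \<longlonglongrightarrow> 0" by (simp add: o_def)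
  obtain C N where "C > 0" and CN: "\<forall>i. \<forall>n\<ge>N.
        \<bar>ln (deriv_sup_norm X (\<phi> i)) - ln (deriv_sup_norm X (\<Psi> n i))\<bar> \<le> C"
    using assms(1) unfolding lambda_converges_def by blast
  have "\<forall>i. \<forall>n\<ge>N. \<bar>ln (deriv_sup_norm X (\<phi> i)) - ln (deriv_sup_norm X ((\<Psi> \<circ> r) n i))\<bar> \<le> C"
    using CN seq_suble[OF assms(2)] by (metis comp_apply order_trans)
  with 1 \<open>C > 0\<close> show ?thesis unfolding lambda_converges_def by blast
qed

lemma lambda_closed_Un:
  assumes "lambda_closed X F" "lambda_closed X G"
  shows "lambda_closed X (F \<union> G)"
  unfolding lambda_closed_def
proof (intro conjI allI impI)
  show "F \<union> G \<subseteq> CIFS X" using assms by (auto simp: lambda_closed_def)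
next
  fix \<Psi> \<phi>
  assume *: "(\<forall>n. \<Psi> n \<in> F \<union> G) \<and> \<phi> \<in> CIFS X \<and> lambda_converges X \<Psi> \<phi>"
  have sub: "\<phi> \<in> H" if H: "lambda_closed X H" and inf: "infinite {n. \<Psi> n \<in> H}" for H
  proof -
    obtain r :: "nat \<Rightarrow> nat" where r: "strict_mono r" "\<And>n. r n \<in> {n. \<Psi> n \<in> H}"
      using infinite_enumerate[OF inf] by blast
    have "lambda_converges X (\<Psi> \<circ> r) \<phi>" using lambda_converges_subseq * r(1) by blast
    moreover have "\<forall>n. (\<Psi> \<circ> r) n \<in> H" using r(2) by simp
    ultimately show ?thesis using H * unfolding lambda_closed_def by blast
  qed
  have "UNIV = {n. \<Psi> n \<in> F} \<union> {n. \<Psi> n \<in> G}" using * by auto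
  then have "infinite {n. \<Psi> n \<in> F} \<or> infinite {n. \<Psi> n \<in> G}"
    by (metis finite_Un infinite_UNIV_nat)
  then show "\<phi> \<in> F \<union> G" using sub assms by blast
qed

lemma istopology_lambda: "istopology (\<lambda>U. U \<subseteq> CIFS X \<and> lambda_closed X (CIFS X - U))"
  unfolding istopology_def
proof (intro conjI allI impI)
  fix S T
  assume *: "S \<subseteq> CIFS X \<and> lambda_closed X (CIFS X - S)"
    "T \<subseteq> CIFS X \<and> lambda_closed X (CIFS X - T)"
  then show "S \<inter> T \<subseteq> CIFS X" by blast
  show "lambda_closed X (CIFS X - S \<inter> T)"
    unfolding Diff_Int using * by (intro lambda_closed_Un) simp_all
next
  fix K
  assume K: "\<forall>U\<in>K. U \<subseteq> CIFS X \<and> lambda_closed X (CIFS X - U)"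
  then show "\<Union>K \<subseteq> CIFS X" by blast
  show "lambda_closed X (CIFS X - \<Union>K)"
    unfolding lambda_closed_def
  proof (intro conjI allI impI)
    fix \<Psi> \<phi>
    assume *: "(\<forall>n. \<Psi> n \<in> CIFS X - \<Union>K) \<and> \<phi> \<in> CIFS X \<and> lambda_converges X \<Psi> \<phi>"
    have "\<phi> \<notin> U" if "U \<in> K" for U
    proof -
      have "lambda_closed X (CIFS X - U)" using K that by simp
      moreover have "\<forall>n. \<Psi> n \<in> CIFS X - U" using * that by simp
      ultimately have "\<phi> \<in> CIFS X - U" using * unfolding lambda_closed_def by meson
      then show ?thesis by simp
    qed
    then show "\<phi> \<in> CIFS X - \<Union>K" using * by simp
  qed simp
qed

lemma openin_lambda_topology:
  "openin (lambda_topology X) U \<longleftrightarrow> U \<subseteq> CIFS X \<and> lambda_closed X (CIFS X - U)"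
  unfolding lambda_topology_def using topology_inverse'[OF istopology_lambda] by simp

lemma topspace_lambda_topology: "topspace (lambda_topology X) = CIFS X"
  unfolding topspace_def openin_lambda_topology
  by (auto simp: lambda_closed_def intro!: exI[of _ "CIFS X"])

lemma closedin_lambda_topology: "closedin (lambda_topology X) F \<longleftrightarrow> lambda_closed X F"
proof (cases "F \<subseteq> CIFS X")
  case True
  then have "CIFS X - (CIFS X - F) = F" by blast
  then show ?thesis
    using True by (simp add: closedin_def topspace_lambda_topology openin_lambda_topology)
next
  case False
  then show ?thesis by (simp add: closedin_def topspace_lambda_topology lambda_closed_def)
qed


section \<open>Functions on \<open>\<complex>\<^sup>n\<close>\<close>

text \<open>Since the dimension is quantified existentially, \<open>\<complex>\<^sup>n\<close> is modelled by the sequences that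
  vanish from index \<open>n\<close> on, with the (product) topology of \<open>nat \<Rightarrow> complex\<close>.\<close>

type_synonym cvec = "nat \<Rightarrow> complex"

definition Cspace :: "nat \<Rightarrow> cvec set" where
  "Cspace n = {z. \<forall>i\<ge>n. z i = 0}"

definition Cdist :: "nat \<Rightarrow> cvec \<Rightarrow> cvec \<Rightarrow> real" where
  "Cdist n z w = L2_set (\<lambda>i. dist (z i) (w i)) {..<n}"

text \<open>In the following notions \<open>W\<close> is always an open subset of \<open>Cspace n\<close>.\<close>

definition holomorphic_Cn :: "nat \<Rightarrow> cvec set \<Rightarrow> (cvec \<Rightarrow> complex) \<Rightarrow> bool" where
  "holomorphic_Cn n W f \<longleftrightarrow>
     (\<forall>z\<in>W. \<exists>a::nat \<Rightarrow> complex. \<forall>\<epsilon>>0. \<exists>\<delta>>0. \<forall>w\<in>W. Cdist n z w < \<delta> \<longrightarrow>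
        norm (f w - f z - (\<Sum>i<n. a i * (w i - z i))) \<le> \<epsilon> * Cdist n z w)"

definition multi_indices :: "nat \<Rightarrow> (nat \<Rightarrow> nat) set" where
  "multi_indices n = {a. \<forall>i\<ge>n. a i = 0}"

text \<open>Power series in the \<open>2n\<close> real coordinates \<open>Re z\<^sub>j\<close>, \<open>Im z\<^sub>j\<close>.\<close>

definition real_analytic_Cn :: "nat \<Rightarrow> cvec set \<Rightarrow> (cvec \<Rightarrow> real) \<Rightarrow> bool" where
  "real_analytic_Cn n W f \<longleftrightarrow>
     (\<forall>z\<in>W. \<exists>c r. 0 < r \<and> (\<forall>w\<in>W. Cdist n z w < r \<longrightarrow>
        ((\<lambda>(a, b). c a b * (\<Prod>j<n. Re (w j - z j) ^ a j * Im (w j - z j) ^ b j))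
           has_sum f w) (multi_indices n \<times> multi_indices n)))"

definition along :: "(cvec \<Rightarrow> real) \<Rightarrow> cvec \<Rightarrow> cvec \<Rightarrow> real \<Rightarrow> real" where
  "along f v z t = f (\<lambda>i. z i + of_real t * v i)"

definition dir_deriv :: "cvec \<Rightarrow> (cvec \<Rightarrow> real) \<Rightarrow> cvec \<Rightarrow> real" where
  "dir_deriv v f z = deriv (along f v z) 0"

definition C1_Cn :: "nat \<Rightarrow> cvec set \<Rightarrow> (cvec \<Rightarrow> real) \<Rightarrow> bool" where
  "C1_Cn n W f \<longleftrightarrow>
     (\<forall>v\<in>Cspace n. (\<forall>z\<in>W. along f v z differentiable at 0) \<and> continuous_on W (dir_deriv v f))"

definition C2_Cn :: "nat \<Rightarrow> cvec set \<Rightarrow> (cvec \<Rightarrow> real) \<Rightarrow> bool" where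
  "C2_Cn n W f \<longleftrightarrow> C1_Cn n W f \<and> (\<forall>v\<in>Cspace n. C1_Cn n W (dir_deriv v f))"

text \<open>A \<open>C\<^sup>2\<close> function is pluriharmonic if its restriction to every complex line
  \<open>\<zeta> \<mapsto> z + \<zeta> v\<close> has vanishing Laplacian.\<close>

definition pluriharmonic_Cn :: "nat \<Rightarrow> cvec set \<Rightarrow> (cvec \<Rightarrow> real) \<Rightarrow> bool" where
  "pluriharmonic_Cn n W f \<longleftrightarrow> C2_Cn n W f \<and>
     (\<forall>z\<in>W. \<forall>v\<in>Cspace n.
        dir_deriv v (dir_deriv v f) z
        + dir_deriv (\<lambda>i. \<i> * v i) (dir_deriv (\<lambda>i. \<i> * v i) f) z = 0)"


section \<open>Complex manifolds\<close>

text \<open>The points form the carrier of an arbitrary topology on a subset of the type \<open>'p\<close>, unrelated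
  to any type class topology that \<open>'p\<close> may have.  Connected second countable manifolds have at most
  the cardinality of the continuum, so carriers in the type \<open>complex\<close> realize all of them, of every
  dimension, up to isomorphism.  A chart is a pair of a domain and a coordinate
  map.\<close>

record 'p cmanifold =
  mtop :: "'p topology"
  mdim :: nat
  matlas :: "('p set \<times> ('p \<Rightarrow> cvec)) set"

definition complex_manifold :: "'p cmanifold \<Rightarrow> bool" where
  "complex_manifold M \<longleftrightarrow>
     Hausdorff_space (mtop M) \<and> second_countable (mtop M) \<and>
     (\<Union>(U, \<kappa>)\<in>matlas M. U) = topspace (mtop M) \<and>
     (\<forall>(U, \<kappa>)\<in>matlas M.
        openin (mtop M) U \<and> openin (top_of_set (Cspace (mdim M))) (\<kappa> ` U) \<and>
        homeomorphic_map (subtopology (mtop M) U) (top_of_set (\<kappa> ` U)) \<kappa>) \<and>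
     (\<forall>(U, \<kappa>)\<in>matlas M. \<forall>(U', \<kappa>')\<in>matlas M. \<forall>j<mdim M.
        holomorphic_Cn (mdim M) (\<kappa> ` (U \<inter> U')) (\<lambda>z. \<kappa>' (inv_into U \<kappa> z) j))"

text \<open>A connected manifold is nonempty.  Zero-dimensional manifolds (single points) are excluded.\<close>

definition connected_complex_manifold :: "'p cmanifold \<Rightarrow> bool" where
  "connected_complex_manifold M \<longleftrightarrow>
     complex_manifold M \<and> 0 < mdim M \<and> connected_space (mtop M) \<and> topspace (mtop M) \<noteq> {}"

text \<open>In the following notions \<open>G\<close> is an open subset of \<open>M\<close> and \<open>V\<close> an open subset of \<open>\<complex>\<close>.\<close>

text \<open>Holomorphy on the product \<open>G \<times> V\<close>, read in charts of \<open>M\<close>: the first \<open>mdim M\<close> coordinates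
  parametrize \<open>G\<close> and the last one is the variable in \<open>V\<close>.\<close>

definition holomorphic_on_product ::
    "'p cmanifold \<Rightarrow> 'p set \<Rightarrow> complex set \<Rightarrow> ('p \<Rightarrow> complex \<Rightarrow> complex) \<Rightarrow> bool" where
  "holomorphic_on_product M G V F \<longleftrightarrow>
     (\<forall>(U, \<kappa>)\<in>matlas M. let n = mdim M in
        holomorphic_Cn (Suc n)
          {z \<in> Cspace (Suc n). z(n := 0) \<in> \<kappa> ` (U \<inter> G) \<and> z n \<in> V}
          (\<lambda>z. F (inv_into U \<kappa> (z(n := 0))) (z n)))"

definition real_analytic_on :: "'p cmanifold \<Rightarrow> 'p set \<Rightarrow> ('p \<Rightarrow> real) \<Rightarrow> bool" where
  "real_analytic_on M G f \<longleftrightarrow>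
     (\<forall>(U, \<kappa>)\<in>matlas M. real_analytic_Cn (mdim M) (\<kappa> ` (U \<inter> G)) (f \<circ> inv_into U \<kappa>))"

definition pluriharmonic_on :: "'p cmanifold \<Rightarrow> 'p set \<Rightarrow> ('p \<Rightarrow> real) \<Rightarrow> bool" where
  "pluriharmonic_on M G f \<longleftrightarrow>
     (\<forall>(U, \<kappa>)\<in>matlas M. pluriharmonic_Cn (mdim M) (\<kappa> ` (U \<inter> G)) (f \<circ> inv_into U \<kappa>))"


section \<open>Analytic families\<close>

text \<open>The inverse of an injective holomorphic map on an open set is automatically holomorphic.\<close>

definition holomorphic_diffeo_into :: "complex set \<Rightarrow> (complex \<Rightarrow> complex) \<Rightarrow> bool" where
  "holomorphic_diffeo_into V f \<longleftrightarrow> f holomorphic_on V \<and> inj_on f V \<and> f ` V \<subseteq> V"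

definition HIFS :: "complex set \<Rightarrow> system set" where
  "HIFS X = {\<phi>\<in>CIFS X. \<exists>V. open V \<and> connected V \<and> X \<subseteq> V \<and>
     (\<forall>i. \<exists>e. (\<forall>x\<in>X. e x = \<phi> i x) \<and> holomorphic_diffeo_into V e)}"

definition analytic_family :: "complex set \<Rightarrow> 'p cmanifold \<Rightarrow> ('p \<Rightarrow> system) \<Rightarrow> bool" where
  "analytic_family X M \<Phi> \<longleftrightarrow>
     connected_complex_manifold M \<and>
     (\<forall>\<gamma>\<in>topspace (mtop M). \<Phi> \<gamma> \<in> HIFS X) \<and>
     (\<forall>\<gamma>\<^sub>0\<in>topspace (mtop M). \<exists>G V e.
        openin (mtop M) G \<and> \<gamma>\<^sub>0 \<in> G \<and>
        open V \<and> connected V \<and> bounded V \<and> X \<subseteq> V \<and>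
        (\<forall>i. \<forall>\<gamma>\<in>topspace (mtop M).
           (\<forall>x\<in>X. e i \<gamma> x = \<Phi> \<gamma> i x) \<and> holomorphic_diffeo_into V (e i \<gamma>)) \<and>
        (\<forall>i. holomorphic_on_product M G V (e i)))"

definition params :: "'p cmanifold \<Rightarrow> ('p \<Rightarrow> system) \<Rightarrow> system set \<Rightarrow> 'p set" where
  "params M \<Phi> S = {\<gamma>\<in>topspace (mtop M). \<Phi> \<gamma> \<in> S}"

definition RAH :: "complex set \<Rightarrow> 'p cmanifold \<Rightarrow> ('p \<Rightarrow> system) \<Rightarrow> 'p set" where
  "RAH X M \<Phi> = {\<gamma>\<^sub>0\<in>topspace (mtop M).
     \<exists>G. openin (mtop M) G \<and> \<gamma>\<^sub>0 \<in> G \<and> real_analytic_on M G (\<lambda>\<gamma>. h_dim X (\<Phi> \<gamma>))}"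

definition NPHH :: "complex set \<Rightarrow> 'p cmanifold \<Rightarrow> ('p \<Rightarrow> system) \<Rightarrow> 'p set" where
  "NPHH X M \<Phi> = {\<gamma>\<^sub>0\<in>topspace (mtop M).
     \<forall>G. openin (mtop M) G \<and> \<gamma>\<^sub>0 \<in> G \<longrightarrow> \<not> pluriharmonic_on M G (\<lambda>\<gamma>. h_dim X (\<Phi> \<gamma>))}"

definition h_constant_above_theta :: "complex set \<Rightarrow> 'p cmanifold \<Rightarrow> ('p \<Rightarrow> system) \<Rightarrow> bool" where
  "h_constant_above_theta X M \<Phi> \<longleftrightarrow>
     (\<exists>\<theta> c. \<theta> < c \<and> (\<forall>\<gamma>\<in>topspace (mtop M). theta X (\<Phi> \<gamma>) = \<theta> \<and> h_dim X (\<Phi> \<gamma>) = c))"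

definition h_equals_theta :: "complex set \<Rightarrow> 'p cmanifold \<Rightarrow> ('p \<Rightarrow> system) \<Rightarrow> bool" where
  "h_equals_theta X M \<Phi> \<longleftrightarrow>
     (\<exists>\<theta>. \<forall>\<gamma>\<in>topspace (mtop M). theta X (\<Phi> \<gamma>) = \<theta> \<and> h_dim X (\<Phi> \<gamma>) = \<theta>)"

datatype family_type =
  Type_I | Type_II | Type_III | Type_IV | Type_V | Type_VI | Type_VII | Type_VIII

primrec is_of_type ::
    "family_type \<Rightarrow> complex set \<Rightarrow> 'p cmanifold \<Rightarrow> ('p \<Rightarrow> system) \<Rightarrow> bool" where
  "is_of_type Type_I X M \<Phi> =
    (let \<Gamma> = topspace (mtop M) in
       \<Gamma> = params M \<Phi> (CFR X) \<and> \<Gamma> = RAH X M \<Phi> \<and> h_constant_above_theta X M \<Phi>)"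
| "is_of_type Type_II X M \<Phi> =
    (let \<Gamma> = topspace (mtop M) in
       \<Gamma> = params M \<Phi> (CFR X) \<and> \<Gamma> = RAH X M \<Phi> \<and> \<Gamma> = NPHH X M \<Phi>)"
| "is_of_type Type_III X M \<Phi> =
    (let \<Gamma> = topspace (mtop M) in
       \<Gamma> = params M \<Phi> (FSR X) \<and> \<Gamma> = RAH X M \<Phi> \<and> h_constant_above_theta X M \<Phi>)"
| "is_of_type Type_IV X M \<Phi> =
    (let \<Gamma> = topspace (mtop M) in
       \<Gamma> = params M \<Phi> (FSR X) \<and> \<Gamma> = RAH X M \<Phi> \<and> \<Gamma> = NPHH X M \<Phi>)"
| "is_of_type Type_V X M \<Phi> =
    (let \<Gamma> = topspace (mtop M); FSR\<^sub>\<Gamma> = params M \<Phi> (FSR X); CR\<^sub>\<Gamma> = params M \<Phi> (CR X) in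
       \<Gamma> = FSR\<^sub>\<Gamma> \<union> CR\<^sub>\<Gamma> \<and> \<Gamma> = NPHH X M \<Phi> \<and>
       FSR\<^sub>\<Gamma> \<noteq> {} \<and> CR\<^sub>\<Gamma> \<noteq> {} \<and>
       CR\<^sub>\<Gamma> = mtop M frontier_of FSR\<^sub>\<Gamma> \<and> FSR\<^sub>\<Gamma> \<subseteq> RAH X M \<Phi>)"
| "is_of_type Type_VI X M \<Phi> =
    (let \<Gamma> = topspace (mtop M) in
       \<Gamma> = params M \<Phi> (CR X) \<and> \<Gamma> = RAH X M \<Phi> \<and> h_equals_theta X M \<Phi>)"
| "is_of_type Type_VII X M \<Phi> =
    (let \<Gamma> = topspace (mtop M); FSR\<^sub>\<Gamma> = params M \<Phi> (FSR X); CR\<^sub>\<Gamma> = params M \<Phi> (CR X);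
         IR\<^sub>\<Gamma> = params M \<Phi> (IR X) in
       FSR\<^sub>\<Gamma> \<noteq> {} \<and> CR\<^sub>\<Gamma> \<noteq> {} \<and> IR\<^sub>\<Gamma> \<noteq> {} \<and> params M \<Phi> (CFR X) = {} \<and>
       mtop M frontier_of IR\<^sub>\<Gamma> \<noteq> {} \<and> mtop M frontier_of IR\<^sub>\<Gamma> \<subseteq> CR\<^sub>\<Gamma> \<and>
       CR\<^sub>\<Gamma> = mtop M frontier_of FSR\<^sub>\<Gamma> \<and>
       FSR\<^sub>\<Gamma> \<union> IR\<^sub>\<Gamma> \<subseteq> RAH X M \<Phi> \<and>
       mtop M frontier_of IR\<^sub>\<Gamma> \<subseteq> \<Gamma> - RAH X M \<Phi> \<and>
       NPHH X M \<Phi> = FSR\<^sub>\<Gamma> \<union> CR\<^sub>\<Gamma>)"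
| "is_of_type Type_VIII X M \<Phi> =
    (let \<Gamma> = topspace (mtop M) in
       \<Gamma> = params M \<Phi> (IR X) \<and> \<Gamma> = RAH X M \<Phi> \<and> h_equals_theta X M \<Phi>)"

end

theory Submission
  imports Defs "HOL-Complex_Analysis.Complex_Analysis" "HOL-Real_Asymp.Real_Asymp"
begin

text \<open>All families consist of similarities \<open>x \<mapsto> a i * x + b i\<close> with
  \<open>a i = s i * exp (\<kappa> i * \<gamma>)\<close>, \<open>\<kappa> i \<in> {0, 1, - 1}\<close>, for \<open>\<gamma>\<close> in the unit disc, that map a
  large disc around \<open>X\<close> into disjoint discs inside \<open>X\<close>. Then the pressure at \<open>t\<close> is \<open>ln (\<Sum>i. \<bar>a i\<bar> powr t)\<close>, the
  dimension \<open>h\<close> depends only on \<open>x = Re \<gamma>\<close>, and by Moran's argument it is determined by the sums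
  \<open>\<Sum>i. \<bar>a i\<bar> powr t\<close>. Types I and II use geometric ratios \<open>s i\<close>; all other types use
  \<open>s i = c * (w i)\<^sup>2\<close> with weights \<open>w\<close> of sum \<open>1\<close> and critical exponent \<open>1\<close>, so that
  \<open>\<theta> = 1/2\<close> and \<open>\<Sum>i. s i powr \<theta> = sqrt c\<close> can be prescribed. The choice \<open>\<kappa> = 0\<close> gives constant
  families, \<open>\<kappa> = 1\<close> makes the sum at \<open>\<theta>\<close> equal to \<open>exp (\<theta> * x) * sqrt c\<close>, and pairs of equal
  ratios with \<open>\<kappa> = 1\<close> and \<open>\<kappa> = - 1\<close> make it \<open>cosh (\<theta> * x)\<close>, which has its minimum \<open>1\<close> on
  \<open>x = 0\<close>. Real-analyticity of \<open>h\<close> comes from solving the Moran equation for \<open>x\<close> as a holomorphic function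
  of \<open>h\<close>. Since \<open>h\<close> depends only on \<open>x\<close>, it can only be pluriharmonic where it is affine in \<open>x\<close>,
  which is impossible by a convexity argument.\<close>

section \<open>Sums in the extended nonnegative reals\<close>

text \<open>The discs have to fit into a disc of unknown size inside X, so the sum of the ratios
  must be small, while most types prescribe the value of the Moran sum at \<open>\<theta>\<close>.
  For \<open>\<theta> = 1\<close> the two demands would collide. Squared weights separate them: the
  sum of \<open>c * (w i)\<^sup>2\<close> is at most c times the largest weight, which may be as
  small as desired, whereas the sum at exponent 1/2 is \<open>sqrt c\<close> for all such weights.
  The weights must have a finite sum at the critical exponent itself, since an infinite value there
  would make the system cofinitely regular; powers of the index do not do this, but differences of
  reciprocals of logarithms do. Only the linear parts move with the parameter. The centres are
  fixed, with room for the factor \<open>exp 1 \<le> 3\<close> that the parameter can contribute, so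
  one domain of extension serves all parameters. The dimension is at first only a number attached to
  each parameter, not known to be continuous. A termwise comparison of two Moran series gives a
  Lipschitz bound, and this replaces differentiating the Moran sum in an implicit function
  argument.\<close>

lemma infsum_ennreal_SUP:
  fixes f :: "'a \<Rightarrow> ennreal"
  shows "infsum f A = (SUP F\<in>{F. finite F \<and> F \<subseteq> A}. sum f F)"
  by (rule nonneg_infsum_complete) simp

lemma sum_le_infsum_ennreal:
  fixes f :: "'a \<Rightarrow> ennreal"
  assumes "finite F" "F \<subseteq> A"
  shows "sum f F \<le> infsum f A"
  unfolding infsum_ennreal_SUP using assms by (intro SUP_upper) auto

lemma infsum_ennreal_le:
  fixes f :: "'a \<Rightarrow> ennreal"
  assumes "\<And>F. finite F \<Longrightarrow> F \<subseteq> A \<Longrightarrow> sum f F \<le> c"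
  shows "infsum f A \<le> c"
  unfolding infsum_ennreal_SUP using assms by (intro SUP_least) auto

text \<open>Initial segments are particular finite sets. This direction bounds the series in the
  Hausdorff premeasure by an unordered sum over words.\<close>

lemma suminf_le_infsum_ennreal:
  fixes h :: "nat \<Rightarrow> ennreal"
  shows "suminf h \<le> infsum h UNIV"
  unfolding suminf_eq_SUP by (intro SUP_least sum_le_infsum_ennreal) auto

text \<open>Both inequalities come from finite sums: a finite set of pairs lies in the rectangle of
  its projections, and a sum over a rectangle is a product. It makes the partition sum over words of
  length n the n-th power of the sum over letters.\<close>

lemma infsum_Times_ennreal:
  fixes f :: "'a \<Rightarrow> ennreal" and g :: "'b \<Rightarrow> ennreal"
  shows "(\<Sum>\<^sub>\<infinity>(x, y)\<in>A \<times> B. f x * g y) = infsum f A * infsum g B"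
proof (rule antisym)
  show "(\<Sum>\<^sub>\<infinity>(x, y)\<in>A \<times> B. f x * g y) \<le> infsum f A * infsum g B"
  proof (rule infsum_ennreal_le)
    fix F assume F: "finite F" "F \<subseteq> A \<times> B"
    have "(\<Sum>(x, y)\<in>F. f x * g y) \<le> (\<Sum>(x, y)\<in>fst ` F \<times> snd ` F. f x * g y)"
      using F by (intro sum_mono2) (force simp: image_iff)+
    also have "\<dots> = sum f (fst ` F) * sum g (snd ` F)"
      by (simp add: sum_product sum.cartesian_product)
    also have "\<dots> \<le> infsum f A * infsum g B"
      using F by (intro mult_mono sum_le_infsum_ennreal) auto
    finally show "(\<Sum>(x, y)\<in>F. f x * g y) \<le> infsum f A * infsum g B" .
  qed
  have fin: "sum f F * sum g G \<le> (\<Sum>\<^sub>\<infinity>(x, y)\<in>A \<times> B. f x * g y)"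
    if "finite F" "F \<subseteq> A" "finite G" "G \<subseteq> B" for F G
  proof -
    have "sum f F * sum g G = (\<Sum>(x, y)\<in>F \<times> G. f x * g y)"
      by (simp add: sum_product sum.cartesian_product)
    also have "\<dots> \<le> (\<Sum>\<^sub>\<infinity>(x, y)\<in>A \<times> B. f x * g y)"
      using that by (intro sum_le_infsum_ennreal) auto
    finally show ?thesis .
  qed
  show "infsum f A * infsum g B \<le> (\<Sum>\<^sub>\<infinity>(x, y)\<in>A \<times> B. f x * g y)"
    unfolding infsum_ennreal_SUP[of f A] infsum_ennreal_SUP[of g B]
      SUP_mult_left_ennreal SUP_mult_right_ennreal
    using fin by (intro SUP_least) auto
qed

lemma infsum_ennreal_eq:
  fixes f :: "'a \<Rightarrow> real"
  assumes "f summable_on A" "\<And>x. x \<in> A \<Longrightarrow> 0 \<le> f x"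
  shows "(\<Sum>\<^sub>\<infinity>x\<in>A. ennreal (f x)) = ennreal (infsum f A)"
  using infsum_nonneg_is_SUPREMUM_ennreal[OF assms]
  by (subst infsum_ennreal_SUP) (auto intro!: SUP_cong sum_ennreal assms simp: subset_iff)

lemma summable_on_if_infsum_ennreal_finite:
  fixes f :: "'a \<Rightarrow> real"
  assumes "(\<Sum>\<^sub>\<infinity>x\<in>A. ennreal (f x)) < \<infinity>" "\<And>x. x \<in> A \<Longrightarrow> 0 \<le> f x"
  shows "f summable_on A"
proof (rule nonneg_bdd_above_summable_on)
  show "bdd_above (sum f ` {F. F \<subseteq> A \<and> finite F})"
  proof (rule bdd_aboveI2)
    fix F assume F: "F \<in> {F. F \<subseteq> A \<and> finite F}"
    have "ennreal (sum f F) = (\<Sum>x\<in>F. ennreal (f x))"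
      using F assms(2) by (subst sum_ennreal) (auto simp: subset_iff)
    also have "\<dots> \<le> (\<Sum>\<^sub>\<infinity>x\<in>A. ennreal (f x))"
      using F by (intro sum_le_infsum_ennreal) auto
    finally have "ennreal (sum f F) \<le> (\<Sum>\<^sub>\<infinity>x\<in>A. ennreal (f x))" .
    then have "enn2real (ennreal (sum f F)) \<le> enn2real (\<Sum>\<^sub>\<infinity>x\<in>A. ennreal (f x))"
      using assms(1) by (intro enn2real_mono) auto
    then show "sum f F \<le> enn2real (\<Sum>\<^sub>\<infinity>x\<in>A. ennreal (f x))"
      using F assms(2) by (simp add: subset_iff sum_nonneg)
  qed
qed (use assms in auto)

section \<open>Derivatives relative to a set with the cone condition\<close>

text \<open>The axis direction satisfies the strict angle inequality, hence so does a small
  perturbation of it towards any w. So the directions in which the cone contains a segment at its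
  vertex span the plane.\<close>

lemma eventually_in_cone:
  fixes u w :: complex
  assumes u: "norm u = 1" and \<beta>: "0 < \<beta>" "\<beta> < pi" and l: "0 < l"
  shows "\<exists>\<epsilon>>0. \<exists>\<tau>>0. \<forall>t\<in>{0<..<\<tau>}. x + t *\<^sub>R (u + \<epsilon> *\<^sub>R w) \<in> open_cone x u \<beta> l"
proof -
  have c1: "cos (\<beta> / 2) < 1"
    using \<beta> cos_monotone_0_pi[of 0 "\<beta>/2"] by simp
  have uu: "u \<bullet> u = 1" using u by (simp add: dot_square_norm)
  \<comment> \<open>\<open>f \<epsilon> > 0\<close> is the angle condition of the cone for the
    perturbed direction; it is invariant under scaling by t > 0. At 0 it reads
    \<open>cos (\<beta> / 2) < 1\<close>.\<close>
  define f where "f \<epsilon> = (u + \<epsilon> *\<^sub>R w) \<bullet> u - cos (\<beta> / 2) * norm (u + \<epsilon> *\<^sub>R w)" for \<epsilon> :: real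
  have "(f \<longlongrightarrow> f 0) (at_right 0)"
    unfolding f_def by (intro tendsto_intros) 
  moreover have "f 0 > 0" using u uu c1 by (simp add: f_def)
  ultimately have "\<forall>\<^sub>F \<epsilon> in at_right 0. f \<epsilon> > 0" by (rule order_tendstoD)
  moreover have "\<forall>\<^sub>F \<epsilon> in at_right (0::real). \<epsilon> > 0" by (simp add: eventually_at_right_less)
  ultimately have "\<forall>\<^sub>F \<epsilon> in at_right 0. f \<epsilon> > 0 \<and> \<epsilon> > 0" by (rule eventually_conj)
  then obtain \<epsilon> where \<epsilon>: "f \<epsilon> > 0" "\<epsilon> > 0"
    using eventually_happens by force
  \<comment> \<open>The component of the direction along the axis, so that \<open>t * k < l\<close>
    is the altitude condition. It is positive because \<beta> < pi makes the cosine
    nonnegative.\<close>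
  define k where "k = (u + \<epsilon> *\<^sub>R w) \<bullet> u"
  have kpos: "0 < k"
  proof -
    have "0 \<le> cos (\<beta> / 2)" using \<beta> by (intro cos_ge_zero) auto
    then have "0 \<le> cos (\<beta> / 2) * norm (u + \<epsilon> *\<^sub>R w)" by simp
    then show ?thesis using \<epsilon>(1) by (simp add: f_def k_def)
  qed
  have "x + t *\<^sub>R (u + \<epsilon> *\<^sub>R w) \<in> open_cone x u \<beta> l" if t: "t \<in> {0<..<l / k}" for t
  proof -
    have "t * k < l" using t kpos by (simp add: field_simps)
    moreover have "cos (\<beta> / 2) * (t * norm (u + \<epsilon> *\<^sub>R w)) < t * k"
      using \<epsilon>(1) t by (simp add: f_def k_def mult.left_commute)
    ultimately show ?thesis
      using t by (simp add: open_cone_def k_def)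
  qed
  moreover have "0 < l / k" using kpos l by simp
  ultimately show ?thesis using \<epsilon>(2) by blast
qed

text \<open>A function on an interval has only one one-sided derivative at an endpoint. This is
  applied to the difference of two derivatives of one map, which is a derivative of the zero
  function.\<close>

lemma has_derivative_zero_along:
  fixes x v :: complex
  assumes D: "((\<lambda>_. 0::complex) has_derivative D) (at x within X)"
    and \<tau>: "0 < \<tau>" "\<And>t. t \<in> {0<..<\<tau>} \<Longrightarrow> x + t *\<^sub>R v \<in> X" and x: "x \<in> X"
  shows "D v = 0"
proof -
  define \<tau>' where "\<tau>' = \<tau> / 2"
  have sub: "(\<lambda>t. x + t *\<^sub>R v) ` {0..\<tau>'} \<subseteq> X"
  proof clarify
    fix t assume "t \<in> {0..\<tau>'}"
    then show "x + t *\<^sub>R v \<in> X" using \<tau> x by (cases "t = 0") (auto simp: \<tau>'_def)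
  qed
  have "((\<lambda>t. x + t *\<^sub>R v) has_derivative (\<lambda>t. t *\<^sub>R v)) (at 0 within {0..\<tau>'})"
    by (auto intro!: derivative_eq_intros)
  moreover have "((\<lambda>_. 0::complex) has_derivative D)
      (at ((\<lambda>t. x + t *\<^sub>R v) 0) within (\<lambda>t. x + t *\<^sub>R v) ` {0..\<tau>'})"
    using has_derivative_subset[OF D sub] by simp
  ultimately have "((\<lambda>t. 0::complex) has_derivative (\<lambda>t. D (t *\<^sub>R v))) (at 0 within {0..\<tau>'})"
    using has_derivative_in_compose[of "\<lambda>t. x + t *\<^sub>R v" "\<lambda>t. t *\<^sub>R v" 0 "{0..\<tau>'}" "\<lambda>_. 0" D] by simp
  moreover have "D (t *\<^sub>R v) = t *\<^sub>R D v" for t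
    using has_derivative_linear[OF D] by (simp add: linear_cmul)
  ultimately have "((\<lambda>t. 0::complex) has_vector_derivative D v) (at 0 within {0..\<tau>'})"
    by (simp add: has_vector_derivative_def)
  moreover have "((\<lambda>t. 0::complex) has_vector_derivative 0) (at 0 within {0..\<tau>'})"
    by simp
  moreover have "at (0::real) within {0..\<tau>'} \<noteq> bot"
    using \<tau>(1) by (simp add: trivial_limit_within islimpt_Icc \<tau>'_def)
  ultimately show ?thesis
    using vector_derivative_unique_within by blast
qed

lemma has_derivative_unique_cone:
  fixes f :: "complex \<Rightarrow> complex"
  assumes X: "cone_condition X" and x: "x \<in> X"
    and A: "(f has_derivative A) (at x within X)" and B: "(f has_derivative B) (at x within X)"
  shows "A = B"
proof
  fix w
  obtain \<beta> l u where cone: "0 < \<beta>" "\<beta> < pi" "0 < l" "norm u = 1" "open_cone x u \<beta> l \<subseteq> X"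
    using X x interior_subset unfolding cone_condition_def by (metis order_trans)
  define D where "D = (\<lambda>v. A v - B v)"
  have D: "((\<lambda>_. 0::complex) has_derivative D) (at x within X)"
    using has_derivative_diff[OF A B] by (simp add: D_def)
  have *: "\<exists>\<epsilon>>0. D (u + \<epsilon> *\<^sub>R w) = 0" for w
  proof -
    obtain \<epsilon> \<tau> where "\<epsilon> > 0" "\<tau> > 0" "\<forall>t\<in>{0<..<\<tau>}. x + t *\<^sub>R (u + \<epsilon> *\<^sub>R w) \<in> open_cone x u \<beta> l"
      using eventually_in_cone[of u \<beta> l x w] cone by blast
    then show ?thesis using has_derivative_zero_along[OF D, of \<tau>] x cone(5) by blast
  qed
  have lin: "linear D" using has_derivative_linear[OF D] .
  \<comment> \<open>The case \<open>w = 0\<close> puts the axis direction itself into the kernel;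
    subtracting it below leaves a nonzero multiple of w.\<close>
  have "D u = 0" using *[of 0] by auto
  moreover obtain \<epsilon> where "\<epsilon> > 0" "D (u + \<epsilon> *\<^sub>R w) = 0" using * by blast
  ultimately have "D w = 0" using lin by (simp add: linear_add linear_cmul)
  then show "A w = B w" by (simp add: D_def)
qed

text \<open>\<open>frechet_derivative\<close> chooses some derivative relative to X; its value is
  known only because the cone condition makes this derivative unique.\<close>

lemma deriv_on_affine:
  assumes X: "cone_condition X" and x: "x \<in> X" and f: "\<And>y. y \<in> X \<Longrightarrow> f y = a * y + b"
  shows "deriv_on X f x = (\<lambda>v. a * v)"
proof -
  have "((\<lambda>y. a * y + b) has_derivative (\<lambda>v. a * v)) (at x within X)"
    by (auto intro!: derivative_eq_intros)
  then have 1: "(f has_derivative (\<lambda>v. a * v)) (at x within X)"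
    by (rule has_derivative_transform[rotated 2]) (use x f in auto)
  then have "(f has_derivative frechet_derivative f (at x within X)) (at x within X)"
    using frechet_derivative_works differentiable_def by blast
  from has_derivative_unique_cone[OF X x this 1] show ?thesis by (simp add: deriv_on_def)
qed

lemma onorm_complex_mult: "onorm (\<lambda>v. a * v :: complex) = norm a"
proof (rule antisym)
  show "onorm (\<lambda>v. a * v) \<le> norm a" by (rule onorm_le) (simp add: norm_mult)
  have "norm (a * 1) \<le> onorm (\<lambda>v. a * v) * norm (1::complex)"
    by (rule onorm[OF bounded_linear_mult_right])
  then show "norm a \<le> onorm (\<lambda>v. a * v)" by simp
qed

section \<open>Systems of similarities\<close>

lemma word_map_append: "word_map \<psi> (u @ w) = word_map \<psi> u \<circ> word_map \<psi> w"
  by (induction u) (auto simp: comp_assoc)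

definition affine_system :: "complex set \<Rightarrow> (nat \<Rightarrow> complex) \<Rightarrow> (nat \<Rightarrow> complex) \<Rightarrow> system" where
  "affine_system X a b = (\<lambda>i. \<lambda>x\<in>X. a i * x + b i)"

definition moran_sum :: "(nat \<Rightarrow> real) \<Rightarrow> nat set \<Rightarrow> real \<Rightarrow> ennreal" where
  "moran_sum c I t = (\<Sum>\<^sub>\<infinity>i\<in>I. ennreal (c i powr t))"

text \<open>The hypotheses speak of the ball and not just of X: the ball is the common domain of the
  extensions, and disjoint images of the ball give disjoint images of the compact set X. This is
  stronger than the open set condition and yields positive gaps.\<close>

locale affine_ifs =
  fixes X :: "complex set" and R q :: real and a b :: "nat \<Rightarrow> complex"
  assumes X: "cifs_space X"
    and X_subset: "X \<subseteq> ball 0 R"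
    and q: "q < 1"
    and a_nz: "\<And>i. a i \<noteq> 0"
    and a_le: "\<And>i. norm (a i) \<le> q"
    and into: "\<And>i x. x \<in> ball 0 R \<Longrightarrow> a i * x + b i \<in> interior X"
    and disj: "\<And>i j x y. i \<noteq> j \<Longrightarrow> x \<in> ball 0 R \<Longrightarrow> y \<in> ball 0 R \<Longrightarrow> a i * x + b i \<noteq> a j * y + b j"
begin

abbreviation \<phi> :: system where "\<phi> \<equiv> affine_system X a b"

abbreviation f :: "nat \<Rightarrow> complex \<Rightarrow> complex" where "f i x \<equiv> a i * x + b i"

lemma X_ne: "X \<noteq> {}" and X_compact: "compact X" and X_cone: "cone_condition X"
  using X by (auto simp: cifs_space_def)

lemma q_pos: "0 < q"
  using a_le[of 0] a_nz[of 0] by (metis less_le_trans zero_less_norm_iff)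

lemma \<phi>_eq: "x \<in> X \<Longrightarrow> \<phi> i x = f i x"
  by (simp add: affine_system_def)

lemma f_in_X: "x \<in> X \<Longrightarrow> f i x \<in> X"
  using into[of x i] X_subset interior_subset by blast

lemma f_inj: "f i x = f i y \<longleftrightarrow> x = y"
  using a_nz by simp

lemma dist_f: "dist (f i x) (f i y) = norm (a i) * dist x y"
  by (simp add: dist_norm flip: norm_mult right_diff_distrib)

lemma f_into_ball: "x \<in> ball 0 R \<Longrightarrow> f i x \<in> ball 0 R"
  using into[of x i] X_subset interior_subset by blast

lemma in_CIFS: "\<phi> \<in> CIFS X"
  unfolding CIFS_def
proof (intro CollectI conjI allI impI)
  fix i show "\<phi> i \<in> X \<rightarrow>\<^sub>E X" by (auto simp: affine_system_def f_in_X)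
  show "inj_on (\<phi> i) X" by (auto simp: inj_on_def \<phi>_eq a_nz)
next
  show "\<exists>s>0. s < 1 \<and> (\<forall>i. \<forall>x\<in>X. \<forall>y\<in>X. dist (\<phi> i x) (\<phi> i y) \<le> s * dist x y)"
  proof (intro exI[of _ q] conjI allI ballI)
    fix i x y assume "x \<in> X" "y \<in> X"
    then have "dist (\<phi> i x) (\<phi> i y) = norm (a i) * dist x y" by (simp only: \<phi>_eq dist_f)
    then show "dist (\<phi> i x) (\<phi> i y) \<le> q * dist x y" using a_le[of i] by (simp add: mult_right_mono)
  qed (use q q_pos in auto)
next
  fix i show "\<phi> i ` interior X \<subseteq> interior X"
    using into X_subset interior_subset[of X] by (auto simp: \<phi>_eq subset_iff)
next
  fix i j :: nat assume "i \<noteq> j"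
  then show "\<phi> i ` interior X \<inter> \<phi> j ` interior X = {}"
    using disj[of i j] X_subset interior_subset[of X] by (auto simp: \<phi>_eq subset_iff)
next
  define D where "D i = (\<lambda>x::complex. Blinfun (\<lambda>v. a i * v))" for i
  have D: "blinfun_apply (D i x) = (\<lambda>v. a i * v)" for i x
    unfolding D_def by (rule bounded_linear_Blinfun_apply) (rule bounded_linear_mult_right)
  have diffeo: "C1_conformal_diffeo_into (ball 0 R) (f i) (D i)" for i
    unfolding C1_conformal_diffeo_into_def D
  proof (intro conjI ballI)
    show "inj_on (f i) (ball 0 R)" by (auto simp: inj_on_def a_nz)
    show "f i ` ball 0 R \<subseteq> ball 0 R" using f_into_ball by blast
    show "continuous_on (ball 0 R) (D i)" by (simp add: D_def)
    show "(f i has_derivative (\<lambda>v. a i * v)) (at x)" for x by (auto intro!: derivative_eq_intros)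
    have "orthogonal_transformation (\<lambda>v. a i / norm (a i) * v)"
      unfolding orthogonal_transformation
      by (auto simp: norm_mult norm_divide a_nz intro!: bounded_linear.linear bounded_linear_mult_right)
    then show "\<exists>c T. 0 < c \<and> orthogonal_transformation T \<and> (\<lambda>v. a i * v) = (\<lambda>v. c *\<^sub>R T v)"
      using a_nz
      by (intro exI[of _ "norm (a i)"] exI[of _ "\<lambda>v. a i / norm (a i) * v"]) (auto simp: scaleR_conv_of_real)
  qed
  \<comment> \<open>Each derivative is constant, so the left side of the Hoelder inequality is 0 and
    only a nonnegative infimum is needed; for this the ball has to be nonempty.\<close>
  have "ball 0 R \<noteq> ({} :: complex set)" using X_subset X_ne by blast
  then have "0 \<le> (INF z\<in>ball 0 R. norm (D i z))" for i
    by (rule cINF_greatest) (rule norm_ge_zero)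
  then have hoelder: "\<exists>L \<alpha>. 1 \<le> L \<and> 0 < \<alpha> \<and>
         (\<forall>i. \<forall>x\<in>ball 0 R. \<forall>y\<in>ball 0 R. \<bar>norm (D i y) - norm (D i x)\<bar>
             \<le> L * (INF z\<in>ball 0 R. norm (D i z)) * dist y x powr \<alpha>)"
    by (intro exI[of _ 1]) (simp add: D_def)
  have ext: "\<forall>x\<in>X. f i x = \<phi> i x" for i using \<phi>_eq by simp
  show "\<exists>V e D. open V \<and> connected V \<and> X \<subseteq> V \<and>
        (\<forall>i. (\<forall>x\<in>X. e i x = \<phi> i x) \<and> C1_conformal_diffeo_into V (e i) (D i)) \<and>
        (\<exists>L \<alpha>. 1 \<le> L \<and> 0 < \<alpha> \<and>
           (\<forall>i. \<forall>x\<in>V. \<forall>y\<in>V. \<bar>norm (D i y) - norm (D i x)\<bar>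
                \<le> L * (INF z\<in>V. norm (D i z)) * dist y x powr \<alpha>))"
    by (rule exI[of _ "ball 0 R"], rule exI[of _ f], rule exI[of _ D])
      (intro conjI allI open_ball convex_connected convex_ball X_subset diffeo hoelder ext)
qed

lemma holomorphic_diffeo_f: "holomorphic_diffeo_into (ball 0 R) (f i)"
  unfolding holomorphic_diffeo_into_def
  using f_into_ball by (auto simp: inj_on_def a_nz intro!: holomorphic_intros)

lemma in_HIFS: "\<phi> \<in> HIFS X"
  unfolding HIFS_def using in_CIFS X_subset holomorphic_diffeo_f
  by (auto intro!: exI[of _ "ball 0 R"] exI[of _ "f _"] simp: \<phi>_eq)

section \<open>Words of similarities and their pressure\<close>

lemma word_map_\<phi>:
  "\<exists>d. \<forall>x\<in>X. word_map \<phi> w x = prod_list (map a w) * x + d \<and> word_map \<phi> w x \<in> X"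
proof (induction w)
  case (Cons i w)
  then obtain d where d: "\<forall>x\<in>X. word_map \<phi> w x = prod_list (map a w) * x + d \<and> word_map \<phi> w x \<in> X"
    by blast
  \<comment> \<open>The maps are affine only on X, so invariance of X is carried through the
    induction.\<close>
  have "word_map \<phi> (i # w) x = prod_list (map a (i # w)) * x + (a i * d + b i) \<and> word_map \<phi> (i # w) x \<in> X"
    if "x \<in> X" for x
  proof -
    have w: "word_map \<phi> w x = prod_list (map a w) * x + d" "word_map \<phi> w x \<in> X" using d that by auto
    have "word_map \<phi> (i # w) x = f i (word_map \<phi> w x)" using w(2) by (simp add: \<phi>_eq)
    then show ?thesis using w f_in_X[OF w(2)] by (simp add: algebra_simps)
  qed
  then show ?case by blast
qed (auto intro!: exI[of _ 0])

lemma deriv_sup_norm_affine: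
  assumes "\<And>x. x \<in> X \<Longrightarrow> h x = c * x + d"
  shows "deriv_sup_norm X h = norm c"
proof -
  have "onorm (deriv_on X h x) = norm c" if "x \<in> X" for x
    using deriv_on_affine[OF X_cone that assms] by (simp add: onorm_complex_mult)
  then show ?thesis unfolding deriv_sup_norm_def using X_ne by simp
qed

lemma norm_prod_list: "norm (prod_list (map a w)) = prod_list (map (\<lambda>i. norm (a i)) w)"
  by (induction w) (simp_all add: norm_mult)

lemma deriv_sup_norm_word: "deriv_sup_norm X (word_map \<phi> w) = prod_list (map (\<lambda>i. norm (a i)) w)"
proof -
  obtain d where "\<forall>x\<in>X. word_map \<phi> w x = prod_list (map a w) * x + d"
    using word_map_\<phi> by blast
  then show ?thesis using deriv_sup_norm_affine[of "word_map \<phi> w"] norm_prod_list by auto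
qed

lemma deriv_sup_norm_\<phi>: "deriv_sup_norm X (\<phi> i) = norm (a i)"
  using deriv_sup_norm_affine[of "\<phi> i"] \<phi>_eq by blast

text \<open>The ratio of a composition of similarities is the product of the ratios, so splitting
  off the first letter multiplies the sum by the sum over single letters.\<close>

lemma partition_sum_eq: "partition_sum X I \<phi> n t = moran_sum (\<lambda>i. norm (a i)) I t ^ n"
proof (induction n)
  case 0
  have "{w. length w = 0 \<and> set w \<subseteq> I} = {[]}" by auto
  then show ?case using deriv_sup_norm_word[of "[]"] by (simp add: partition_sum_def)
next
  case (Suc n)
  let ?W = "\<lambda>n. {w. length w = n \<and> set w \<subseteq> I}"
  let ?g = "\<lambda>w. ennreal (deriv_sup_norm X (word_map \<phi> w) powr t)"
  have bij: "bij_betw (\<lambda>(i, w). i # w) (I \<times> ?W n) (?W (Suc n))"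
    by (rule bij_betw_byWitness[where f' = "\<lambda>w. (hd w, tl w)"]) (auto simp: length_Suc_conv)
  have pos: "0 \<le> prod_list (map (\<lambda>i. norm (a i)) w)" for w
    by (induction w) auto
  have "partition_sum X I \<phi> (Suc n) t = (\<Sum>\<^sub>\<infinity>(i, w)\<in>I \<times> ?W n. ?g (i # w))"
    unfolding partition_sum_def infsum_reindex_bij_betw[OF bij, symmetric]
    by (simp add: case_prod_unfold)
  also have "\<dots> = (\<Sum>\<^sub>\<infinity>(i, w)\<in>I \<times> ?W n. ennreal (norm (a i) powr t) * ?g w)"
    unfolding deriv_sup_norm_word using pos
    by (intro infsum_cong) (auto simp: powr_mult ennreal_mult)
  also have "\<dots> = moran_sum (\<lambda>i. norm (a i)) I t * partition_sum X I \<phi> n t"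
    unfolding infsum_Times_ennreal moran_sum_def partition_sum_def ..
  finally show ?case using Suc by simp
qed

lemma pressure_eq: "pressure X I \<phi> t = ln_ext (moran_sum (\<lambda>i. norm (a i)) I t)"
proof -
  let ?Z = "moran_sum (\<lambda>i. norm (a i)) I t"
  have "ereal (1 / real n) * ln_ext (?Z ^ n) = ln_ext ?Z" if "0 < n" for n
  proof -
    consider "?Z = \<infinity>" | "?Z = 0" | "?Z \<noteq> 0" "?Z \<noteq> \<infinity>" by blast
    then show ?thesis
    proof cases
      case 1
      then show ?thesis using that by (simp add: ln_ext_def top_power_ennreal)
    next
      case 2
      then show ?thesis using that by (cases n) (simp_all add: ln_ext_def)
    next
      case 3
      define z where "z = enn2real ?Z"
      have z: "?Z = ennreal z" "0 < z"
        using 3 by (simp_all add: z_def enn2real_positive_iff less_top zero_less_iff_neq_zero)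
      have "ln_ext (ennreal r) = ereal (ln r)" if "0 < r" for r
        using that by (simp add: ln_ext_def)
      then have "ln_ext (ennreal z ^ n) = ereal (real n * ln z)" "ln_ext (ennreal z) = ereal (ln z)"
        using z(2) by (simp_all only: ennreal_power less_imp_le zero_less_power ln_realpow)
      then show ?thesis unfolding z(1) using that by simp
    qed
  qed
  \<comment> \<open>The term at n = 0 is 0 because of the factor \<open>1 / real 0\<close>, so the
    equality is claimed from 1 on.\<close>
  then have "\<forall>\<^sub>F n in sequentially. ereal (1 / real n) * ln_ext (partition_sum X I \<phi> n t) = ln_ext ?Z"
    unfolding partition_sum_eq by (intro eventually_sequentiallyI[of 1]) simp
  then have "(\<lambda>n. ereal (1 / real n) * ln_ext (partition_sum X I \<phi> n t)) \<longlonglongrightarrow> ln_ext ?Z"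
    by (rule tendsto_eventually)
  then show ?thesis unfolding pressure_def by (rule limI)
qed

end

lemma ln_ext_simps:
  "ln_ext z < \<infinity> \<longleftrightarrow> z < \<infinity>"
  "ln_ext z = 0 \<longleftrightarrow> z = 1"
  "0 < ln_ext z \<longleftrightarrow> 1 < z"
proof -
  have "(ln_ext z < \<infinity> \<longleftrightarrow> z < \<infinity>) \<and> (ln_ext z = 0 \<longleftrightarrow> z = 1) \<and> (0 < ln_ext z \<longleftrightarrow> 1 < z)"
  proof (cases z)
    case (real r)
    show ?thesis
    proof (cases "r = 0")
      case False
      then have "0 < r" using real by simp
      then show ?thesis using real by (simp add: ln_ext_def)
    qed (simp add: real ln_ext_def)
  qed (simp add: ln_ext_def)
  then show "ln_ext z < \<infinity> \<longleftrightarrow> z < \<infinity>" "ln_ext z = 0 \<longleftrightarrow> z = 1" "0 < ln_ext z \<longleftrightarrow> 1 < z"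
    by blast+
qed

section \<open>Hausdorff dimension of the limit set\<close>

text \<open>Moran's argument by induction on the size of the cover: either some set of the cover meets two
  of the pieces \<open>f i ` A\<close>, and then has diameter at least \<open>g\<close>, or the cover splits into
  smaller covers of the separate pieces.\<close>

lemma moran_finite_cover:
  fixes a b :: "nat \<Rightarrow> complex" and U :: "'j \<Rightarrow> complex set"
  assumes F: "finite F" and A: "A \<noteq> {}" and inv: "\<And>i x. i \<in> F \<Longrightarrow> x \<in> A \<Longrightarrow> a i * x + b i \<in> A"
    and gap: "\<And>i j x y. i \<in> F \<Longrightarrow> j \<in> F \<Longrightarrow> i \<noteq> j \<Longrightarrow> x \<in> A \<Longrightarrow> y \<in> A \<Longrightarrow>
               g \<le> dist (a i * x + b i) (a j * y + b j)"
    and g: "0 < g" and t: "0 < t" and a: "\<And>i. i \<in> F \<Longrightarrow> a i \<noteq> 0 \<and> norm (a i) < 1"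
    and sum1: "1 \<le> (\<Sum>i\<in>F. norm (a i) powr t)"
    and J: "finite J" "\<And>j. j \<in> J \<Longrightarrow> bounded (U j)" "A \<subseteq> (\<Union>j\<in>J. U j)"
  shows "g powr t \<le> (\<Sum>j\<in>J. diameter (U j) powr t)"
  using J
proof (induction "card J" arbitrary: J U rule: less_induct)
  case less
  let ?f = "\<lambda>i x. a i * x + b i"
  show ?case
  proof (cases "\<exists>j\<in>J. \<exists>i\<in>F. \<exists>i'\<in>F. i \<noteq> i' \<and> U j \<inter> ?f i ` A \<noteq> {} \<and> U j \<inter> ?f i' ` A \<noteq> {}")
    case True
    then obtain j i i' x y where *: "j \<in> J" "i \<in> F" "i' \<in> F" "i \<noteq> i'" "x \<in> A" "y \<in> A"
      "?f i x \<in> U j" "?f i' y \<in> U j" by blast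
    have "g \<le> dist (?f i x) (?f i' y)" using * gap by blast
    also have "\<dots> \<le> diameter (U j)" using * less.prems(2) by (intro diameter_bounded_bound) auto
    finally have "g powr t \<le> diameter (U j) powr t" using g t by (intro powr_mono2) auto
    also have "\<dots> \<le> (\<Sum>j\<in>J. diameter (U j) powr t)"
      using * less.prems(1) by (intro member_le_sum) auto
    finally show ?thesis .
  next
    case False
    define J' where "J' i = {j \<in> J. U j \<inter> ?f i ` A \<noteq> {}}" for i
    have disj: "J' i \<inter> J' i' = {}" if "i \<in> F" "i' \<in> F" "i \<noteq> i'" for i i'
      using False that unfolding J'_def by blast
    have cov: "?f i ` A \<subseteq> (\<Union>j\<in>J' i. U j)" if "i \<in> F" for i
    proof
      fix y assume y: "y \<in> ?f i ` A"
      then have "y \<in> A" using inv that by blast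
      then obtain j where "j \<in> J" "y \<in> U j" using less.prems(3) by blast
      then show "y \<in> (\<Union>j\<in>J' i. U j)" using y by (auto simp: J'_def)
    qed
    have ne: "J' i \<noteq> {}" if "i \<in> F" for i
      using cov[OF that] A by blast
    have piece: "norm (a i) powr t * g powr t \<le> (\<Sum>j\<in>J' i. diameter (U j) powr t)" if i: "i \<in> F" for i
    proof -
      \<comment> \<open>A single map would contribute less than 1 to the sum. A second piece meets
        some set of the cover that does not meet piece i, so the cover of piece i has fewer
        sets.\<close>
      have "F \<noteq> {i}" using sum1 a[OF i] t powr_less_mono2[of t "norm (a i)" 1] by auto
      then obtain i' where i': "i' \<in> F" "i' \<noteq> i" using i by blast
      obtain j' where "j' \<in> J' i'" using ne i' by blast
      then have "J' i \<subset> J" using disj[of i i'] i i' unfolding J'_def by blast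
      then have card: "card (J' i) < card J" using less.prems(1) by (simp add: psubset_card_mono)
      \<comment> \<open>Pulling the cover of piece i back by the similarity gives a cover of all of
        A, with diameters divided by the ratio.\<close>
      define V where "V j = ?f i -` U j" for j
      have V: "bounded (V j) \<and> diameter (V j) \<le> diameter (U j) / norm (a i)" if "j \<in> J" for j
      proof -
        have d: "dist x y \<le> diameter (U j) / norm (a i)" if "x \<in> V j" "y \<in> V j" for x y
        proof -
          have "dist (?f i x) (?f i y) \<le> diameter (U j)"
            using that less.prems(2)[OF \<open>j \<in> J\<close>] by (intro diameter_bounded_bound) (auto simp: V_def)
          moreover have "dist (?f i x) (?f i y) = norm (a i) * dist x y"
            by (simp add: dist_norm flip: norm_mult right_diff_distrib)
          ultimately show ?thesis using a[OF i] by (simp add: field_simps)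
        qed
        then have "bounded (V j)" unfolding bounded_two_points by blast
        moreover have "diameter (V j) \<le> diameter (U j) / norm (a i)"
          using d less.prems(2)[OF that] by (intro diameter_le) (auto simp: dist_norm diameter_ge_0)
        ultimately show ?thesis by blast
      qed
      have "g powr t \<le> (\<Sum>j\<in>J' i. diameter (V j) powr t)"
      proof (rule less.hyps[OF card])
        show "finite (J' i)" using less.prems(1) by (simp add: J'_def)
        show "bounded (V j)" if "j \<in> J' i" for j using V that by (simp add: J'_def)
        show "A \<subseteq> (\<Union>j\<in>J' i. V j)" using cov[OF i] unfolding V_def by blast
      qed
      also have "\<dots> \<le> (\<Sum>j\<in>J' i. (diameter (U j) / norm (a i)) powr t)"
        using V t by (intro sum_mono powr_mono2) (auto simp: J'_def intro!: diameter_ge_0)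
      also have "\<dots> = (\<Sum>j\<in>J' i. diameter (U j) powr t) / norm (a i) powr t"
        unfolding sum_divide_distrib using less.prems(2)
        by (intro sum.cong powr_divide) (auto simp: J'_def intro!: diameter_ge_0)
      finally show ?thesis using a[OF i] by (simp add: field_simps)
    qed
    \<comment> \<open>The disjoint covers of the pieces together cost \<open>g powr t\<close> times
      the sum of the powers of the ratios, and that sum is at least 1.\<close>
    have "g powr t \<le> (\<Sum>i\<in>F. norm (a i) powr t) * g powr t"
      using mult_right_mono[OF sum1, of "g powr t"] by simp
    also have "\<dots> \<le> (\<Sum>i\<in>F. \<Sum>j\<in>J' i. diameter (U j) powr t)"
      unfolding sum_distrib_right using piece by (rule sum_mono)
    also have "\<dots> = (\<Sum>j\<in>(\<Union>i\<in>F. J' i). diameter (U j) powr t)"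
      using F less.prems(1) disj by (intro sum.UNION_disjoint[symmetric]) (auto simp: J'_def)
    also have "\<dots> \<le> (\<Sum>j\<in>J. diameter (U j) powr t)"
      using less.prems(1) by (intro sum_mono2) (auto simp: J'_def)
    finally show ?thesis .
  qed
qed

text \<open>The covers in the definition of Hausdorff measure are countable and by arbitrary sets,
  while the Moran induction needs a finite one. Enlarging each set to an open set costs less than
  the slack in the strict inequality, and compactness then leaves finitely many.\<close>

lemma compact_finite_cover_diameter:
  fixes U :: "nat \<Rightarrow> complex set"
  assumes K: "compact K" "K \<subseteq> (\<Union>n. U n)" and U: "\<And>n. bounded (U n)" and t: "0 < t"
    and S: "(\<Sum>n. ennreal (diameter (U n) powr t)) < ennreal c"
  shows "\<exists>J V. finite J \<and> (\<forall>n. bounded (V n)) \<and> K \<subseteq> (\<Union>n\<in>J. V (n::nat)) \<and>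
           (\<Sum>n\<in>J. diameter (V n :: complex set) powr t) < c"
proof -
  let ?d = "\<lambda>n. diameter (U n)"
  have d0: "0 \<le> ?d n" for n using U by (rule diameter_ge_0)
  have sm: "summable (\<lambda>n. ?d n powr t)"
    using order_less_trans[OF S ennreal_less_top] by (intro summable_suminf_not_top) auto
  then have "(\<Sum>n. ennreal (?d n powr t)) = ennreal (\<Sum>n. ?d n powr t)"
    by (intro suminf_ennreal2) auto
  then have lt: "(\<Sum>n. ?d n powr t) < c"
    using S by (simp add: ennreal_less_iff suminf_nonneg sm)
  \<comment> \<open>This slack is shared out as \<open>e * (1/2) ^ Suc n\<close>, with sum
    e.\<close>
  define e where "e = c - (\<Sum>n. ?d n powr t)"
  have e: "0 < e" using lt by (simp add: e_def)
  have "\<exists>\<eta>>0. (?d n + 2 * \<eta>) powr t < ?d n powr t + e * (1/2) ^ Suc n" for n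
  proof -
    \<comment> \<open>Continuity of the power at a diameter that may be 0; this is where t > 0
      enters.\<close>
    have "((\<lambda>\<eta>. (?d n + 2 * \<eta>) powr t) \<longlongrightarrow> (?d n + 2 * 0) powr t) (at_right 0)"
      using t d0[of n]
      by (intro tendsto_powr' tendsto_intros) (auto simp: eventually_at_right_less intro!: eventually_mono[OF eventually_at_right_less])
    moreover have "(?d n + 2 * 0) powr t < ?d n powr t + e * (1/2) ^ Suc n" using e by simp
    ultimately have "\<forall>\<^sub>F \<eta> in at_right 0. (?d n + 2 * \<eta>) powr t < ?d n powr t + e * (1/2) ^ Suc n"
      by (rule order_tendstoD)
    then have "\<forall>\<^sub>F \<eta> in at_right 0. 0 < \<eta> \<and> (?d n + 2 * \<eta>) powr t < ?d n powr t + e * (1/2) ^ Suc n"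
      using eventually_at_right_less by (rule eventually_conj[rotated])
    then show ?thesis using eventually_happens[of _ "at_right (0::real)"] by force
  qed
  then obtain \<eta> where \<eta>: "\<And>n. 0 < \<eta> n"
    "\<And>n. (?d n + 2 * \<eta> n) powr t < ?d n powr t + e * (1/2) ^ Suc n" by metis
  define V where "V n = (\<Union>x\<in>U n. ball x (\<eta> n))" for n
  have op: "open (V n)" and sub: "U n \<subseteq> V n" for n
    using \<eta>(1)[of n] by (auto simp: V_def)
  have Vd: "dist x y \<le> ?d n + 2 * \<eta> n" if V: "x \<in> V n" "y \<in> V n" for x y n
  proof -
    obtain x' where x': "x' \<in> U n" "dist x' x < \<eta> n" using V(1) by (auto simp: V_def)
    obtain y' where y': "y' \<in> U n" "dist y' y < \<eta> n" using V(2) by (auto simp: V_def)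
    note * = x' y'
    have "dist x' y' \<le> ?d n" using x' y' U by (intro diameter_bounded_bound) auto
    moreover have "dist x y \<le> dist x' x + dist x' y' + dist y' y"
      using dist_triangle[of x y x'] dist_triangle[of x' y y'] by (simp add: dist_commute)
    ultimately show ?thesis using * by simp
  qed
  have Vb: "bounded (V n)" for n using Vd[of _ n] unfolding bounded_two_points by blast
  have Vdiam: "diameter (V n) \<le> ?d n + 2 * \<eta> n" for n
    using Vd[of _ n] d0[of n] \<eta>(1)[of n] by (intro diameter_le) (auto simp: dist_norm)
  have "(\<Union>n. U n) \<subseteq> (\<Union>n. V n)" by (rule UN_mono[OF subset_refl sub])
  with K(2) have KV: "K \<subseteq> (\<Union>n. V n)" by (rule order_trans)
  obtain J where J: "J \<subseteq> UNIV" "finite J" "K \<subseteq> (\<Union>n\<in>J. V n)"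
    by (rule compactE_image[OF K(1) op KV])
  have geo: "(\<lambda>n. e * (1/2) ^ Suc n) sums e"
    using sums_mult[OF power_half_series, of e] by simp
  have "(\<Sum>n\<in>J. diameter (V n) powr t) < c"
  \<comment> \<open>The strict termwise comparison needs a nonempty index set.\<close>
  proof (cases "J = {}")
    case True
    have "0 \<le> (\<Sum>n. ?d n powr t)" by (intro suminf_nonneg sm) auto
    then show ?thesis using True lt by simp
  next
    case False
    have "(\<Sum>n\<in>J. diameter (V n) powr t) \<le> (\<Sum>n\<in>J. (?d n + 2 * \<eta> n) powr t)"
      using Vdiam t Vb by (intro sum_mono powr_mono2) (auto intro!: diameter_ge_0)
    also have "\<dots> < (\<Sum>n\<in>J. ?d n powr t + e * (1/2) ^ Suc n)"
      using \<eta>(2) False J by (intro sum_strict_mono) auto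
    also have "\<dots> \<le> (\<Sum>n. ?d n powr t + e * (1/2) ^ Suc n)"
      using J e summable_add[OF sm sums_summable[OF geo]]
      by (intro sum_le_suminf) auto
    also have "\<dots> = (\<Sum>n. ?d n powr t) + e"
      using suminf_add[OF sm sums_summable[OF geo]] sums_unique[OF geo] by simp
    finally show ?thesis by (simp add: e_def)
  qed
  then show ?thesis using J Vb by blast
qed

section \<open>Bounds for the Hausdorff measure of the limit set\<close>

context affine_ifs
begin

lemma finite_gap:
  assumes F: "finite F"
  shows "\<exists>g>0. \<forall>i\<in>F. \<forall>j\<in>F. i \<noteq> j \<longrightarrow> (\<forall>x\<in>X. \<forall>y\<in>X. g \<le> dist (f i x) (f j y))"
proof -
  have comp: "compact (f i ` X)" for i
    by (intro compact_continuous_image X_compact continuous_intros)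
  have "\<exists>g>0. \<forall>x\<in>X. \<forall>y\<in>X. g \<le> dist (f i x) (f j y)" if "i \<noteq> j" for i j
  proof -
    have "f i ` X \<inter> f j ` X = {}" using disj[OF that] X_subset by blast
    then show ?thesis
      using separate_compact_closed[OF comp compact_imp_closed[OF comp]] by (metis imageI)
  qed
  then obtain G where G: "\<And>i j. i \<noteq> j \<Longrightarrow> 0 < G i j \<and> (\<forall>x\<in>X. \<forall>y\<in>X. G i j \<le> dist (f i x) (f j y))"
    by metis
  \<comment> \<open>The extra element 1 keeps the minimum meaningful when there are no two indices
    to compare.\<close>
  let ?S = "insert 1 ((\<lambda>(i, j). G i j) ` {(i, j) \<in> F \<times> F. i \<noteq> j})"
  have fin: "finite ?S" using F by (auto intro!: finite_imageI intro: finite_subset[of _ "F \<times> F"])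
  have "0 < Min ?S" using fin G by (subst Min_gr_iff) auto
  moreover have "Min ?S \<le> G i j" if "i \<in> F" "j \<in> F" "i \<noteq> j" for i j
    using fin that by (intro Min_le) auto
  ultimately show ?thesis using G by (meson order_trans)
qed

text \<open>A set covered by its own images lets each of its points be pulled back for ever inside
  the set; the indices met on the way form a code of the point.\<close>

lemma in_limit_setI:
  assumes A: "A \<subseteq> X" and cov: "\<And>x. x \<in> A \<Longrightarrow> \<exists>i. \<exists>y\<in>A. x = f i y" and x: "x \<in> A"
  shows "x \<in> limit_set X \<phi>"
proof -
  obtain I Y where IY: "\<And>x. x \<in> A \<Longrightarrow> Y x \<in> A \<and> x = f (I x) (Y x)" using cov by metis
  define y where "y n = (Y ^^ n) x" for n
  define \<omega> where "\<omega> n = I (y n)" for n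
  have yA: "y n \<in> A" for n by (induction n) (auto simp: y_def x IY)
  have step: "y n = \<phi> (\<omega> n) (y (Suc n))" for n
    using IY[OF yA[of n]] A by (subst \<phi>_eq) (auto simp: y_def \<omega>_def)
  have "x = word_map \<phi> (map \<omega> [0..<n]) (y n)" for n
  proof (induction n)
    case 0 then show ?case by (simp add: y_def)
  next
    case (Suc n)
    note Suc
    also note step[of n]
    finally show ?case by (simp add: word_map_append)
  qed
  then have "x \<in> word_map \<phi> (map \<omega> [0..<n]) ` X" for n using yA A by blast
  then show ?thesis unfolding limit_set_def by blast
qed

text \<open>The decreasing intersection of the iterates of X under finitely many of the maps, that
  is, the attractor of a finite subsystem. It supplies the compact set for the lower bound, as the
  limit set of an infinite system need not be compact.\<close>

lemma finite_attractor:
  assumes F: "finite F" "F \<noteq> {}"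
  shows "\<exists>A. compact A \<and> A \<noteq> {} \<and> A \<subseteq> X \<and> A \<subseteq> limit_set X \<phi> \<and> (\<forall>i\<in>F. \<forall>x\<in>A. f i x \<in> A)"
proof -
  define K where "K n = ((\<lambda>S. \<Union>i\<in>F. f i ` S) ^^ n) X" for n
  have K0: "K 0 = X" and KS: "K (Suc n) = (\<Union>i\<in>F. f i ` K n)" for n by (auto simp: K_def)
  have KX: "K n \<subseteq> X" for n by (induction n) (auto simp: K0 KS f_in_X subset_iff)
  have comp: "compact (K n)" for n
    by (induction n) (auto simp: K0 KS X_compact F intro!: compact_UN compact_continuous_image continuous_intros)
  have ne: "K n \<noteq> {}" for n by (induction n) (auto simp: K0 KS X_ne F)
  have decS: "K (Suc n) \<subseteq> K n" for n
  proof (induction n)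
    case 0 then show ?case using KX[of 1] by (simp add: K0)
  next
    case (Suc n)
    have "(\<Union>i\<in>F. f i ` K (Suc n)) \<subseteq> (\<Union>i\<in>F. f i ` K n)"
      by (intro UN_mono image_mono subset_refl Suc)
    then show ?case by (simp only: KS)
  qed
  define A where "A = (\<Inter>n. K n)"
  have anti: "K n \<subseteq> K m" if "m \<le> n" for m n by (rule lift_Suc_antimono_le[of K, OF decS that])
  have "A \<noteq> {}" unfolding A_def by (rule compact_nest[OF comp ne anti])
  moreover have "compact A" unfolding A_def using comp by (intro compact_Inter) auto
  moreover have AX: "A \<subseteq> X" using K0 unfolding A_def by blast
  moreover have "f i x \<in> A" if "i \<in> F" "x \<in> A" for i x
  proof -
    have "x \<in> K n" for n using that by (simp add: A_def)
    then have "f i x \<in> K (Suc n)" for n unfolding KS using that(1) by blast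
    then have "f i x \<in> K n" for n using decS by (rule subsetD[rotated])
    then show ?thesis by (simp add: A_def)
  qed
  moreover have "\<exists>i. \<exists>y\<in>A. x = f i y" if x: "x \<in> A" for x
  proof -
    have xK: "x \<in> K n" for n using x by (simp add: A_def)
    then have "x \<in> K (Suc 0)" .
    then obtain i y where i: "i \<in> F" "y \<in> X" "x = f i y" unfolding KS K0 by blast
    \<comment> \<open>Disjointness of the images forces the same index at every level, so the
      preimage found at the first level works for all levels.\<close>
    have "y \<in> K n" for n
    proof -
      have "x \<in> K (Suc n)" by (rule xK)
      then obtain j z where j: "z \<in> K n" "x = f j z" unfolding KS by blast
      have "j = i" using disj[of i j y z] i j KX X_subset by blast
      then show ?thesis using i j f_inj by simp
    qed
    then have "y \<in> A" by (simp add: A_def)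
    then show ?thesis using i(3) by blast
  qed
  then have "A \<subseteq> limit_set X \<phi>" using in_limit_setI[OF AX] by blast
  ultimately show ?thesis by blast
qed

lemma hausdorff_outer_measure_pos:
  assumes F: "finite F" and t: "0 < t" and sum1: "1 \<le> (\<Sum>i\<in>F. norm (a i) powr t)"
  shows "hausdorff_outer_measure t (limit_set X \<phi>) \<noteq> 0"
proof -
  have "F \<noteq> {}" using sum1 by auto
  then obtain A where A: "compact A" "A \<noteq> {}" "A \<subseteq> X" "A \<subseteq> limit_set X \<phi>" "\<forall>i\<in>F. \<forall>x\<in>A. f i x \<in> A"
    using finite_attractor[OF F] by blast
  obtain g where g: "0 < g" "\<forall>i\<in>F. \<forall>j\<in>F. i \<noteq> j \<longrightarrow> (\<forall>x\<in>X. \<forall>y\<in>X. g \<le> dist (f i x) (f j y))"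
    using finite_gap[OF F] by blast
  \<comment> \<open>One scale suffices, because the outer measure is the supremum over all
    scales.\<close>
  have "ennreal (g powr t) \<le> hausdorff_premeasure 1 t (limit_set X \<phi>)"
    unfolding hausdorff_premeasure_def
  proof (intro INF_greatest, rule ccontr)
    fix U :: "nat \<Rightarrow> complex set"
    assume U: "U \<in> {U. limit_set X \<phi> \<subseteq> (\<Union>i. U i) \<and> (\<forall>i. bounded (U i) \<and> diameter (U i) \<le> 1)}"
    assume "\<not> ennreal (g powr t) \<le> (\<Sum>i. ennreal (diameter (U i) powr t))"
    then have lt: "(\<Sum>i. ennreal (diameter (U i) powr t)) < ennreal (g powr t)" by simp
    have "A \<subseteq> (\<Union>i. U i)" "\<And>i. bounded (U i)" using U A(4) by auto
    from compact_finite_cover_diameter[OF A(1) this t lt]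
    obtain J V where J: "finite J" "\<forall>n. bounded (V n)" "A \<subseteq> (\<Union>n\<in>J. V (n::nat))"
        "(\<Sum>n\<in>J. diameter (V n) powr t) < g powr t"
      by (elim exE conjE)
    have "g powr t \<le> (\<Sum>n\<in>J. diameter (V n) powr t)"
    proof (rule moran_finite_cover[OF F A(2) _ _ g(1) t _ sum1 J(1)])
      show "a i * x + b i \<in> A" if "i \<in> F" "x \<in> A" for i x using A that by blast
      show "g \<le> dist (f i x) (f j y)" if "i \<in> F" "j \<in> F" "i \<noteq> j" "x \<in> A" "y \<in> A" for i j x y
        using g that A(3) by blast
      show "a i \<noteq> 0 \<and> norm (a i) < 1" for i using a_nz a_le[of i] q by auto
    qed (use J in auto)
    then show False using J by simp
  qed
  also have "\<dots> \<le> hausdorff_outer_measure t (limit_set X \<phi>)"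
    unfolding hausdorff_outer_measure_def by (intro SUP_upper) auto
  finally show ?thesis using g(1) by (auto simp: ennreal_eq_0_iff)
qed

text \<open>The images of X under the words of length n cover the limit set, and the t-th powers of
  their diameters add up to at most \<open>D powr t * z ^ n\<close>, which tends to 0.\<close>

lemma hausdorff_outer_measure_zero:
  assumes t: "0 < t" and Z: "moran_sum (\<lambda>i. norm (a i)) UNIV t < 1"
  shows "hausdorff_outer_measure t (limit_set X \<phi>) = 0"
proof -
  let ?Z = "moran_sum (\<lambda>i. norm (a i)) UNIV t"
  define z where "z = enn2real ?Z"
  have zZ: "?Z = ennreal z" using Z by (simp add: z_def less_top order_less_trans[OF Z])
  have z: "0 \<le> z" "z < 1" using Z unfolding zZ by (auto simp: z_def) 
  define D where "D = diameter X"
  have D: "0 \<le> D" unfolding D_def by (intro diameter_ge_0 compact_imp_bounded X_compact)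
  let ?p = "\<lambda>w. prod_list (map (\<lambda>i. norm (a i)) w)"
  have p0: "0 \<le> ?p w" for w by (induction w) auto
  have pq: "?p w \<le> q ^ length w" for w
    by (induction w) (auto intro!: mult_mono a_le p0 simp: q_pos less_imp_le)
  let ?T = "\<lambda>w. word_map \<phi> w ` X"
  have T: "bounded (?T w) \<and> diameter (?T w) \<le> ?p w * D" for w
  proof -
    obtain d where d: "\<forall>x\<in>X. word_map \<phi> w x = prod_list (map a w) * x + d \<and> word_map \<phi> w x \<in> X"
      using word_map_\<phi> by blast
    have sub: "?T w \<subseteq> X" using d by blast
    have "norm (x - y) \<le> ?p w * D" if "x \<in> ?T w" "y \<in> ?T w" for x y
    proof -
      obtain x' where x': "x' \<in> X" "x = word_map \<phi> w x'" using \<open>x \<in> ?T w\<close> by (rule imageE)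
      obtain y' where y': "y' \<in> X" "y = word_map \<phi> w y'" using \<open>y \<in> ?T w\<close> by (rule imageE)
      note * = x'(1) y'(1) x'(2) y'(2)
      have "x - y = prod_list (map a w) * (x' - y')" using * d by (simp add: algebra_simps)
      then have "norm (x - y) = ?p w * dist x' y'" by (simp add: norm_mult norm_prod_list dist_norm)
      moreover have "dist x' y' \<le> D" unfolding D_def
        using * by (intro diameter_bounded_bound compact_imp_bounded X_compact)
      ultimately show ?thesis using p0 by (simp add: mult_left_mono)
    qed
    moreover have "bounded (?T w)"
      using bounded_subset[OF compact_imp_bounded[OF X_compact] sub] .
    ultimately show ?thesis using D p0 by (intro conjI diameter_le) auto
  qed
  have pre: "hausdorff_premeasure \<delta> t (limit_set X \<phi>) \<le> ennreal (D powr t * z ^ n)"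
    if n: "1 \<le> n" "q ^ n * D \<le> \<delta>" for n \<delta>
  proof -
    let ?W = "{w :: nat list. length w = n}"
    \<comment> \<open>Covers are indexed by the natural numbers, so the words of length n are to be
      enumerated bijectively; there are infinitely many because n \<ge> 1.\<close>
    have "infinite ?W"
    proof
      assume "finite ?W"
      moreover have "range (\<lambda>i. replicate n i) \<subseteq> ?W" by auto
      ultimately have "finite (range (\<lambda>i::nat. replicate n i))" by (rule rev_finite_subset)
      moreover have "inj (\<lambda>i::nat. replicate n i)" using n(1) by (auto simp: inj_on_def replicate_eq_replicate)
      ultimately show False using finite_imageD infinite_UNIV_nat by blast
    qed
    then have bij: "bij_betw (from_nat_into ?W) UNIV ?W"
      by (intro bij_betw_from_nat_into countableI_type)
    have inW: "length (from_nat_into ?W i) = n" for i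
      using bij by (auto simp: bij_betw_def)
    have "hausdorff_premeasure \<delta> t (limit_set X \<phi>) \<le> (\<Sum>i. ennreal (diameter (?T (from_nat_into ?W i)) powr t))"
      unfolding hausdorff_premeasure_def
    proof (intro INF_lower CollectI conjI allI)
      show "limit_set X \<phi> \<subseteq> (\<Union>i. ?T (from_nat_into ?W i))"
      proof
        fix x assume "x \<in> limit_set X \<phi>"
        then obtain \<omega> where "x \<in> (\<Inter>n\<in>{1..}. word_map \<phi> (map \<omega> [0..<n]) ` X)"
          unfolding limit_set_def by (rule UN_E)
        then have x: "x \<in> word_map \<phi> (map \<omega> [0..<n]) ` X" by (rule INT_D) (use n(1) in simp)
        have "map \<omega> [0..<n] \<in> range (from_nat_into ?W)"
          unfolding bij_betw_imp_surj_on[OF bij] by simp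
        then obtain i where i: "map \<omega> [0..<n] = from_nat_into ?W i" by (rule rangeE)
        show "x \<in> (\<Union>i. ?T (from_nat_into ?W i))"
          by (rule UN_I[where a = i]) (use x i in simp_all)
      qed
      fix i show "bounded (?T (from_nat_into ?W i))" using T by blast
      have "diameter (?T (from_nat_into ?W i)) \<le> ?p (from_nat_into ?W i) * D" using T by blast
      also have "\<dots> \<le> q ^ n * D" using pq[of "from_nat_into ?W i"] inW D by (simp add: mult_right_mono)
      finally show "diameter (?T (from_nat_into ?W i)) \<le> \<delta>" using n by simp
    qed
    also have "\<dots> \<le> (\<Sum>\<^sub>\<infinity>i. ennreal (diameter (?T (from_nat_into ?W i)) powr t))"
      by (rule suminf_le_infsum_ennreal)
    also have "\<dots> = (\<Sum>\<^sub>\<infinity>w\<in>?W. ennreal (diameter (?T w) powr t))"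
      by (rule infsum_reindex_bij_betw[OF bij])
    also have "\<dots> \<le> ennreal (D powr t) * partition_sum X UNIV \<phi> n t"
    proof (rule infsum_ennreal_le)
      fix G assume G: "finite G" "G \<subseteq> ?W"
      have "(\<Sum>w\<in>G. ennreal (diameter (?T w) powr t)) \<le> (\<Sum>w\<in>G. ennreal (D powr t) * ennreal (?p w powr t))"
      proof (rule sum_mono)
        fix w
        have "diameter (?T w) powr t \<le> (?p w * D) powr t"
          using T t by (intro powr_mono2) (auto intro!: diameter_ge_0)
        also have "\<dots> = D powr t * ?p w powr t" using p0 D by (simp add: powr_mult)
        finally show "ennreal (diameter (?T w) powr t) \<le> ennreal (D powr t) * ennreal (?p w powr t)"
          by (simp add: ennreal_leI flip: ennreal_mult)
      qed
      also have "\<dots> = ennreal (D powr t) * (\<Sum>w\<in>G. ennreal (?p w powr t))" by (rule sum_distrib_left[symmetric])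
      also have "\<dots> \<le> ennreal (D powr t) * partition_sum X UNIV \<phi> n t"
        unfolding partition_sum_def deriv_sup_norm_word using G
        by (intro mult_left_mono sum_le_infsum_ennreal) auto
      finally show "(\<Sum>w\<in>G. ennreal (diameter (?T w) powr t)) \<le> ennreal (D powr t) * partition_sum X UNIV \<phi> n t" .
    qed
    also have "\<dots> = ennreal (D powr t * z ^ n)"
      unfolding partition_sum_eq zZ using z by (simp add: ennreal_mult ennreal_power)
    finally show ?thesis .
  qed
  have "hausdorff_premeasure \<delta> t (limit_set X \<phi>) \<le> 0" if \<delta>: "0 < \<delta>" for \<delta>
  proof (rule LIMSEQ_le_const)
    have "(\<lambda>n. D powr t * z ^ n) \<longlonglongrightarrow> D powr t * 0"
      using z by (intro tendsto_intros LIMSEQ_power_zero) auto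
    then show "(\<lambda>n. ennreal (D powr t * z ^ n)) \<longlonglongrightarrow> 0"
      using tendsto_ennrealI by fastforce
    have "(\<lambda>n. q ^ n * D) \<longlonglongrightarrow> 0 * D"
      using q q_pos by (intro tendsto_intros LIMSEQ_power_zero) auto
    then have "\<forall>\<^sub>F n in sequentially. q ^ n * D < \<delta>" using \<delta> by (intro order_tendstoD) auto
    then obtain N where "\<forall>n\<ge>N. q ^ n * D < \<delta>" unfolding eventually_sequentially by blast
    then show "\<exists>N. \<forall>n\<ge>N. hausdorff_premeasure \<delta> t (limit_set X \<phi>) \<le> ennreal (D powr t * z ^ n)"
      by (intro exI[of _ "max 1 N"]) (auto intro!: pre simp: less_imp_le)
  qed
  then show ?thesis unfolding hausdorff_outer_measure_def
    by (intro antisym SUP_least) auto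
qed

text \<open>Only the inequalities on the two sides of s enter, not the value at s. Hence it applies
  also to irregular systems, whose sum is infinite below s and less than 1 from s on.\<close>

theorem h_dim_eqI:
  assumes s: "0 \<le> s" and low: "\<And>t. 0 < t \<Longrightarrow> t < s \<Longrightarrow> 1 < moran_sum (\<lambda>i. norm (a i)) UNIV t"
    and up: "\<And>t. s < t \<Longrightarrow> moran_sum (\<lambda>i. norm (a i)) UNIV t < 1"
  shows "h_dim X \<phi> = s"
  unfolding h_dim_def hausdorff_dim_def
proof (rule cInf_eq)
  fix t assume t: "t \<in> {t. 0 < t \<and> hausdorff_outer_measure t (limit_set X \<phi>) = 0}"
  show "s \<le> t"
  proof (rule ccontr)
    assume "\<not> s \<le> t"
    then have "1 < moran_sum (\<lambda>i. norm (a i)) UNIV t" using low t by simp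
    \<comment> \<open>A supremum of finite sums that exceeds 1 does so already on a finite
      subsystem, to which the lower bound applies.\<close>
    then obtain F where F: "finite F" "1 < (\<Sum>i\<in>F. ennreal (norm (a i) powr t))"
      unfolding moran_sum_def infsum_ennreal_SUP less_SUP_iff by auto
    then have "1 < ennreal (\<Sum>i\<in>F. norm (a i) powr t)" by (simp add: sum_ennreal)
    then have "1 \<le> (\<Sum>i\<in>F. norm (a i) powr t)"
      by simp
    then show False using hausdorff_outer_measure_pos[OF F(1), of t] t by simp
  qed
next
  fix y assume y: "\<And>t. t \<in> {t. 0 < t \<and> hausdorff_outer_measure t (limit_set X \<phi>) = 0} \<Longrightarrow> y \<le> t"
  show "y \<le> s"
  proof (rule ccontr)
    assume "\<not> y \<le> s"
    then have "s < (s + y) / 2" "(s + y) / 2 < y" by auto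
    with hausdorff_outer_measure_zero[of "(s + y) / 2"] up s y[of "(s + y) / 2"] show False by auto
  qed
qed

end

section \<open>Moran sums and regularity\<close>

text \<open>Extension by 0 turns an unordered sum over an index set into a series, which is the form
  needed for the Weierstrass test and for splitting off initial segments.\<close>

lemma infsum_restrict_nat:
  fixes g :: "nat \<Rightarrow> real"
  assumes "\<And>i. 0 \<le> g i"
  shows "g summable_on I \<longleftrightarrow> summable (\<lambda>i. if i \<in> I then g i else 0)"
    and "g summable_on I \<Longrightarrow> infsum g I = (\<Sum>i. if i \<in> I then g i else 0)"
proof -
  let ?h = "\<lambda>i. if i \<in> I then g i else 0"
  have "g summable_on I \<longleftrightarrow> ?h summable_on UNIV"
    by (rule summable_on_cong_neutral) auto
  also have "\<dots> \<longleftrightarrow> summable ?h"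
    using assms by (intro summable_on_UNIV_nonneg_real_iff) auto
  finally show iff: "g summable_on I \<longleftrightarrow> summable ?h" .
  have inf: "infsum g I = infsum ?h UNIV"
    by (rule infsum_cong_neutral) auto
  assume "g summable_on I"
  then have "summable ?h" using iff by simp
  then have "(?h has_sum suminf ?h) UNIV"
    by (intro norm_summable_imp_has_sum) (use assms in \<open>auto simp: summable_sums if_distrib[of abs] cong: if_cong\<close>)
  then show "infsum g I = suminf ?h" unfolding inf by (rule infsumI)
qed

lemma moran_sum_finite_iff: "moran_sum c I t < \<infinity> \<longleftrightarrow> (\<lambda>i. c i powr t) summable_on I"
proof
  assume "moran_sum c I t < \<infinity>"
  then show "(\<lambda>i. c i powr t) summable_on I"
    unfolding moran_sum_def by (rule summable_on_if_infsum_ennreal_finite) simp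
next
  assume "(\<lambda>i. c i powr t) summable_on I"
  then have "moran_sum c I t = ennreal (\<Sum>\<^sub>\<infinity>i\<in>I. c i powr t)"
    unfolding moran_sum_def by (rule infsum_ennreal_eq) simp
  then show "moran_sum c I t < \<infinity>" by simp
qed

lemma moran_sum_eq:
  assumes "(\<lambda>i. c i powr t) summable_on I"
  shows "moran_sum c I t = ennreal (\<Sum>\<^sub>\<infinity>i\<in>I. c i powr t)"
  unfolding moran_sum_def using assms by (rule infsum_ennreal_eq) simp

lemma moran_sum_UNIV_eq:
  assumes "summable (\<lambda>i. c i powr t)"
  shows "moran_sum c UNIV t = ennreal (\<Sum>i. c i powr t)"
  using moran_sum_eq[of c t UNIV] infsum_restrict_nat[of "\<lambda>i. c i powr t" UNIV] assms by simp

lemma moran_sum_UNIV_finite_iff: "moran_sum c UNIV t < \<infinity> \<longleftrightarrow> summable (\<lambda>i. c i powr t)"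
  unfolding moran_sum_finite_iff using infsum_restrict_nat(1)[of "\<lambda>i. c i powr t" UNIV] by simp

section \<open>Decay, roots and tails of Moran sums\<close>

locale contraction_ratios =
  fixes c :: "nat \<Rightarrow> real" and q :: real
  assumes c_pos: "\<And>i. 0 < c i" and c_le: "\<And>i. c i \<le> q" and q_less: "q < 1"
begin

abbreviation "Z \<equiv> moran_sum c"

lemma q_pos: "0 < q"
  using c_pos[of 0] c_le[of 0] by simp

text \<open>All ratios are at most q, so raising the exponent gains a factor that is uniform in the
  index. From this come both the strict passage through the value 1 and the decay to 0.\<close>

lemma moran_sum_decay:
  assumes "t \<le> t'"
  shows "Z I t' \<le> ennreal (q powr (t' - t)) * Z I t"
  unfolding moran_sum_def
proof (rule infsum_ennreal_le)
  fix F assume F: "finite F" "F \<subseteq> I"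
  have "(\<Sum>i\<in>F. ennreal (c i powr t')) \<le> (\<Sum>i\<in>F. ennreal (q powr (t' - t)) * ennreal (c i powr t))"
  proof (rule sum_mono)
    fix i
    have "c i powr t' = c i powr (t' - t) * c i powr t" by (simp flip: powr_add)
    also have "\<dots> \<le> q powr (t' - t) * c i powr t"
      using assms c_pos[of i] c_le[of i] by (intro mult_right_mono powr_mono2) auto
    finally show "ennreal (c i powr t') \<le> ennreal (q powr (t' - t)) * ennreal (c i powr t)"
      by (simp add: ennreal_leI flip: ennreal_mult)
  qed
  also have "\<dots> = ennreal (q powr (t' - t)) * (\<Sum>i\<in>F. ennreal (c i powr t))"
    by (rule sum_distrib_left[symmetric])
  also have "\<dots> \<le> ennreal (q powr (t' - t)) * (\<Sum>\<^sub>\<infinity>i\<in>I. ennreal (c i powr t))"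
    using F by (intro mult_left_mono sum_le_infsum_ennreal) auto
  finally show "(\<Sum>i\<in>F. ennreal (c i powr t'))
      \<le> ennreal (q powr (t' - t)) * (\<Sum>\<^sub>\<infinity>i\<in>I. ennreal (c i powr t))" .
qed

lemma moran_sum_less_1:
  assumes "t < t'" "Z I t \<le> 1"
  shows "Z I t' < 1"
proof -
  have "Z I t' \<le> ennreal (q powr (t' - t)) * Z I t" using assms by (intro moran_sum_decay) auto
  also have "\<dots> \<le> ennreal (q powr (t' - t)) * 1" using assms by (intro mult_left_mono) auto
  also have "\<dots> < 1" using assms q_less q_pos powr_less_mono2[of "t' - t" q 1] by simp
  finally show ?thesis .
qed

lemma moran_sum_gr_1:
  assumes "t < t'" "1 \<le> Z I t'"
  shows "1 < Z I t"
  using moran_sum_less_1[OF assms(1), of I] assms(2) by (metis leD leI)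

text \<open>Intermediate value theorem from t0 on: the terms decrease in t, so the convergent series
  at t0 dominates and the sum is continuous; the decay estimate brings it below 1.\<close>

lemma moran_sum_root:
  assumes fin: "Z I t0 < \<infinity>" and gr: "1 < Z I t0"
  shows "\<exists>t>t0. Z I t = 1"
proof -
  define g where "g i t = (if i \<in> I then c i powr t else 0)" for i t
  have ci: "0 < c i \<and> c i < 1" for i using c_pos[of i] c_le[of i] q_less by simp
  have sm0: "summable (\<lambda>i. g i t0)"
    using fin infsum_restrict_nat(1)[of "\<lambda>i. c i powr t0" I] unfolding moran_sum_finite_iff g_def by simp
  have le: "norm (g i t) \<le> g i t0" if "t0 \<le> t" for i t
    using powr_mono'[of t0 t "c i"] ci[of i] that by (auto simp: g_def)
  have unif: "uniform_limit {t0..} (\<lambda>n t. \<Sum>i<n. g i t) (\<lambda>t. \<Sum>i. g i t) sequentially"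
    by (rule Weierstrass_m_test[OF _ sm0]) (use le in auto)
  have g_cont: "continuous_on {t0..} (g i)" for i
    unfolding g_def using ci[of i] by (cases "i \<in> I") (auto intro!: continuous_intros)
  have cont: "continuous_on {t0..} (\<lambda>t. \<Sum>i. g i t)"
    by (rule uniform_limit_theorem[OF _ unif]) (auto intro!: always_eventually continuous_on_sum g_cont)
  have Z: "Z I t = ennreal (\<Sum>i. g i t)" if "t0 \<le> t" for t
  proof -
    have "summable (\<lambda>i. g i t)"
      by (rule summable_comparison_test'[OF sm0]) (use le[OF that] in auto)
    then have sI: "(\<lambda>i. c i powr t) summable_on I"
      using infsum_restrict_nat(1)[of "\<lambda>i. c i powr t" I] by (simp add: g_def)
    from moran_sum_eq[OF sI] show ?thesis
      using infsum_restrict_nat(2)[OF _ sI] by (simp add: g_def)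
  qed
  have S0: "1 < (\<Sum>i. g i t0)" using gr Z[of t0] by simp
  have "((\<lambda>T. q powr (T - t0) * (\<Sum>i. g i t0)) \<longlongrightarrow> 0 * (\<Sum>i. g i t0)) at_top"
  proof (intro tendsto_intros)
    have "filterlim (\<lambda>T. T - t0) at_top at_top"
      using filterlim_tendsto_add_at_top[OF tendsto_const[of "- t0"] filterlim_ident] by simp
    then have "((\<lambda>T. exp (ln q * (T - t0))) \<longlongrightarrow> 0) at_top"
      using q_pos q_less
      by (intro filterlim_compose[OF exp_at_bot] filterlim_tendsto_neg_mult_at_bot[OF tendsto_const]) auto
    then show "((\<lambda>T. q powr (T - t0)) \<longlongrightarrow> 0) at_top"
      using q_pos by (simp add: powr_def mult.commute)
  qed
  then have "\<forall>\<^sub>F T in at_top. q powr (T - t0) * (\<Sum>i. g i t0) < 1"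
    by (rule order_tendstoD) simp
  then have "\<forall>\<^sub>F T in at_top. q powr (T - t0) * (\<Sum>i. g i t0) < 1 \<and> t0 \<le> T"
    using eventually_ge_at_top by (rule eventually_conj)
  then obtain T where T: "q powr (T - t0) * (\<Sum>i. g i t0) < 1" "t0 \<le> T"
    using eventually_happens[of _ "at_top :: real filter"] by force
  have "ennreal (\<Sum>i. g i T) \<le> ennreal (q powr (T - t0)) * ennreal (\<Sum>i. g i t0)"
    using moran_sum_decay[OF T(2), of I] Z[OF T(2)] Z[of t0] by simp
  also have "\<dots> = ennreal (q powr (T - t0) * (\<Sum>i. g i t0))"
    using S0 by (intro ennreal_mult[symmetric]) auto
  also have "\<dots> < 1" using T by simp
  finally have ST: "(\<Sum>i. g i T) < 1" by simp
  have "\<exists>t\<ge>t0. t \<le> T \<and> (\<Sum>i. g i t) = 1"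
    using S0 ST T(2) by (intro IVT2' continuous_on_subset[OF cont]) auto
  then obtain t where t: "t0 \<le> t" "(\<Sum>i. g i t) = 1" by auto
  then have "t \<noteq> t0" using S0 by auto
  then show ?thesis using t Z[OF t(1)] by (intro exI[of _ t]) auto
qed

lemma moran_sum_mono_set: "I \<subseteq> J \<Longrightarrow> Z I t \<le> Z J t"
  unfolding moran_sum_def infsum_ennreal_SUP by (intro SUP_subset_mono) auto

lemma moran_sum_cofinite_finite:
  assumes "finite (- I)" "Z I t < \<infinity>"
  shows "Z UNIV t < \<infinity>"
proof -
  have "(\<lambda>i. c i powr t) summable_on I" "(\<lambda>i. c i powr t) summable_on - I"
    using assms unfolding moran_sum_finite_iff by (simp_all add: summable_on_finite)
  then have "(\<lambda>i. c i powr t) summable_on I \<union> - I"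
    by (rule summable_on_Un_disjoint) simp
  then show ?thesis unfolding moran_sum_finite_iff by simp
qed

text \<open>A tail is a cofinite subsystem. This one will witness the failure of cofinite
  regularity.\<close>

lemma moran_sum_small_tail:
  assumes "Z UNIV t < \<infinity>"
  shows "\<exists>n. Z {n..} t < 1"
proof -
  have sm: "summable (\<lambda>i. c i powr t)" using assms unfolding moran_sum_UNIV_finite_iff .
  then have "(\<lambda>n. \<Sum>i. c (i + n) powr t) \<longlonglongrightarrow> 0" by (rule suminf_exist_split2)
  then have "\<forall>\<^sub>F n in sequentially. (\<Sum>i. c (i + n) powr t) < 1" by (rule order_tendstoD) simp
  then obtain n where n: "(\<Sum>i. c (i + n) powr t) < 1"
    using eventually_happens[of _ sequentially] by auto
  let ?h = "\<lambda>i. if i \<in> {n..} then c i powr t else 0"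
  have smh: "summable ?h"
    by (rule summable_comparison_test'[OF sm, of 0]) auto
  have "suminf ?h = (\<Sum>i. ?h (i + n)) + sum ?h {..<n}" by (rule suminf_split_initial_segment[OF smh])
  also have "\<dots> = (\<Sum>i. c (i + n) powr t)" by simp
  finally have "suminf ?h < 1" using n by simp
  moreover have sI: "(\<lambda>i. c i powr t) summable_on {n..}"
    using smh infsum_restrict_nat(1)[of "\<lambda>i. c i powr t" "{n..}"] by simp
  from moran_sum_eq[OF sI] have "Z {n..} t = ennreal (suminf ?h)"
    using infsum_restrict_nat(2)[OF _ sI] by simp
  ultimately show ?thesis by (intro exI[of _ n]) simp
qed

text \<open>Two indices are enough: the sum of their powers tends to 2 as t decreases to 0.\<close>

lemma moran_sum_infinite_small_t:
  assumes "infinite I"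
  shows "\<exists>t>0. 1 < Z I t"
proof -
  obtain i where i: "i \<in> I" using assms by (metis ex_in_conv finite.emptyI)
  have "infinite (I - {i})" using assms by simp
  then obtain j where j: "j \<in> I" "j \<noteq> i" by (metis Diff_iff ex_in_conv finite.emptyI singletonI)
  have "((\<lambda>t. c i powr t + c j powr t) \<longlongrightarrow> c i powr 0 + c j powr 0) (at_right 0)"
    using c_pos[of i] c_pos[of j] by (intro tendsto_intros) auto
  then have "\<forall>\<^sub>F t in at_right 0. 1 < c i powr t + c j powr t"
    by (rule order_tendstoD) (use c_pos[of i] c_pos[of j] in auto)
  then have "\<forall>\<^sub>F t in at_right 0. 1 < c i powr t + c j powr t \<and> 0 < t"
    using eventually_at_right_less by (rule eventually_conj)
  then obtain t where t: "1 < c i powr t + c j powr t" "0 < t"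
    using eventually_happens[of _ "at_right (0::real)"] by force
  have "1 < ennreal (c i powr t + c j powr t)" using t(1) by (simp del: ennreal_plus)
  also have "\<dots> = (\<Sum>i\<in>{i,j}. ennreal (c i powr t))" using j(2) by simp
  also have "\<dots> \<le> Z I t" unfolding moran_sum_def using i j by (intro sum_le_infsum_ennreal) auto
  finally show ?thesis using t by blast
qed

end

section \<open>Regularity classes in terms of Moran sums\<close>

context affine_ifs
begin

sublocale ratios: contraction_ratios "\<lambda>i. norm (a i)" q
  using a_nz a_le q by unfold_locales auto

abbreviation "Z \<equiv> moran_sum (\<lambda>i. norm (a i))"

lemma regular_iff: "regular X I \<phi> \<longleftrightarrow> (\<exists>t\<ge>0. Z I t = 1)"
  unfolding regular_def pressure_eq ln_ext_simps ..

lemma theta_eqI: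
  assumes "0 \<le> \<theta>" and inf: "\<And>t. 0 \<le> t \<Longrightarrow> t < \<theta> \<Longrightarrow> Z UNIV t = \<infinity>"
    and fin: "\<And>t. \<theta> < t \<Longrightarrow> Z UNIV t < \<infinity>"
  shows "theta X \<phi> = \<theta>"
  unfolding theta_def pressure_eq ln_ext_simps
proof (rule cInf_eq)
  fix t assume t: "t \<in> {t. 0 \<le> t \<and> Z UNIV t < \<infinity>}"
  show "\<theta> \<le> t"
  proof (rule ccontr)
    assume "\<not> \<theta> \<le> t"
    then have "Z UNIV t = \<infinity>" using t inf[of t] by simp
    then show False using t by simp
  qed
next
  fix y assume y: "\<And>t. t \<in> {t. 0 \<le> t \<and> Z UNIV t < \<infinity>} \<Longrightarrow> y \<le> t"
  show "y \<le> \<theta>"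
  proof (rule dense_ge)
    fix t assume "\<theta> < t"
    then show "y \<le> t" using y[of t] fin[of t] assms(1) by simp
  qed
qed

lemma h_dim_root:
  assumes "0 \<le> t" "Z UNIV t = 1"
  shows "h_dim X \<phi> = t"
  using assms(1)
proof (rule h_dim_eqI)
  show "1 < Z UNIV t'" if "t' < t" for t'
    using ratios.moran_sum_gr_1[OF that, of UNIV] assms by simp
  show "Z UNIV t' < 1" if "t < t'" for t'
    using ratios.moran_sum_less_1[OF that, of UNIV] assms by simp
qed

text \<open>Over an infinite index set the sum exceeds 1 for some small t > 0, where it is still
  finite, so it has a root; cofinite index sets are infinite.\<close>

lemma cofinitely_regular:
  assumes fin: "\<And>t. 0 < t \<Longrightarrow> Z UNIV t < \<infinity>"
  shows "\<phi> \<in> CFR X" and "\<exists>t>0. Z UNIV t = 1" and "theta X \<phi> = 0"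
proof -
  have root: "\<exists>t>0. Z I t = 1" if "infinite I" for I
  proof -
    obtain t where t: "0 < t" "1 < Z I t" using ratios.moran_sum_infinite_small_t[OF \<open>infinite I\<close>] by auto
    have "Z I t < \<infinity>"
      using ratios.moran_sum_mono_set[of I UNIV t] fin[OF t(1)] by (rule le_less_trans) simp
    from ratios.moran_sum_root[OF this t(2)] obtain t' where "t < t'" "Z I t' = 1" by auto
    then show ?thesis using t(1) by (intro exI[of _ t']) auto
  qed
  then show "\<exists>t>0. Z UNIV t = 1" using infinite_UNIV_nat by blast
  have "regular X I \<phi>" if "finite (- I)" for I
  proof -
    have "infinite I" using that by (metis finite_compl infinite_UNIV_nat)
    then obtain t where "0 < t" "Z I t = 1" using root[of I] by auto
    then show ?thesis unfolding regular_iff by (intro exI[of _ t]) simp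
  qed
  then show "\<phi> \<in> CFR X" using in_CIFS by (simp add: CFR_def)
  show "theta X \<phi> = 0" using fin by (intro theta_eqI) auto
qed

end

text \<open>The sum jumps from infinity to a finite value at \<theta>. No root lies below \<theta>,
  and comparing the value at \<theta> with 1 decides the class of the system.\<close>

locale affine_ifs_critical = affine_ifs +
  fixes \<theta> :: real
  assumes \<theta>: "0 \<le> \<theta>"
    and Z_below: "\<And>t. t < \<theta> \<Longrightarrow> Z UNIV t = \<infinity>"
    and Z_crit: "Z UNIV \<theta> < \<infinity>"
begin

lemma Z_above: "Z UNIV t < \<infinity>" if "\<theta> \<le> t"
proof -
  have "Z UNIV t \<le> ennreal (q powr (t - \<theta>)) * Z UNIV \<theta>" using that by (rule ratios.moran_sum_decay)
  also have "\<dots> < \<infinity>" using Z_crit by (simp add: ennreal_mult_less_top)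
  finally show ?thesis .
qed

lemma theta_eq: "theta X \<phi> = \<theta>"
  using \<theta> by (intro theta_eqI Z_below Z_above) auto

lemma regular_UNIV_iff: "regular X UNIV \<phi> \<longleftrightarrow> 1 \<le> Z UNIV \<theta>"
proof
  assume "regular X UNIV \<phi>"
  then obtain t where t: "0 \<le> t" "Z UNIV t = 1" unfolding regular_iff by blast
  then have "\<theta> \<le> t" using Z_below[of t] by (cases "t < \<theta>") auto
  then show "1 \<le> Z UNIV \<theta>"
    using t ratios.moran_sum_gr_1[of \<theta> t UNIV] by (cases "t = \<theta>") (auto intro: less_imp_le)
next
  assume ge: "1 \<le> Z UNIV \<theta>"
  show "regular X UNIV \<phi>"
  proof (cases "Z UNIV \<theta> = 1")
    case False
    then have "1 < Z UNIV \<theta>" using ge by simp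
    from ratios.moran_sum_root[OF Z_crit this] obtain t where "\<theta> < t" "Z UNIV t = 1" by auto
    then show ?thesis using \<theta> unfolding regular_iff by (intro exI[of _ t]) simp
  qed (use \<theta> regular_iff in auto)
qed

text \<open>A suitable tail has sum below 1 at \<theta>, so it has no root from \<theta> on; below
  \<theta> its sum is infinite, because only finitely many maps were removed.\<close>

lemma not_in_CFR: "\<phi> \<notin> CFR X"
proof
  assume "\<phi> \<in> CFR X"
  obtain n where n: "Z {n..} \<theta> < 1" using ratios.moran_sum_small_tail[OF Z_crit] by blast
  have fin: "finite (- {n..})" by (simp add: Compl_atLeast)
  have "\<forall>I. I \<noteq> {} \<and> finite (- I) \<longrightarrow> regular X I \<phi>"
    using \<open>\<phi> \<in> CFR X\<close> unfolding CFR_def mem_Collect_eq by (rule conjunct2)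
  from this[THEN spec, of "{n..}"] fin have "regular X {n..} \<phi>" by simp
  then obtain t where t: "Z {n..} t = 1" unfolding regular_iff by blast
  have "\<theta> \<le> t"
  proof (rule ccontr)
    assume "\<not> \<theta> \<le> t"
    then have "Z UNIV t = \<infinity>" by (intro Z_below) simp
    then show False using ratios.moran_sum_cofinite_finite[OF fin, of t] t by simp
  qed
  then have "Z {n..} t < 1"
    using ratios.moran_sum_less_1[of \<theta> t "{n..}"] n by (cases "\<theta> = t") (auto intro: less_imp_le)
  then show False using t by simp
qed

lemma in_IR_iff: "\<phi> \<in> IR X \<longleftrightarrow> Z UNIV \<theta> < 1"
  using in_CIFS regular_UNIV_iff by (auto simp: IR_def)

lemma in_CR_iff: "\<phi> \<in> CR X \<longleftrightarrow> Z UNIV \<theta> = 1"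
  using in_CIFS regular_UNIV_iff by (auto simp: CR_def theta_eq pressure_eq ln_ext_simps)

lemma in_FSR_iff: "\<phi> \<in> FSR X \<longleftrightarrow> 1 < Z UNIV \<theta>"
proof
  assume "\<phi> \<in> FSR X"
  then obtain t where "0 < pressure X UNIV \<phi> t" "pressure X UNIV \<phi> t < \<infinity>"
    unfolding FSR_def SR_def by blast
  then have t: "1 < Z UNIV t" "Z UNIV t < \<infinity>" unfolding pressure_eq ln_ext_simps .
  then have "\<theta> \<le> t" using Z_below[of t] by (cases "t < \<theta>") auto
  then show "1 < Z UNIV \<theta>"
    using t ratios.moran_sum_gr_1[of \<theta> t UNIV] by (cases "t = \<theta>") (auto intro: less_imp_le)
next
  assume "1 < Z UNIV \<theta>"
  then have "0 < pressure X UNIV \<phi> \<theta>" "pressure X UNIV \<phi> \<theta> < \<infinity>"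
    using Z_crit unfolding pressure_eq ln_ext_simps by auto
  then show "\<phi> \<in> FSR X"
    using in_CIFS not_in_CFR \<theta> unfolding FSR_def SR_def by blast
qed

lemma h_dim_critical: "Z UNIV \<theta> \<le> 1 \<Longrightarrow> h_dim X \<phi> = \<theta>"
  using \<theta> Z_below ratios.moran_sum_less_1 by (intro h_dim_eqI) auto

lemma h_dim_supercritical:
  assumes "1 < Z UNIV \<theta>"
  shows "\<theta> < h_dim X \<phi>" "Z UNIV (h_dim X \<phi>) = 1"
proof -
  obtain t where t: "\<theta> < t" "Z UNIV t = 1"
    using ratios.moran_sum_root[OF Z_crit assms] by blast
  moreover have "h_dim X \<phi> = t" using t \<theta> by (intro h_dim_root) auto
  ultimately show "\<theta> < h_dim X \<phi>" "Z UNIV (h_dim X \<phi>) = 1" by auto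
qed

end

section \<open>Weights with prescribed critical exponent\<close>

text \<open>The weights are consecutive differences of \<open>ln m / ln (m + j)\<close>. They
  telescope to 1 and behave like a constant times \<open>1 / (j * (ln j)\<^sup>2)\<close>, so that
  every power below the first diverges.\<close>

lemma critical_weights:
  fixes \<epsilon> :: real
  assumes "0 < \<epsilon>"
  shows "\<exists>w::nat \<Rightarrow> real. (\<forall>i. 0 < w i \<and> w i \<le> \<epsilon>) \<and> w sums 1 \<and>
           (\<forall>\<tau><1. \<not> summable (\<lambda>i. w i powr \<tau>))"
proof -
  \<comment> \<open>The bound 3 makes all logarithms at least 1; the bound
    \<open>1 / \<epsilon>\<close> will make every weight at most
    \<open>1 / m \<le> \<epsilon>\<close>.\<close>
  define m where "m = max 3 (nat \<lceil>1 / \<epsilon>\<rceil>)"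
  have m3: "3 \<le> m" by (simp add: m_def)
  have "1 / \<epsilon> \<le> real m" unfolding m_def by linarith
  then have m\<epsilon>: "1 / real m \<le> \<epsilon>" using assms m3 by (simp add: field_simps)
  have "exp 1 \<le> (3::real)" by (rule exp_le)
  then have "1 \<le> ln (3::real)" by (simp add: ln_ge_iff)
  moreover have "ln 3 \<le> ln (real n)" if "3 \<le> n" for n
    using that by (subst ln_le_cancel_iff) auto
  ultimately have ln_ge: "1 \<le> ln (real n)" if "3 \<le> n" for n
    using that order_trans by blast
  have lnm: "1 \<le> ln (real m)" using m3 by (rule ln_ge)
  define f where "f j = ln (real m) / ln (real (m + j))" for j
  define w where "w j = f j - f (Suc j)" for j
  have "f \<longlonglongrightarrow> 0" unfolding f_def by real_asymp
  from telescope_sums'[OF this] have sums: "w sums 1" unfolding w_def using lnm by (simp add: f_def)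
  have w_eq: "w j = ln (real m) * ln (1 + 1 / real (m + j)) / (ln (real (m + j)) * ln (real (m + j + 1)))" for j
  proof -
    have "ln (1 + 1 / real (m + j)) = ln (real (m + j + 1) / real (m + j))"
      using m3 by (simp add: field_simps)
    also have "\<dots> = ln (real (m + j + 1)) - ln (real (m + j))" using m3 by (subst ln_div) auto
    finally have d: "ln (1 + 1 / real (m + j)) = ln (real (m + j + 1)) - ln (real (m + j))" .
    show ?thesis unfolding d w_def f_def
      using ln_ge[of "m + j"] ln_ge[of "m + j + 1"] m3 by (simp add: field_simps)
  qed
  have pos: "0 < w j" for j
    unfolding w_eq using ln_ge[of "m + j"] ln_ge[of "m + j + 1"] lnm m3 by (intro divide_pos_pos mult_pos_pos ln_gt_zero) auto
  have le: "w j \<le> 1 / real m" for j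
  proof -
    have "ln (1 + 1 / real (m + j)) \<le> 1 / real (m + j)" using m3 by (intro ln_add_one_self_le_self) auto
    also have "\<dots> \<le> 1 / real m" using m3 by (simp add: frac_le)
    finally have 1: "ln (1 + 1 / real (m + j)) \<le> 1 / real m" .
    have "ln (real m) \<le> ln (real (m + j))" using m3 by simp
    also have "\<dots> \<le> ln (real (m + j)) * ln (real (m + j + 1))"
      using ln_ge[of "m + j"] ln_ge[of "m + j + 1"] m3 mult_left_mono[of 1 "ln (real (m + j + 1))" "ln (real (m + j))"] by simp
    finally have 2: "ln (real m) / (ln (real (m + j)) * ln (real (m + j + 1))) \<le> 1"
      using ln_ge[of "m + j"] ln_ge[of "m + j + 1"] m3 by (intro divide_le_eq_1_pos[THEN iffD2] mult_pos_pos) auto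
    have "w j = ln (real m) / (ln (real (m + j)) * ln (real (m + j + 1))) * ln (1 + 1 / real (m + j))"
      unfolding w_eq by simp
    also have "\<dots> \<le> 1 * (1 / real m)"
      using 1 2 m3 by (intro mult_mono) auto
    finally show ?thesis by simp
  qed
  have nsum0: "\<not> summable (\<lambda>i. w i powr \<tau>)" if \<tau>: "0 < \<tau>" "\<tau> < 1" for \<tau>
  proof
    assume sm: "summable (\<lambda>i. w i powr \<tau>)"
    define C where "C = ln (real m)"
    define M where "M = real m"
    have C: "C > 0" using lnm by (simp add: C_def)
    \<comment> \<open>The expression grows like \<open>j powr (1 - \<tau>)\<close> up to logarithms,
      so the harmonic series is eventually a minorant.\<close>
    have "filterlim (\<lambda>j. real j * (C * ln (1 + 1 / (M + real j)) / (ln (M + real j) * ln (M + real j + 1))) powr \<tau>)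
        at_top at_top"
      using C \<tau> by real_asymp
    then have "\<forall>\<^sub>F j in at_top. 1 \<le> real j * w j powr \<tau>"
      unfolding w_eq filterlim_at_top C_def M_def by (simp add: add.assoc add.commute[of _ 1])
    then have "\<forall>\<^sub>F j in sequentially. norm (1 / real j) \<le> w j powr \<tau>"
      using eventually_gt_at_top[of 0] by eventually_elim (simp add: field_simps)
    then have "summable (\<lambda>j. 1 / real j)" using sm by (rule summable_comparison_test_ev)
    then show False using not_summable_harmonic[where 'a = real] by (simp add: inverse_eq_divide)
  qed
  \<comment> \<open>Exponents below 1/2, in particular nonpositive ones, are reduced to 1/2: the
    weights are at most 1, so a larger exponent gives smaller terms.\<close>
  have "\<not> summable (\<lambda>i. w i powr \<tau>)" if \<tau>: "\<tau> < 1" for \<tau>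
  proof
    assume sm: "summable (\<lambda>i. w i powr \<tau>)"
    have "w i \<le> 1" for i using le[of i] m3 by (simp add: order_trans[OF le])
    then have "norm (w i powr max \<tau> (1/2)) \<le> w i powr \<tau>" for i
      using pos[of i] powr_mono'[of \<tau> "max \<tau> (1/2)" "w i"] by (simp add: less_imp_le)
    then have "summable (\<lambda>i. w i powr max \<tau> (1/2))"
      by (intro summable_comparison_test'[OF sm]) auto
    then show False using nsum0[of "max \<tau> (1/2)"] \<tau> by auto
  qed
  then show ?thesis
    using pos le m\<epsilon> sums by (intro exI[of _ w] conjI allI) (auto intro: order_trans)
qed

section \<open>Roots of Moran equations along a line\<close>

lemma sums_strict_less:
  fixes f g :: "nat \<Rightarrow> real"
  assumes "f sums A" "g sums B" "\<And>i. f i \<le> g i" "f j < g j"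
  shows "A < B"
proof -
  have d: "(\<lambda>i. g i - f i) sums (B - A)" using assms by (intro sums_diff)
  have "0 < (\<Sum>i. g i - f i)"
    using assms by (intro suminf_pos2[of _ j] sums_summable[OF d]) auto
  then show ?thesis using sums_unique[OF d] by simp
qed

lemma exp_midpoint_strict:
  assumes "a \<noteq> b"
  shows "exp ((a + b) / 2) < (exp a + exp (b::real)) / 2"
proof -
  have "0 < (exp (a / 2) - exp (b / 2))\<^sup>2" using assms by simp
  also have "\<dots> = exp a + exp b - 2 * exp ((a + b) / 2)"
    by (simp add: power2_eq_square algebra_simps add_divide_distrib flip: exp_add)
  finally show ?thesis by simp
qed

lemma exp_midpoint: "exp ((a + b) / 2) \<le> (exp a + exp (b::real)) / 2"
  using exp_midpoint_strict[of a b] by (cases "a = b") auto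

text \<open>Jensen's inequality from nested midpoints. The weights 1/4, 1/4 and 1/2 belong to the
  two ends of a chord of the parabola and to one further point.\<close>

lemma exp_convex3:
  "exp (x / 4 + y / 4 + z / 2) \<le> exp x / 4 + exp y / 4 + exp (z::real) / 2"
proof -
  have "exp (x / 4 + y / 4 + z / 2) = exp (((x + y) / 2 + z) / 2)" by (simp add: field_simps)
  also have "\<dots> \<le> (exp ((x + y) / 2) + exp z) / 2" by (rule exp_midpoint)
  also have "\<dots> \<le> ((exp x + exp y) / 2 + exp z) / 2" using exp_midpoint[of x y] by simp
  finally show ?thesis by (simp add: add_divide_distrib)
qed

text \<open>The set \<open>{(A, B). (\<Sum>i. exp (A * p i + B * r i)) \<le> 1}\<close> is convex and, since
  \<open>h * p i + h\<^sup>2 * r i < 0\<close>, contains with \<open>(h, h\<^sup>2)\<close> the outward part of the ray through it in its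
  interior. But this ray runs below the parabola and chords of the parabola run above it, so an
  arc of the parabola cannot lie on the boundary.\<close>

lemma no_parabola_arc:
  fixes p r :: "nat \<Rightarrow> real"
  assumes sums: "\<And>h. h0 - \<eta> < h \<Longrightarrow> h < h0 + \<eta> \<Longrightarrow> (\<lambda>i. exp (h * p i + h\<^sup>2 * r i)) sums 1"
    and neg: "\<And>h i. h0 - \<eta> < h \<Longrightarrow> h < h0 + \<eta> \<Longrightarrow> h * p i + h\<^sup>2 * r i < 0"
    and h0: "0 < h0" and \<eta>: "0 < \<eta>"
  shows False
proof -
  \<comment> \<open>Half of the minimum keeps the ends of the chord on the arc and makes
    \<open>h'\<close> below positive.\<close>
  define \<epsilon> where "\<epsilon> = min \<eta> h0 / 2"
  have \<epsilon>: "0 < \<epsilon>" "\<epsilon> < \<eta>" "\<epsilon> < h0" using h0 \<eta> by (auto simp: \<epsilon>_def)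
  \<comment> \<open>Chosen so that stretching \<open>(h', h'\<^sup>2)\<close> by
    \<open>h0 / h'\<close> gives \<open>(h0, h0\<^sup>2 - \<epsilon>\<^sup>2)\<close>. The chord
    over \<open>h0 - \<epsilon>\<close> and \<open>h0 + \<epsilon>\<close> has midpoint
    \<open>(h0, h0\<^sup>2 + \<epsilon>\<^sup>2)\<close>, so the point of the parabola at h0 is the
    mean of these two.\<close>
  define h' where "h' = h0 - \<epsilon>\<^sup>2 / h0"
  have "\<epsilon>\<^sup>2 / h0 < \<epsilon>" using \<epsilon> h0 by (simp add: field_simps power2_eq_square)
  then have h': "h0 - \<eta> < h'" "h' < h0" "0 < h'"
    using \<epsilon> h0 by (auto simp: h'_def)
  define L where "L h i = h * p i + h\<^sup>2 * r i" for h i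
  have strict: "exp (L h0 i) < exp (L (h0 - \<epsilon>) i) / 4 + exp (L (h0 + \<epsilon>) i) / 4 + exp (L h' i) / 2" for i
  proof -
    have "h0 * h' = h0\<^sup>2 - \<epsilon>\<^sup>2" using h0 by (simp add: h'_def field_simps power2_eq_square)
    then have hh: "h0 / h' * h'\<^sup>2 = h0\<^sup>2 - \<epsilon>\<^sup>2" using h' by (simp add: power2_eq_square)
    have "h0 / h' * L h' i = (h0 / h' * h') * p i + (h0 / h' * h'\<^sup>2) * r i"
      by (simp only: L_def distrib_left mult.assoc)
    also have "\<dots> = h0 * p i + (h0\<^sup>2 - \<epsilon>\<^sup>2) * r i" unfolding hh using h' by simp
    finally have Lh': "h0 / h' * L h' i = h0 * p i + (h0\<^sup>2 - \<epsilon>\<^sup>2) * r i" .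
    have "L h0 i = L (h0 - \<epsilon>) i / 4 + L (h0 + \<epsilon>) i / 4 + (h0 / h' * L h' i) / 2"
      by (subst Lh') (simp add: L_def power2_eq_square field_simps)
    \<comment> \<open>Stretching a negative exponent by a factor above 1 lowers it; this is the
      source of strictness.\<close>
    moreover have "h0 / h' * L h' i < 1 * L h' i"
      using neg[of h' i] h' \<eta> unfolding L_def by (intro mult_strict_right_mono_neg) auto
    ultimately have "L h0 i < L (h0 - \<epsilon>) i / 4 + L (h0 + \<epsilon>) i / 4 + L h' i / 2" by simp
    then have "exp (L h0 i) < exp (L (h0 - \<epsilon>) i / 4 + L (h0 + \<epsilon>) i / 4 + L h' i / 2)" by simp
    also note exp_convex3
    finally show ?thesis .
  qed
  have R: "(\<lambda>i. exp (L (h0 - \<epsilon>) i) / 4 + exp (L (h0 + \<epsilon>) i) / 4 + exp (L h' i) / 2) sums (1 / 4 + 1 / 4 + 1 / 2)"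
    unfolding L_def using \<epsilon> h' \<eta> by (intro sums_add sums_divide sums) auto
  have "(\<lambda>i. exp (L h0 i)) sums 1" unfolding L_def using \<eta> by (intro sums) auto
  from sums_strict_less[OF this R less_imp_le[OF strict] strict[of 0]] show False by simp
qed

text \<open>If the root \<alpha> * x + \<beta> is constant, strict convexity of exp in x refutes a
  nonzero coefficient. Otherwise x is an affine function of the root h, each exponent becomes a
  quadratic polynomial in h without constant term, and the roots trace an arc of a parabola.\<close>

lemma affine_root_constant_coefficients:
  fixes \<kappa> \<mu> :: "nat \<Rightarrow> real"
  assumes sums: "\<And>x. \<bar>x - x0\<bar> < r \<Longrightarrow> (\<lambda>i. exp ((\<alpha> * x + \<beta>) * (\<mu> i + \<kappa> i * x))) sums 1"
    and neg: "\<And>x i. \<bar>x - x0\<bar> < r \<Longrightarrow> \<mu> i + \<kappa> i * x < 0"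
    and pos: "\<And>x. \<bar>x - x0\<bar> < r \<Longrightarrow> 0 < \<alpha> * x + \<beta>" and r: "0 < r"
  shows "\<kappa> j = 0"
proof (rule ccontr)
  assume \<kappa>: "\<kappa> j \<noteq> 0"
  show False
  proof (cases "\<alpha> = 0")
    case True
    have \<beta>: "0 < \<beta>" using pos[of x0] r True by simp
    define g where "g x i = exp (\<beta> * (\<mu> i + \<kappa> i * x))" for x i
    have s: "g x sums 1" if "\<bar>x - x0\<bar> < r" for x
      using sums[OF that] unfolding g_def True by simp
    have mid: "g x0 i = exp ((\<beta> * (\<mu> i + \<kappa> i * (x0 - r/2)) + \<beta> * (\<mu> i + \<kappa> i * (x0 + r/2))) / 2)" for i
      unfolding g_def by (simp add: algebra_simps)
    have le: "g x0 i \<le> g (x0 - r/2) i / 2 + g (x0 + r/2) i / 2" for i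
    proof -
      note mid[of i]
      also note exp_midpoint
      finally show ?thesis by (simp add: g_def add_divide_distrib)
    qed
    have less: "g x0 j < g (x0 - r/2) j / 2 + g (x0 + r/2) j / 2"
      using exp_midpoint_strict[of "\<beta> * (\<mu> j + \<kappa> j * (x0 - r/2))" "\<beta> * (\<mu> j + \<kappa> j * (x0 + r/2))"]
        \<beta> \<kappa> r unfolding mid by (simp add: g_def add_divide_distrib)
    have "(\<lambda>i. g (x0 - r/2) i / 2 + g (x0 + r/2) i / 2) sums (1/2 + 1/2)"
      using r by (intro sums_add sums_divide s) auto
    from sums_strict_less[OF s this le less] r show False by simp
  next
    case False
    define p where "p i = \<mu> i - \<kappa> i * \<beta> / \<alpha>" for i
    define s where "s i = \<kappa> i / \<alpha>" for i
    define h0 where "h0 = \<alpha> * x0 + \<beta>"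
    define \<eta> where "\<eta> = \<bar>\<alpha>\<bar> * r"
    have x: "\<exists>x. \<bar>x - x0\<bar> < r \<and> h = \<alpha> * x + \<beta> \<and> (\<forall>i. h * p i + h\<^sup>2 * s i = (\<alpha> * x + \<beta>) * (\<mu> i + \<kappa> i * x))"
      if "h0 - \<eta> < h" "h < h0 + \<eta>" for h
    proof (intro exI[of _ "(h - \<beta>) / \<alpha>"] conjI allI)
      have "\<bar>h - h0\<bar> < \<bar>\<alpha>\<bar> * r" using that by (auto simp: \<eta>_def abs_less_iff)
      moreover have "(h - \<beta>) / \<alpha> - x0 = (h - h0) / \<alpha>" using False by (simp add: h0_def field_simps)
      ultimately show "\<bar>(h - \<beta>) / \<alpha> - x0\<bar> < r" using False by (simp add: abs_divide field_simps)
      show "h = \<alpha> * ((h - \<beta>) / \<alpha>) + \<beta>" using False by simp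
      show "h * p i + h\<^sup>2 * s i = (\<alpha> * ((h - \<beta>) / \<alpha>) + \<beta>) * (\<mu> i + \<kappa> i * ((h - \<beta>) / \<alpha>))" for i
        using False by (simp add: p_def s_def power2_eq_square field_simps)
    qed
    show False
    proof (rule no_parabola_arc[of h0 \<eta> p s])
      show "0 < h0" using pos[of x0] r by (simp add: h0_def)
      show "0 < \<eta>" using False r by (simp add: \<eta>_def)
    next
      fix h assume "h0 - \<eta> < h" "h < h0 + \<eta>"
      then obtain x where *: "\<bar>x - x0\<bar> < r" "\<forall>i. h * p i + h\<^sup>2 * s i = (\<alpha> * x + \<beta>) * (\<mu> i + \<kappa> i * x)"
        using x by blast
      show "(\<lambda>i. exp (h * p i + h\<^sup>2 * s i)) sums 1" using sums[OF *(1)] *(2) by simp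
      show "h * p i + h\<^sup>2 * s i < 0" for i
        using neg[OF *(1), of i] pos[OF *(1)] *(2) by (simp add: mult_pos_neg)
    qed
  qed
qed

section \<open>Lipschitz dependence and analyticity of roots\<close>

lemma root_upper_Lipschitz:
  fixes \<kappa> \<mu> :: "nat \<Rightarrow> real"
  assumes sx: "(\<lambda>i. exp (h * (\<mu> i + \<kappa> i * x))) sums 1" and sy: "(\<lambda>i. exp (h' * (\<mu> i + \<kappa> i * y))) sums 1"
    and h: "0 \<le> h" and \<kappa>: "\<And>i. \<bar>\<kappa> i\<bar> \<le> 1"
    and Lx: "\<And>i. \<mu> i + \<kappa> i * x \<le> - L" and Ly: "\<And>i. \<mu> i + \<kappa> i * y \<le> - L"
    and L: "0 < L" and d: "\<bar>x - y\<bar> \<le> L / 2"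
  shows "h' \<le> h + 2 * h / L * \<bar>x - y\<bar>"
proof (rule ccontr)
  \<comment> \<open>If \<open>h'\<close> exceeded \<open>h + \<tau>\<close>, each term at y would be
    strictly below the corresponding term at x, although both series sum to 1. Moving from x to y
    raises an exponent by at most \<open>h * \<bar>x - y\<bar>\<close>, and the gain
    \<open>\<tau> * L\<close> is twice that.\<close>
  define \<tau> where "\<tau> = 2 * h / L * \<bar>x - y\<bar>"
  have \<tau>: "0 \<le> \<tau>" using h L by (simp add: \<tau>_def)
  assume "\<not> ?thesis"
  then have less: "h + \<tau> < h'" by (simp add: \<tau>_def)
  have lt: "h' * (\<mu> i + \<kappa> i * y) < h * (\<mu> i + \<kappa> i * x)" for i
  proof -
    have "\<kappa> i * (y - x) \<le> \<bar>\<kappa> i\<bar> * \<bar>y - x\<bar>" by (metis abs_ge_self abs_mult)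
    also have "\<dots> \<le> \<bar>x - y\<bar>" using \<kappa>[of i] mult_right_mono[of "\<bar>\<kappa> i\<bar>" 1 "\<bar>y - x\<bar>"] by (simp add: abs_minus_commute)
    finally have k: "\<mu> i + \<kappa> i * y \<le> (\<mu> i + \<kappa> i * x) + \<bar>x - y\<bar>" by (simp add: algebra_simps)
    have "h' * (\<mu> i + \<kappa> i * y) < (h + \<tau>) * (\<mu> i + \<kappa> i * y)"
      using less Ly[of i] L by (intro mult_strict_right_mono_neg) auto
    also have "\<dots> = h * (\<mu> i + \<kappa> i * y) + \<tau> * (\<mu> i + \<kappa> i * y)" by (simp add: distrib_right)
    also have "\<dots> \<le> h * (\<mu> i + \<kappa> i * x + \<bar>x - y\<bar>) + \<tau> * (- L)"
      using mult_left_mono[OF k h] mult_left_mono[OF Ly[of i] \<tau>] by (rule add_mono)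
    also have "\<dots> = h * (\<mu> i + \<kappa> i * x) - h * \<bar>x - y\<bar>" using L by (simp add: \<tau>_def algebra_simps)
    also have "\<dots> \<le> h * (\<mu> i + \<kappa> i * x)" using h by simp
    finally show ?thesis .
  qed
  have "(1::real) < 1"
    by (rule sums_strict_less[OF sy sx, of 0]) (use lt in \<open>auto intro: less_imp_le\<close>)
  then show False by simp
qed

lemma root_Lipschitz:
  fixes \<kappa> \<mu> :: "nat \<Rightarrow> real"
  assumes sx: "(\<lambda>i. exp (h * (\<mu> i + \<kappa> i * x))) sums 1" and sy: "(\<lambda>i. exp (h' * (\<mu> i + \<kappa> i * y))) sums 1"
    and h: "0 \<le> h" "0 \<le> h'" and \<kappa>: "\<And>i. \<bar>\<kappa> i\<bar> \<le> 1"
    and Lx: "\<And>i. \<mu> i + \<kappa> i * x \<le> - L" and Ly: "\<And>i. \<mu> i + \<kappa> i * y \<le> - L"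
    and L: "0 < L" and d: "\<bar>x - y\<bar> \<le> L / 2"
  shows "\<bar>h' - h\<bar> \<le> 4 * h / L * \<bar>y - x\<bar>"
proof -
  have 1: "h' \<le> h + 2 * h / L * \<bar>x - y\<bar>" by (rule root_upper_Lipschitz[OF sx sy h(1) \<kappa> Lx Ly L d])
  have 2: "h \<le> h' + 2 * h' / L * \<bar>x - y\<bar>"
    using root_upper_Lipschitz[OF sy sx h(2) \<kappa> Ly Lx L] d by (simp add: abs_minus_commute)
  \<comment> \<open>Within distance L / 2 the root at most doubles, which removes \<open>h'\<close>
    from the constant.\<close>
  have "2 * h / L * \<bar>x - y\<bar> \<le> 2 * h / L * (L / 2)" using d h L by (intro mult_left_mono) auto
  then have "h' \<le> 2 * h" using 1 L by simp
  then have "2 * h' / L * \<bar>x - y\<bar> \<le> 4 * h / L * \<bar>x - y\<bar>"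
    using L by (intro mult_right_mono divide_right_mono) auto
  moreover have "2 * h / L * \<bar>x - y\<bar> \<le> 4 * h / L * \<bar>x - y\<bar>"
    using L h by (intro mult_right_mono divide_right_mono) auto
  ultimately show ?thesis using 1 2 by (simp add: abs_le_iff abs_minus_commute)
qed

text \<open>As the \<mu> i are nonpositive, the modulus of a term is largest where the real part of
  h is smallest; on a closed disc the convergent series at its leftmost point dominates.\<close>

lemma dirichlet_holomorphic:
  fixes \<mu> :: "nat \<Rightarrow> real"
  assumes \<mu>: "\<And>i. \<mu> i \<le> 0" and sm: "\<And>t. \<theta> < t \<Longrightarrow> summable (\<lambda>i. exp (t * \<mu> i))"
  shows "(\<lambda>h. \<Sum>i. exp (h * complex_of_real (\<mu> i))) holomorphic_on {h. \<theta> < Re h}"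
proof (rule holomorphic_uniform_sequence[OF open_halfspace_Re_gt])
  show "(\<lambda>h. \<Sum>i<n. exp (h * complex_of_real (\<mu> i))) holomorphic_on {h. \<theta> < Re h}" for n
    by (intro holomorphic_intros)
next
  fix z assume z: "z \<in> {h. \<theta> < Re h}"
  define d where "d = (Re z - \<theta>) / 2"
  have d: "0 < d" using z by (simp add: d_def)
  have le: "Re z - d \<le> Re h" if "h \<in> cball z d" for h
  proof -
    have "\<bar>Re (z - h)\<bar> \<le> norm (z - h)" by (rule abs_Re_le_cmod)
    then show ?thesis using that by (simp add: dist_norm)
  qed
  have "\<theta> < Re z - d" using d by (simp add: d_def field_simps)
  then have sm': "summable (\<lambda>i. exp ((Re z - d) * \<mu> i))" by (rule sm)
  show "\<exists>d>0. cball z d \<subseteq> {h. \<theta> < Re h} \<and>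
      uniform_limit (cball z d) (\<lambda>n h. \<Sum>i<n. exp (h * complex_of_real (\<mu> i)))
        (\<lambda>h. \<Sum>i. exp (h * complex_of_real (\<mu> i))) sequentially"
  proof (intro exI[of _ d] conjI d)
    show "cball z d \<subseteq> {h. \<theta> < Re h}" using le \<open>\<theta> < Re z - d\<close> by fastforce
    show "uniform_limit (cball z d) (\<lambda>n h. \<Sum>i<n. exp (h * complex_of_real (\<mu> i)))
        (\<lambda>h. \<Sum>i. exp (h * complex_of_real (\<mu> i))) sequentially"
    proof (rule Weierstrass_m_test[OF _ sm'])
      fix i h assume "h \<in> cball z d"
      then have "Re h * \<mu> i \<le> (Re z - d) * \<mu> i" using \<mu>[of i] le by (intro mult_right_mono_neg) auto
      then show "norm (exp (h * complex_of_real (\<mu> i))) \<le> exp ((Re z - d) * \<mu> i)" by simp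
    qed
  qed
qed

text \<open>The Lipschitz bound on \<open>H\<close> forces \<open>deriv Y (H x0) \<noteq> 0\<close>, so \<open>H\<close> is the restriction of the
  holomorphic local inverse of \<open>Y\<close>.\<close>

lemma power_series_of_inverse:
  fixes H :: "real \<Rightarrow> real" and Y :: "complex \<Rightarrow> complex"
  assumes W: "open W" "complex_of_real (H x0) \<in> W" and Y: "Y holomorphic_on W"
    and inv: "\<And>x. \<bar>x - x0\<bar> < r \<Longrightarrow> Y (of_real (H x)) = of_real x"
    and lip: "\<And>x. \<bar>x - x0\<bar> < r \<Longrightarrow> \<bar>H x - H x0\<bar> \<le> K * \<bar>x - x0\<bar>" and r: "0 < r" "0 \<le> K"
  shows "\<exists>c \<rho>. 0 < \<rho> \<and> (\<forall>x. \<bar>x - x0\<bar> < \<rho> \<longrightarrow> ((\<lambda>n. c n * (x - x0) ^ n) has_sum H x) UNIV)"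
proof -
  define h0 where "h0 = complex_of_real (H x0)"
  have Yh0: "Y h0 = of_real x0" unfolding h0_def using inv[of x0] r by simp
  have "deriv Y h0 \<noteq> 0"
  proof
    assume D0: "deriv Y h0 = 0"
    have "(Y has_field_derivative 0) (at h0)"
      using holomorphic_derivI[OF Y W(1), of h0 UNIV] W(2) D0 by (simp add: h0_def)
    then have "(Y has_derivative (\<lambda>v. 0)) (at h0)" by (simp add: has_field_derivative_def lambda_zero)
    then have "\<forall>e>0. \<exists>d>0. \<forall>y. norm (y - h0) < d \<longrightarrow> norm (Y y - Y h0 - 0) \<le> e * norm (y - h0)"
      unfolding has_derivative_at_alt by blast
    then obtain d where d: "d > 0"
      "\<And>y. norm (y - h0) < d \<Longrightarrow> norm (Y y - Y h0) \<le> 1 / (2 * (K + 1)) * norm (y - h0)"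
      using r(2) by (metis (no_types, lifting) diff_zero divide_pos_pos mult_pos_pos zero_less_numeral zero_less_one add_nonneg_pos)
    \<comment> \<open>For this small step Y changes by at most \<open>1 / (2 * (K + 1))\<close>
      times the change of H, which is at most K times the step. So the step would be less than
      itself. Using K + 1 avoids a division by 0.\<close>
    define x where "x = x0 + min (r / 2) (d / (2 * (K + 1)))"
    have x: "x0 < x" "\<bar>x - x0\<bar> < r" using r d by (auto simp: x_def)
    have xd: "x - x0 \<le> d / (2 * (K + 1))" by (simp add: x_def)
    have "K * (x - x0) < d"
    proof -
      have "K * (x - x0) \<le> (K + 1) * (d / (2 * (K + 1)))"
        using xd x r by (intro mult_mono) auto
      also have "\<dots> = d / 2" using r by (simp add: field_simps)
      finally show ?thesis using d by simp
    qed
    then have "\<bar>H x - H x0\<bar> < d" using lip[OF x(2)] x(1) by simp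
    then have "norm (of_real (H x) - h0) < d" unfolding h0_def by (simp flip: of_real_diff)
    from d(2)[OF this] have "norm (complex_of_real x - of_real x0) \<le> 1 / (2 * (K + 1)) * norm (of_real (H x) - h0)"
      using inv[OF x(2)] Yh0 by simp
    then have "x - x0 \<le> 1 / (2 * (K + 1)) * \<bar>H x - H x0\<bar>"
      using x(1) unfolding h0_def by (simp flip: of_real_diff)
    also have "\<dots> \<le> 1 / (2 * (K + 1)) * (K * (x - x0))"
      using lip[OF x(2)] x(1) r by (intro mult_left_mono) auto
    also have "\<dots> < x - x0"
    proof -
      have "0 \<le> K * (x - x0)" using r x by simp
      then show ?thesis using r x by (simp add: field_simps)
    qed
    finally show False by simp
  qed
  then obtain s where s: "s > 0" "ball h0 s \<subseteq> W" "open (Y ` ball h0 s)" "inj_on Y (ball h0 s)"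
    using has_complex_derivative_locally_invertible[OF Y, of h0] W unfolding h0_def by metis
  obtain G where G: "G holomorphic_on (Y ` ball h0 s)" "\<And>z. z \<in> ball h0 s \<Longrightarrow> G (Y z) = z"
    using holomorphic_has_inverse[OF holomorphic_on_subset[OF Y s(2)] open_ball s(4)] by metis
  have "complex_of_real x0 \<in> Y ` ball h0 s" using Yh0 s(1) by (metis centre_in_ball imageI)
  then obtain \<rho>1 where \<rho>1: "\<rho>1 > 0" "ball (complex_of_real x0) \<rho>1 \<subseteq> Y ` ball h0 s"
    using s(3) open_contains_ball by metis
  define c where "c n = (deriv ^^ n) G (of_real x0) / fact n" for n
  have ser: "(\<lambda>n. c n * (w - of_real x0) ^ n) sums G w" if "w \<in> ball (of_real x0) \<rho>1" for w
    unfolding c_def by (rule holomorphic_power_series[OF holomorphic_on_subset[OF G(1) \<rho>1(2)] that])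
  \<comment> \<open>Three constraints: absolute convergence within half the radius of the Taylor
    series, validity of the hypotheses, and \<open>H x\<close> staying in the disc on which G
    inverts Y.\<close>
  define \<rho> where "\<rho> = min (\<rho>1 / 2) (min r (s / (K + 1)))"
  have \<rho>: "0 < \<rho>" using \<rho>1 r s by (auto simp: \<rho>_def)
  have "((\<lambda>n. Re (c n) * (x - x0) ^ n) has_sum H x) UNIV" if x: "\<bar>x - x0\<bar> < \<rho>" for x
  proof -
    have xr: "\<bar>x - x0\<bar> < r" "\<bar>x - x0\<bar> < \<rho>1 / 2" "\<bar>x - x0\<bar> < s / (K + 1)" using x by (auto simp: \<rho>_def)
    have "\<bar>H x - H x0\<bar> \<le> (K + 1) * \<bar>x - x0\<bar>" using lip[OF xr(1)] by (simp add: distrib_right)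
    also have "\<dots> < s" using xr(3) r by (simp add: field_simps)
    finally have "of_real (H x) \<in> ball h0 s" unfolding h0_def by (simp add: dist_real_def dist_commute abs_minus_commute)
    then have GH: "G (of_real x) = of_real (H x)" using G(2)[of "of_real (H x)"] inv[OF xr(1)] by simp
    have "of_real x \<in> ball (complex_of_real x0) \<rho>1"
      using xr(2) \<rho>1 by (simp add: dist_real_def abs_minus_commute)
    from ser[OF this] have "(\<lambda>n. c n * of_real (x - x0) ^ n) sums of_real (H x)" unfolding GH by simp
    \<comment> \<open>The Taylor coefficients of the inverse are complex a priori; at real x their
      real parts already give the real sum.\<close>
    then have "(\<lambda>n. Re (c n * of_real (x - x0) ^ n)) sums H x" using sums_Re by fastforce
    then have sumsH: "(\<lambda>n. Re (c n) * (x - x0) ^ n) sums H x"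
      by (simp flip: of_real_power)
    \<comment> \<open>Convergence at a point farther from the centre gives absolute convergence at
      x, as required for an unordered sum.\<close>
    have "of_real (x0 + \<rho>1 / 2) \<in> ball (complex_of_real x0) \<rho>1"
      using \<rho>1(1) by (simp only: mem_ball dist_of_real) (simp add: dist_real_def)
    from ser[OF this] have "summable (\<lambda>n. c n * (complex_of_real (\<rho>1 / 2)) ^ n)"
      by (auto dest: sums_summable)
    moreover have "norm (complex_of_real (x - x0)) < norm (complex_of_real (\<rho>1 / 2))"
      using xr \<rho>1 by (simp del: of_real_diff)
    ultimately have "summable (\<lambda>n. norm (c n * complex_of_real (x - x0) ^ n))" by (rule powser_insidea)
    then have "summable (\<lambda>n. norm (Re (c n) * (x - x0) ^ n))"
    proof (rule summable_comparison_test'[of _ 0])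
      fix n
      have "\<bar>Re (c n)\<bar> * \<bar>x - x0\<bar> ^ n \<le> norm (c n) * \<bar>x - x0\<bar> ^ n"
        by (intro mult_right_mono abs_Re_le_cmod) simp
      then show "norm (norm (Re (c n) * (x - x0) ^ n)) \<le> norm (c n * complex_of_real (x - x0) ^ n)"
        by (simp add: abs_mult norm_mult norm_power power_abs flip: of_real_diff)
    qed
    then show ?thesis using sumsH by (rule norm_summable_imp_has_sum)
  qed
  with \<rho> show ?thesis by (intro exI[of _ "\<lambda>n. Re (c n)"] exI[of _ \<rho>] conjI allI impI)
qed

text \<open>With S the Dirichlet series, the equation is \<open>f (h * x) = 1 / S h\<close>; a local
  inverse g of f turns it into \<open>x = g (1 / S h) / h\<close>, which is holomorphic in h. The
  function f is the factor through which x enters: exp for a single sign of \<kappa>,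
  \<open>exp z + exp (- z)\<close> for pairs of opposite signs.\<close>

lemma power_series_of_root:
  fixes H :: "real \<Rightarrow> real" and \<mu> :: "nat \<Rightarrow> real" and f :: "complex \<Rightarrow> complex"
  assumes \<mu>: "\<And>i. \<mu> i \<le> 0" and sm: "\<And>t. \<theta> < t \<Longrightarrow> summable (\<lambda>i. exp (t * \<mu> i))" and \<theta>: "0 \<le> \<theta>" "\<theta> < H x0"
    and f: "f holomorphic_on UNIV" "deriv f (of_real (H x0 * x0)) \<noteq> 0"
    and root: "\<And>x. \<bar>x - x0\<bar> < r \<Longrightarrow> f (of_real (H x * x)) * of_real (\<Sum>i. exp (H x * \<mu> i)) = 1"
    and lip: "\<And>x. \<bar>x - x0\<bar> < r \<Longrightarrow> \<bar>H x - H x0\<bar> \<le> K * \<bar>x - x0\<bar>" and r: "0 < r" "0 \<le> K"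
  shows "\<exists>c \<rho>. 0 < \<rho> \<and> (\<forall>x. \<bar>x - x0\<bar> < \<rho> \<longrightarrow> ((\<lambda>n. c n * (x - x0) ^ n) has_sum H x) UNIV)"
proof -
  define S where "S h = (\<Sum>i. exp (h * complex_of_real (\<mu> i)))" for h
  have S: "S holomorphic_on {h. \<theta> < Re h}"
    unfolding S_def using \<mu> sm by (rule dirichlet_holomorphic)
  have S_real: "S (of_real t) = of_real (\<Sum>i. exp (t * \<mu> i))" if "\<theta> < t" for t
  proof -
    have "(\<lambda>i. exp (t * \<mu> i)) sums (\<Sum>i. exp (t * \<mu> i))" using sm[OF that] by (rule summable_sums)
    then have "(\<lambda>i. complex_of_real (exp (t * \<mu> i))) sums of_real (\<Sum>i. exp (t * \<mu> i))"
      by (rule sums_of_real)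
    then show ?thesis unfolding S_def by (simp add: exp_of_real sums_unique[symmetric] flip: of_real_mult)
  qed
  define y0 where "y0 = complex_of_real (H x0 * x0)"
  obtain s where s: "s > 0" "open (f ` ball y0 s)" "inj_on f (ball y0 s)"
    using has_complex_derivative_locally_invertible[OF f(1), of y0] f(2) unfolding y0_def by auto
  obtain g where g: "g holomorphic_on (f ` ball y0 s)" "\<And>z. z \<in> ball y0 s \<Longrightarrow> g (f z) = z"
    using holomorphic_has_inverse[OF holomorphic_on_subset[OF f(1) subset_UNIV] open_ball s(3)] by metis
  \<comment> \<open>On \<open>W0\<close> the reciprocal of S makes sense, and on the smaller W its
    values lie where g is defined.\<close>
  define W0 where "W0 = {h. \<theta> < Re h} \<inter> S -` (- {0})"
  have W0: "open W0" unfolding W0_def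
    by (intro continuous_open_preimage holomorphic_on_imp_continuous_on S open_halfspace_Re_gt) auto
  have invS: "(\<lambda>h. 1 / S h) holomorphic_on W0"
    by (intro holomorphic_intros holomorphic_on_subset[OF S]) (auto simp: W0_def)
  define W where "W = W0 \<inter> (\<lambda>h. 1 / S h) -` (f ` ball y0 s)"
  have W: "open W" unfolding W_def
    by (intro continuous_open_preimage holomorphic_on_imp_continuous_on invS W0 s(2))
  have Y: "(\<lambda>h. g (1 / S h) / h) holomorphic_on W"
  proof (intro holomorphic_on_divide holomorphic_on_ident)
    show "h \<noteq> 0" if "h \<in> W" for h using that \<theta> by (auto simp: W_def W0_def)
    have "(g \<circ> (\<lambda>h. 1 / S h)) holomorphic_on W"
      by (rule holomorphic_on_compose_gen[OF holomorphic_on_subset[OF invS] g(1)]) (auto simp: W_def)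
    then show "(\<lambda>h. g (1 / S h)) holomorphic_on W" by (simp add: o_def)
  qed
  \<comment> \<open>The Lipschitz bound gives the continuity that keeps \<open>H x * x\<close> in
    the disc on which f is inverted.\<close>
  have lim: "H \<midarrow>x0\<rightarrow> H x0"
  proof (rule LIM_zero_cancel, rule Lim_null_comparison)
    have "((\<lambda>x. K * \<bar>x - x0\<bar>) \<longlongrightarrow> K * \<bar>x0 - x0\<bar>) (at x0)" by (intro tendsto_intros)
    then show "((\<lambda>x. K * \<bar>x - x0\<bar>) \<longlongrightarrow> 0) (at x0)" by simp
    show "\<forall>\<^sub>F x in at x0. norm (H x - H x0) \<le> K * \<bar>x - x0\<bar>"
      unfolding eventually_at using lip r by (intro exI[of _ r]) (auto simp: dist_real_def)
  qed
  have "\<forall>\<^sub>F x in at x0. \<theta> < H x" using lim \<theta>(2) by (rule order_tendstoD)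
  moreover have "((\<lambda>x. complex_of_real (H x * x)) \<longlongrightarrow> y0) (at x0)"
    unfolding y0_def by (intro tendsto_intros lim)
  then have "\<forall>\<^sub>F x in at x0. dist (complex_of_real (H x * x)) y0 < s" using s(1) by (rule tendstoD)
  ultimately have "\<forall>\<^sub>F x in at x0. \<theta> < H x \<and> dist (complex_of_real (H x * x)) y0 < s"
    by (rule eventually_conj)
  then obtain r' where r': "0 < r'"
    "\<And>x. x \<noteq> x0 \<Longrightarrow> dist x x0 < r' \<Longrightarrow> \<theta> < H x \<and> dist (complex_of_real (H x * x)) y0 < s"
    unfolding eventually_at by auto
  have near: "\<theta> < H x \<and> complex_of_real (H x * x) \<in> ball y0 s" if "\<bar>x - x0\<bar> < r'" for x
    using r'(2)[of x] that \<theta> s(1) by (cases "x = x0") (auto simp: dist_real_def y0_def dist_commute)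
  have key: "of_real (H x) \<in> W \<and> g (1 / S (of_real (H x))) / of_real (H x) = of_real x"
    if x: "\<bar>x - x0\<bar> < min r r'" for x
  proof -
    have *: "\<theta> < H x" "complex_of_real (H x * x) \<in> ball y0 s" "f (of_real (H x * x)) * S (of_real (H x)) = 1"
      using near[of x] root[of x] x S_real[of "H x"] by auto
    then have nz: "S (of_real (H x)) \<noteq> 0" by auto
    then have eq: "1 / S (of_real (H x)) = f (of_real (H x * x))"
      using *(3) by (simp add: field_simps)
    have "of_real (H x) \<in> W" unfolding W_def W0_def using * nz eq by auto
    moreover have "g (1 / S (of_real (H x))) = of_real (H x * x)" unfolding eq using g(2)[OF *(2)] .
    ultimately show ?thesis using *(1) \<theta>(1) by simp
  qed
  have m: "0 < min r r'" using r r' by simp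
  show ?thesis
    by (rule power_series_of_inverse[OF W _ Y _ lip m r(2)]) (use key m in auto)
qed

section \<open>The unit disc as a parameter space\<close>

definition coord :: "complex \<Rightarrow> cvec" where
  "coord \<gamma> = (\<lambda>i. if i = 0 then \<gamma> else 0)"

definition disc :: "complex cmanifold" where
  "disc = \<lparr>mtop = top_of_set (ball 0 1), mdim = 1, matlas = {(ball 0 1, coord)}\<rparr>"

lemma disc_simps [simp]:
  "mtop disc = top_of_set (ball 0 1)" "mdim disc = 1" "matlas disc = {(ball 0 1, coord)}"
  by (simp_all add: disc_def)

lemma coord_0 [simp]: "coord \<gamma> 0 = \<gamma>"
  by (simp add: coord_def)

lemma inj_coord: "inj_on coord A"
  by (rule inj_onI) (metis coord_0)

lemma inv_coord [simp]: "\<gamma> \<in> ball 0 1 \<Longrightarrow> inv_into (ball 0 1) coord (coord \<gamma>) = \<gamma>"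
  by (rule inv_into_f_f[OF inj_coord])

lemma Cspace_1: "z \<in> Cspace 1 \<longleftrightarrow> z = coord (z 0)"
proof
  assume z: "z \<in> Cspace 1"
  show "z = coord (z 0)"
  proof
    fix i show "z i = coord (z 0) i" using z by (cases i) (auto simp: Cspace_def coord_def)
  qed
next
  assume z: "z = coord (z 0)"
  have "z i = 0" if "1 \<le> i" for i using fun_cong[OF z, of i] that by (simp add: coord_def)
  then show "z \<in> Cspace 1" by (simp add: Cspace_def)
qed

lemma coord_in_Cspace [simp]: "coord \<gamma> \<in> Cspace 1" "coord \<gamma> \<in> Cspace (Suc 0)"
  using Cspace_1[of "coord \<gamma>"] by simp_all

lemma coord_image: "coord ` T = Cspace 1 \<inter> (\<lambda>z. z 0) -` T"
proof (intro equalityI subsetI)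
  fix z assume z: "z \<in> Cspace 1 \<inter> (\<lambda>z. z 0) -` T"
  then have "z = coord (z 0)" using Cspace_1 by auto
  then show "z \<in> coord ` T" using z by auto
qed auto

lemma continuous_on_coord: "continuous_on A coord"
proof (rule continuous_on_coordinatewise_then_product)
  show "continuous_on A (\<lambda>x. coord x i)" for i
    by (cases "i = 0") (simp_all add: coord_def continuous_on_id)
qed

lemma continuous_on_eval_0: "continuous_on A (\<lambda>z::cvec. z 0)"
  by (rule continuous_on_subset[OF continuous_on_product_coordinates]) simp

lemma homeomorphic_map_coord:
  "homeomorphic_map (top_of_set T) (top_of_set (coord ` T)) coord"
  unfolding homeomorphic_map_maps
proof (rule exI[of _ "\<lambda>z. z 0"])
  show "homeomorphic_maps (top_of_set T) (top_of_set (coord ` T)) coord (\<lambda>z. z 0)"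
    unfolding homeomorphic_maps_def
    by (auto simp: continuous_map_in_subtopology continuous_on_coord continuous_on_eval_0)
qed

lemma Cdist_coord [simp]: "Cdist (Suc 0) (coord \<gamma>) (coord \<gamma>') = dist \<gamma> \<gamma>'"
  by (simp add: Cdist_def lessThan_Suc)

lemma complex_manifold_disc: "complex_manifold disc"
  unfolding complex_manifold_def
proof (intro conjI)
  show "Hausdorff_space (mtop disc)" by (simp add: Hausdorff_space_subtopology)
  have "second_countable (euclidean :: complex topology)"
  proof -
    obtain \<B> :: "complex set set" where B: "countable \<B>" "topological_basis \<B>"
      using ex_countable_basis by blast
    show ?thesis unfolding second_countable_def
    proof (intro exI[of _ \<B>] conjI B(1) ballI allI impI)
      show "openin euclidean V" if "V \<in> \<B>" for V
        using topological_basis_open[OF B(2) that] by simp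
      show "\<exists>V\<in>\<B>. x \<in> V \<and> V \<subseteq> U" if "openin euclidean U \<and> x \<in> U" for U x
        using topological_basisE[OF B(2), of U x] that by auto
    qed
  qed
  then show "second_countable (mtop disc)" by (simp add: second_countable_subtopology)
  show "(\<Union>(U, \<kappa>)\<in>matlas disc. U) = topspace (mtop disc)" by simp
  have "openin (top_of_set (Cspace 1)) (coord ` ball 0 1)"
    unfolding coord_image by (rule continuous_openin_preimage_gen[OF continuous_on_eval_0 open_ball])
  then show "\<forall>(U, \<kappa>)\<in>matlas disc.
        openin (mtop disc) U \<and> openin (top_of_set (Cspace (mdim disc))) (\<kappa> ` U) \<and>
        homeomorphic_map (subtopology (mtop disc) U) (top_of_set (\<kappa> ` U)) \<kappa>"
    using homeomorphic_map_coord[of "ball 0 1"] by (simp add: subtopology_subtopology)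
  show "\<forall>(U, \<kappa>)\<in>matlas disc. \<forall>(U', \<kappa>')\<in>matlas disc. \<forall>j<mdim disc.
        holomorphic_Cn (mdim disc) (\<kappa> ` (U \<inter> U')) (\<lambda>z. \<kappa>' (inv_into U \<kappa> z) j)"
  proof (simp, unfold holomorphic_Cn_def, intro ballI exI allI impI conjI)
    fix z w :: cvec and \<epsilon> :: real
    assume "0 < \<epsilon>" "z \<in> coord ` ball 0 1" "w \<in> coord ` ball 0 1"
    then show "norm (inv_into (ball 0 1) coord w - inv_into (ball 0 1) coord z - (\<Sum>i<Suc 0. 1 * (w i - z i)))
        \<le> \<epsilon> * Cdist (Suc 0) z w"
      by (auto simp: lessThan_Suc)
  qed simp
qed

lemma connected_complex_manifold_disc: "connected_complex_manifold disc"
  unfolding connected_complex_manifold_def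
  by (simp add: complex_manifold_disc connected_space_subtopology)

text \<open>The parameter is coordinate 0 and the space variable is coordinate 1. Under this
  renaming \<open>Cdist\<close> is the norm of the product, so a complex linear derivative on pairs
  is what the coordinate notion asks for.\<close>

lemma holomorphic_on_product_disc:
  assumes T: "T \<subseteq> ball 0 1"
    and D: "\<And>\<gamma> x. \<gamma> \<in> T \<Longrightarrow> x \<in> V \<Longrightarrow>
      ((\<lambda>(\<gamma>, x). F \<gamma> x) has_derivative (\<lambda>(u, v). A \<gamma> x * u + B \<gamma> x * v)) (at (\<gamma>, x))"
  shows "holomorphic_on_product disc T V F"
proof -
  let ?W = "{z \<in> Cspace 2. z(1 := 0) \<in> coord ` (ball 0 1 \<inter> T) \<and> z 1 \<in> V}"
  have upd: "z(1 := 0) = coord (z 0)" if "z \<in> Cspace 2" for z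
  proof
    fix i show "(z(1 := 0)) i = coord (z 0) i"
      using that by (cases "i = 0"; cases "i = 1") (auto simp: Cspace_def coord_def)
  qed
  have W: "z 0 \<in> T \<and> z 1 \<in> V \<and> inv_into (ball 0 1) coord (z(1 := 0)) = z 0" if z: "z \<in> ?W" for z
  proof -
    have eq: "z(1 := 0) = coord (z 0)" using z by (intro upd) simp
    have "z(1 := 0) \<in> coord ` (ball 0 1 \<inter> T)" using z by blast
    then have "coord (z 0) \<in> coord ` (ball 0 1 \<inter> T)" unfolding eq .
    then have "z 0 \<in> ball 0 1 \<inter> T" using inj_coord[of UNIV] by (simp add: inj_image_mem_iff)
    then show ?thesis using z eq by simp
  qed
  have "holomorphic_Cn 2 ?W (\<lambda>z. F (inv_into (ball 0 1) coord (z(1 := 0))) (z 1))"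
    unfolding holomorphic_Cn_def
  proof
    fix z assume z: "z \<in> ?W"
    define a where "a i = (if i = 0 then A (z 0) (z 1) else B (z 0) (z 1))" for i :: nat
    have "((\<lambda>(\<gamma>, x). F \<gamma> x) has_derivative (\<lambda>(u, v). A (z 0) (z 1) * u + B (z 0) (z 1) * v)) (at (z 0, z 1))"
      using W[OF z] by (intro D) auto
    then have alt: "\<forall>e>0. \<exists>d>0. \<forall>y. norm (y - (z 0, z 1)) < d \<longrightarrow>
        norm ((\<lambda>(\<gamma>, x). F \<gamma> x) y - (\<lambda>(\<gamma>, x). F \<gamma> x) (z 0, z 1)
          - (\<lambda>(u, v). A (z 0) (z 1) * u + B (z 0) (z 1) * v) (y - (z 0, z 1))) \<le> e * norm (y - (z 0, z 1))"
      unfolding has_derivative_at_alt by (rule conjunct2)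
    have nrm: "norm ((w 0, w 1) - (z 0, z 1)) = Cdist 2 z w" for w
      by (simp add: Cdist_def L2_set_def numeral_2_eq_2 lessThan_Suc norm_Pair dist_norm norm_minus_commute add.commute)
    have "\<exists>\<delta>>0. \<forall>w\<in>?W. Cdist 2 z w < \<delta> \<longrightarrow>
        norm (F (inv_into (ball 0 1) coord (w(1 := 0))) (w 1) - F (inv_into (ball 0 1) coord (z(1 := 0))) (z 1)
          - (\<Sum>i<2. a i * (w i - z i))) \<le> \<epsilon> * Cdist 2 z w" if \<epsilon>: "\<epsilon> > 0" for \<epsilon>
    proof -
      obtain d where d: "d > 0" "\<And>y. norm (y - (z 0, z 1)) < d \<Longrightarrow>
        norm ((\<lambda>(\<gamma>, x). F \<gamma> x) y - (\<lambda>(\<gamma>, x). F \<gamma> x) (z 0, z 1)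
          - (\<lambda>(u, v). A (z 0) (z 1) * u + B (z 0) (z 1) * v) (y - (z 0, z 1))) \<le> \<epsilon> * norm (y - (z 0, z 1))"
        using alt \<epsilon> by metis
      show ?thesis
      proof (intro exI[of _ d] conjI d(1) ballI impI)
        fix w assume w: "w \<in> ?W" "Cdist 2 z w < d"
        have Fw: "F (inv_into (ball 0 1) coord (w(1 := 0))) (w 1) = F (w 0) (w 1)"
          "F (inv_into (ball 0 1) coord (z(1 := 0))) (z 1) = F (z 0) (z 1)"
          using W[OF w(1)] W[OF z] by simp_all
        have "(\<Sum>i<2. a i * (w i - z i)) = A (z 0) (z 1) * (w 0 - z 0) + B (z 0) (z 1) * (w 1 - z 1)"
          by (simp add: a_def numeral_2_eq_2 lessThan_Suc add.commute)
        then show "norm (F (inv_into (ball 0 1) coord (w(1 := 0))) (w 1) - F (inv_into (ball 0 1) coord (z(1 := 0))) (z 1)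
          - (\<Sum>i<2. a i * (w i - z i))) \<le> \<epsilon> * Cdist 2 z w"
          using d(2)[of "(w 0, w 1)"] w(2) unfolding nrm Fw by simp
      qed
    qed
    then show "\<exists>a::nat \<Rightarrow> complex. \<forall>\<epsilon>>0. \<exists>\<delta>>0. \<forall>w\<in>?W. Cdist 2 z w < \<delta> \<longrightarrow>
        norm (F (inv_into (ball 0 1) coord (w(1 := 0))) (w 1) - F (inv_into (ball 0 1) coord (z(1 := 0))) (z 1)
          - (\<Sum>i<2. a i * (w i - z i))) \<le> \<epsilon> * Cdist 2 z w"
      by (intro exI[of _ a] allI impI)
  qed
  then show ?thesis by (simp add: holomorphic_on_product_def numeral_2_eq_2)
qed

section \<open>Real analyticity of functions of the real part\<close>

definition index1 :: "nat \<Rightarrow> nat \<Rightarrow> nat" where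
  "index1 n = (\<lambda>i. if i = 0 then n else 0)"

lemma multi_indices_1: "multi_indices (Suc 0) = range index1"
proof (intro equalityI subsetI)
  fix a assume a: "a \<in> multi_indices (Suc 0)"
  have "a = index1 (a 0)"
  proof
    fix i show "a i = index1 (a 0) i" using a by (cases i) (auto simp: multi_indices_def index1_def)
  qed
  then show "a \<in> range index1" by blast
qed (auto simp: multi_indices_def index1_def)

lemma index1_simps: "index1 n 0 = n" "index1 n = index1 m \<longleftrightarrow> n = m"
  by (auto simp: index1_def fun_eq_iff)

text \<open>The hypothesis is met in two ways: all coefficients with a positive power of the second
  coordinate vanish, or that coordinate is itself 0. Either way a series in one variable
  remains.\<close>

lemma has_sum_multi_indices_1:
  fixes c :: "(nat \<Rightarrow> nat) \<Rightarrow> (nat \<Rightarrow> nat) \<Rightarrow> real"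
  assumes "\<And>n m. m \<noteq> 0 \<Longrightarrow> c (index1 n) (index1 m) * (u ^ n * v ^ m) = 0"
  shows "((\<lambda>(a, b). c a b * (\<Prod>j<Suc 0. u ^ a j * v ^ b j)) has_sum S)
           (multi_indices (Suc 0) \<times> multi_indices (Suc 0))
         \<longleftrightarrow> ((\<lambda>n. c (index1 n) (index1 0) * u ^ n) has_sum S) UNIV"
proof -
  let ?g = "\<lambda>(a, b). c a b * (\<Prod>j<Suc 0. u ^ a j * v ^ b j)"
  let ?e = "\<lambda>n. (index1 n, index1 0)"
  have "(?g has_sum S) (multi_indices (Suc 0) \<times> multi_indices (Suc 0)) \<longleftrightarrow> (?g has_sum S) (range ?e)"
    using assms by (intro has_sum_cong_neutral) (auto simp: multi_indices_1 index1_simps image_iff)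
  also have "\<dots> \<longleftrightarrow> ((?g \<circ> ?e) has_sum S) UNIV"
    by (rule has_sum_reindex) (auto simp: inj_on_def index1_simps)
  also have "?g \<circ> ?e = (\<lambda>n. c (index1 n) (index1 0) * u ^ n)"
    by (auto simp: fun_eq_iff index1_simps)
  finally show ?thesis .
qed

lemma has_sum_constant_series:
  "((\<lambda>n. (if n = 0 then c else 0) * (x - x0) ^ n) has_sum c) UNIV" for c x x0 :: real
proof -
  have "((\<lambda>n. (if n = 0 then c else 0) * (x - x0) ^ n) has_sum c) UNIV
    \<longleftrightarrow> ((\<lambda>n. (if n = 0 then c else 0) * (x - x0) ^ n) has_sum c) {0}"
    by (rule has_sum_cong_neutral) auto
  then show ?thesis by (simp add: has_sum_finiteI)
qed

lemma RAH_discI: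
  assumes h: "\<And>\<gamma>. \<gamma> \<in> ball 0 1 \<Longrightarrow> Re \<gamma> \<in> T \<Longrightarrow> h_dim X (\<Phi> \<gamma>) = F (Re \<gamma>)"
    and T: "open T"
    and ser: "\<And>x0. x0 \<in> T \<Longrightarrow> \<bar>x0\<bar> < 1 \<Longrightarrow>
      \<exists>c \<rho>. 0 < \<rho> \<and> (\<forall>x. \<bar>x - x0\<bar> < \<rho> \<longrightarrow> ((\<lambda>n. c n * (x - x0) ^ n) has_sum F x) UNIV)"
    and \<gamma>0: "\<gamma>0 \<in> ball 0 1" "Re \<gamma>0 \<in> T"
  shows "\<gamma>0 \<in> RAH X disc \<Phi>"
proof -
  define G where "G = ball 0 1 \<inter> Re -` T"
  have "open (Re -` T)" by (rule open_vimage[OF T]) (intro continuous_intros)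
  then have "openin (mtop disc) G" unfolding G_def by (simp add: openin_open_Int)
  moreover have "\<gamma>0 \<in> G" using \<gamma>0 by (simp add: G_def)
  moreover have "real_analytic_Cn 1 (coord ` (ball 0 1 \<inter> G)) ((\<lambda>\<gamma>. h_dim X (\<Phi> \<gamma>)) \<circ> inv_into (ball 0 1) coord)"
    unfolding real_analytic_Cn_def
  proof
    fix z assume "z \<in> coord ` (ball 0 1 \<inter> G)"
    then obtain \<gamma> where z: "z = coord \<gamma>" and \<gamma>: "\<gamma> \<in> ball 0 1" "Re \<gamma> \<in> T" by (auto simp: G_def)
    have "\<bar>Re \<gamma>\<bar> < 1" using \<gamma>(1) abs_Re_le_cmod[of \<gamma>] by simp
    then obtain c \<rho> where c: "0 < \<rho>"
      "\<And>x. \<bar>x - Re \<gamma>\<bar> < \<rho> \<Longrightarrow> ((\<lambda>n. c n * (x - Re \<gamma>) ^ n) has_sum F x) UNIV"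
      using ser[OF \<gamma>(2)] by metis
    \<comment> \<open>The one-variable series read as a series in both real coordinates, without
      powers of the imaginary part.\<close>
    define C where "C a b = (if b = index1 0 then c (a 0) else 0)" for a b :: "nat \<Rightarrow> nat"
    have "((\<lambda>(a, b). C a b * (\<Prod>j<Suc 0. Re (w j - z j) ^ a j * Im (w j - z j) ^ b j)) has_sum
             ((\<lambda>\<gamma>. h_dim X (\<Phi> \<gamma>)) \<circ> inv_into (ball 0 1) coord) w) (multi_indices (Suc 0) \<times> multi_indices (Suc 0))"
      if w: "w \<in> coord ` (ball 0 1 \<inter> G)" "Cdist 1 z w < \<rho>" for w
    proof -
      obtain \<gamma>' where \<gamma>': "w = coord \<gamma>'" "\<gamma>' \<in> ball 0 1" "Re \<gamma>' \<in> T" using w(1) by (auto simp: G_def)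
      have "\<bar>Re \<gamma>' - Re \<gamma>\<bar> \<le> dist \<gamma> \<gamma>'"
        using abs_Re_le_cmod[of "\<gamma>' - \<gamma>"] by (simp add: dist_norm norm_minus_commute)
      then have "\<bar>Re \<gamma>' - Re \<gamma>\<bar> < \<rho>" using w(2) z \<gamma>'(1) by simp
      then have hs: "((\<lambda>n. c n * (Re \<gamma>' - Re \<gamma>) ^ n) has_sum F (Re \<gamma>')) UNIV" by (rule c(2))
      have val: "((\<lambda>\<gamma>. h_dim X (\<Phi> \<gamma>)) \<circ> inv_into (ball 0 1) coord) w = F (Re \<gamma>')"
        using \<gamma>' h by simp
      have "((\<lambda>(a, b). C a b * (\<Prod>j<Suc 0. (Re \<gamma>' - Re \<gamma>) ^ a j * (Im \<gamma>' - Im \<gamma>) ^ b j)) has_sum F (Re \<gamma>'))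
          (multi_indices (Suc 0) \<times> multi_indices (Suc 0))"
        using hs by (subst has_sum_multi_indices_1) (auto simp: C_def index1_simps)
      then show ?thesis unfolding val by (simp add: z \<gamma>'(1))
    qed
    then show "\<exists>c r. 0 < r \<and> (\<forall>w\<in>coord ` (ball 0 1 \<inter> G). Cdist 1 z w < r \<longrightarrow>
        ((\<lambda>(a, b). c a b * (\<Prod>j<1. Re (w j - z j) ^ a j * Im (w j - z j) ^ b j))
           has_sum ((\<lambda>\<gamma>. h_dim X (\<Phi> \<gamma>)) \<circ> inv_into (ball 0 1) coord) w) (multi_indices 1 \<times> multi_indices 1))"
      unfolding One_nat_def by (intro exI[of _ C] exI[of _ \<rho>] conjI c(1) ballI impI)
  qed
  ultimately show ?thesis using \<gamma>0 unfolding RAH_def real_analytic_on_def by auto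
qed

text \<open>On the horizontal line through the point an expansion would be a one-variable power
  series that equals \<theta> to the left of 0. It would then be constant, against the values to the
  right.\<close>

lemma not_RAH_disc:
  assumes h: "\<And>\<gamma>. \<gamma> \<in> ball 0 1 \<Longrightarrow> h_dim X (\<Phi> \<gamma>) = F (Re \<gamma>)"
    and neg: "\<And>x. - 1 < x \<Longrightarrow> x \<le> 0 \<Longrightarrow> F x = \<theta>" and pos: "\<And>x. 0 < x \<Longrightarrow> x < 1 \<Longrightarrow> F x \<noteq> \<theta>"
    and \<gamma>0: "\<gamma>0 \<in> ball 0 1" "Re \<gamma>0 = 0"
  shows "\<gamma>0 \<notin> RAH X disc \<Phi>"
proof
  assume "\<gamma>0 \<in> RAH X disc \<Phi>"
  then obtain G where G: "openin (top_of_set (ball 0 1)) G" "\<gamma>0 \<in> G"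
    "real_analytic_Cn 1 (coord ` (ball 0 1 \<inter> G)) ((\<lambda>\<gamma>. h_dim X (\<Phi> \<gamma>)) \<circ> inv_into (ball 0 1) coord)"
    unfolding RAH_def real_analytic_on_def by auto
  have "open G" using G(1) by (simp add: openin_open_eq)
  then obtain \<delta> where \<delta>: "\<delta> > 0" "ball \<gamma>0 \<delta> \<subseteq> G" using G(2) open_contains_ball by metis
  have G1: "G \<subseteq> ball 0 1" using openin_imp_subset[OF G(1)] .
  have "coord \<gamma>0 \<in> coord ` (ball 0 1 \<inter> G)" using G(2) \<gamma>0 by blast
  from G(3)[unfolded real_analytic_Cn_def, THEN bspec, OF this]
  obtain c r where c: "0 < r" "\<forall>w\<in>coord ` (ball 0 1 \<inter> G). Cdist 1 (coord \<gamma>0) w < r \<longrightarrow>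
        ((\<lambda>(a, b). c a b * (\<Prod>j<1. Re (w j - coord \<gamma>0 j) ^ a j * Im (w j - coord \<gamma>0 j) ^ b j))
           has_sum ((\<lambda>\<gamma>. h_dim X (\<Phi> \<gamma>)) \<circ> inv_into (ball 0 1) coord) w) (multi_indices 1 \<times> multi_indices 1)"
    by (elim exE conjE)
  define d where "d n = c (index1 n) (index1 0)" for n
  have ser: "(\<lambda>n. d n * t ^ n) sums F t" if t: "\<bar>t\<bar> < min r \<delta>" for t
  proof -
    define \<gamma> where "\<gamma> = \<gamma>0 + of_real t"
    have \<gamma>: "\<gamma> \<in> G" using t \<delta>(2) by (auto simp: \<gamma>_def dist_norm)
    then have "\<gamma> \<in> ball 0 1" using G1 by blast
    have "((\<lambda>(a, b). c a b * (\<Prod>j<1. Re (coord \<gamma> j - coord \<gamma>0 j) ^ a j * Im (coord \<gamma> j - coord \<gamma>0 j) ^ b j))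
           has_sum ((\<lambda>\<gamma>. h_dim X (\<Phi> \<gamma>)) \<circ> inv_into (ball 0 1) coord) (coord \<gamma>)) (multi_indices 1 \<times> multi_indices 1)"
    proof (rule c(2)[rule_format])
      show "coord \<gamma> \<in> coord ` (ball 0 1 \<inter> G)" using \<gamma> \<open>\<gamma> \<in> ball 0 1\<close> by blast
      show "Cdist 1 (coord \<gamma>0) (coord \<gamma>) < r" using t by (simp add: \<gamma>_def dist_norm)
    qed
    moreover have "((\<lambda>\<gamma>. h_dim X (\<Phi> \<gamma>)) \<circ> inv_into (ball 0 1) coord) (coord \<gamma>) = F t"
      using h[OF \<open>\<gamma> \<in> ball 0 1\<close>] \<open>\<gamma> \<in> ball 0 1\<close> \<gamma>0(2) by (simp add: \<gamma>_def)
    ultimately have "((\<lambda>(a, b). c a b * (\<Prod>j<Suc 0. t ^ a j * 0 ^ b j)) has_sum F t)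
        (multi_indices (Suc 0) \<times> multi_indices (Suc 0))"
      by (simp add: \<gamma>_def)
    then have "((\<lambda>n. d n * t ^ n) has_sum F t) UNIV"
      unfolding d_def by (subst (asm) has_sum_multi_indices_1) auto
    then show ?thesis by (rule has_sum_imp_sums)
  qed
  have m: "0 < min r (min \<delta> 1)" using c(1) \<delta>(1) by simp
  \<comment> \<open>Subtracting \<theta> makes the value at 0 vanish, so that isolation of zeros
    applies.\<close>
  define d' where "d' n = (if n = 0 then d 0 - \<theta> else d n)" for n
  have ser': "(\<lambda>n. d' n * (t - 0) ^ n) sums (F t - \<theta>)" if t: "norm (t - 0) < min r (min \<delta> 1)" for t
  proof -
    have "(\<lambda>n. d n * t ^ n) sums F t" using t by (intro ser) auto
    moreover have "(\<lambda>n. if n = 0 then \<theta> else 0) sums \<theta>" using sums_single[of 0 "\<lambda>_. \<theta>"] by (simp add: eq_commute)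
    ultimately have "(\<lambda>n. d n * t ^ n - (if n = 0 then \<theta> else 0)) sums (F t - \<theta>)" by (rule sums_diff)
    moreover have "d n * t ^ n - (if n = 0 then \<theta> else 0) = d' n * (t - 0) ^ n" for n
      by (simp add: d'_def)
    ultimately show ?thesis by simp
  qed
  have F0: "F 0 - \<theta> = 0" using neg[of 0] by simp
  have z: "d' n = 0" if n: "n > 0" for n
  proof (rule ccontr)
    assume "d' n \<noteq> 0"
    have "\<exists>s>0. \<forall>t\<in>cball 0 s - {0}. F t - \<theta> \<noteq> 0"
    proof (rule powser_0_nonzero[of "min r (min \<delta> 1)" 0 d' "\<lambda>t. F t - \<theta>" n])
      show "\<exists>s>0. \<forall>t\<in>cball 0 s - {0}. F t - \<theta> \<noteq> 0"
        if "0 < s" "\<And>z. z \<in> cball 0 s - {0} \<Longrightarrow> F z - \<theta> \<noteq> 0" for s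
        using that by blast
    qed (use m ser' F0 \<open>d' n \<noteq> 0\<close> n in auto)
    then obtain s where s: "0 < s" "\<And>t. t \<in> cball 0 s - {0} \<Longrightarrow> F t - \<theta> \<noteq> 0" by blast
    \<comment> \<open>A point left of 0 that lies both in the zero-free disc and in the range where
      F is constant.\<close>
    have "F (- min s (1/2)) - \<theta> \<noteq> 0" using s(1) by (intro s(2)) auto
    moreover have "F (- min s (1/2)) = \<theta>" using s(1) by (intro neg) auto
    ultimately show False by simp
  qed
  have d0: "d' 0 = 0"
  proof -
    have "(\<lambda>n. d' n * (0 - 0) ^ n) sums (F 0 - \<theta>)" using m by (intro ser') simp
    moreover have "(\<lambda>n. d' n * (0 - 0) ^ n) sums d' 0"
      using powser_sums_zero[of d'] by simp
    ultimately show ?thesis using F0 sums_unique2 by metis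
  qed
  have "d' n = 0" for n using z d0 by (cases n) auto
  then have d': "d' = (\<lambda>_. 0)" by auto
  define \<tau> where "\<tau> = min r (min \<delta> 1) / 2"
  have \<tau>: "0 < \<tau>" "\<tau> < 1" "norm (\<tau> - 0) < min r (min \<delta> 1)" using m by (auto simp: \<tau>_def)
  have "(\<lambda>n. 0) sums (F \<tau> - \<theta>)" using ser'[OF \<tau>(3)] unfolding d' by simp
  then have "F \<tau> = \<theta>" using sums_unique2[OF sums_zero] by fastforce
  then show False using pos[OF \<tau>(1,2)] by simp
qed

section \<open>Pluriharmonicity and frontiers for functions of the real part\<close>

lemma openin_disc_ball:
  assumes "openin (top_of_set (ball 0 1)) G" "\<gamma> \<in> G"
  shows "\<exists>\<delta>>0. ball \<gamma> \<delta> \<subseteq> G" and "G \<subseteq> ball (0::complex) 1"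
proof -
  have "open G" using assms(1) by (simp add: openin_open_eq)
  then show "\<exists>\<delta>>0. ball \<gamma> \<delta> \<subseteq> G" using assms(2) open_contains_ball by metis
  show "G \<subseteq> ball 0 1" using openin_imp_subset[OF assms(1)] .
qed

lemma coord_line: "(\<lambda>i. coord \<gamma> i + of_real t * coord u i) = coord (\<gamma> + of_real t * u)"
  by (auto simp: coord_def)

lemma eventually_along:
  fixes G :: "complex set"
  assumes "open G" "\<gamma> \<in> G"
  shows "\<forall>\<^sub>F t in nhds 0. \<gamma> + of_real t * u \<in> G"
proof -
  have "((\<lambda>t. \<gamma> + complex_of_real t * u) \<longlongrightarrow> \<gamma> + of_real 0 * u) (nhds 0)"
    by (intro tendsto_intros filterlim_ident)
  then show ?thesis using assms by (intro topological_tendstoD[where S = G]) auto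
qed

lemma DERIV_along:
  assumes G: "open G" "\<gamma> \<in> G" and f: "\<And>\<gamma>. \<gamma> \<in> G \<Longrightarrow> f (coord \<gamma>) = g \<gamma>"
  shows "(along f (coord u) (coord \<gamma>) has_field_derivative D) (at 0) \<longleftrightarrow>
         ((\<lambda>t. g (\<gamma> + of_real t * u)) has_field_derivative D) (at 0)"
proof (rule DERIV_cong_ev[OF refl _ refl])
  show "\<forall>\<^sub>F t in nhds 0. along f (coord u) (coord \<gamma>) t = g (\<gamma> + of_real t * u)"
    using eventually_along[OF G, of u]
    by eventually_elim (simp add: along_def coord_line f)
qed

lemma deriv_eq_if_DERIV_iff:
  assumes "\<And>D. (f has_field_derivative D) (at x) \<longleftrightarrow> (g has_field_derivative D) (at y)"
  shows "deriv f x = deriv g y"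
  unfolding deriv_def using assms by simp

lemma C1_const:
  assumes G: "open G" and f: "\<And>\<gamma>. \<gamma> \<in> G \<Longrightarrow> f (coord \<gamma>) = c"
  shows "C1_Cn 1 (coord ` G) f" and "\<And>u \<gamma>. \<gamma> \<in> G \<Longrightarrow> dir_deriv (coord u) f (coord \<gamma>) = 0"
proof -
  have D: "(along f (coord u) (coord \<gamma>) has_field_derivative 0) (at 0)" if "\<gamma> \<in> G" for u \<gamma>
    by (subst DERIV_along[where G = G and g = "\<lambda>_. c"]) (use G f that in auto)
  show d0: "dir_deriv (coord u) f (coord \<gamma>) = 0" if "\<gamma> \<in> G" for u \<gamma>
    unfolding dir_deriv_def by (rule DERIV_imp_deriv[OF D[OF that]])
  show "C1_Cn 1 (coord ` G) f"
    unfolding C1_Cn_def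
  proof (intro ballI conjI)
    fix v assume "v \<in> Cspace 1"
    then obtain u where v: "v = coord u" using Cspace_1 by blast
    show "along f v z differentiable at 0" if "z \<in> coord ` G" for z
      using that D[of _ u] v real_differentiable_def by force
    have "continuous_on (coord ` G) (\<lambda>_. 0::real)" by (rule continuous_on_const)
    moreover have "dir_deriv v f z = 0" if "z \<in> coord ` G" for z
      using that d0[of _ u] v by auto
    ultimately show "continuous_on (coord ` G) (dir_deriv v f)"
      by (simp cong: continuous_on_cong)
  qed
qed

lemma pluriharmonic_const:
  assumes G: "open G" and f: "\<And>\<gamma>. \<gamma> \<in> G \<Longrightarrow> f (coord \<gamma>) = c"
  shows "pluriharmonic_Cn 1 (coord ` G) f"
  unfolding pluriharmonic_Cn_def C2_Cn_def
proof (intro conjI ballI)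
  show "C1_Cn 1 (coord ` G) f" by (rule C1_const(1)[where c = c]) (use G f in auto)
  have d: "dir_deriv (coord u) f (coord \<gamma>) = 0" if "\<gamma> \<in> G" for u \<gamma>
    by (rule C1_const(2)[where G = G and c = c]) (use G f that in auto)
  fix v assume "v \<in> Cspace 1"
  then obtain u where v: "v = coord u" using Cspace_1 by blast
  have iv: "(\<lambda>i. \<i> * v i) = coord (\<i> * u)" by (auto simp: v coord_def)
  show "C1_Cn 1 (coord ` G) (dir_deriv v f)"
    unfolding v by (rule C1_const(1)[OF G, where c = 0]) (rule d)
  have dd: "dir_deriv (coord u) (dir_deriv (coord u) f) (coord \<gamma>) = 0" if "\<gamma> \<in> G" for u \<gamma>
    by (rule C1_const(2)[OF G _ that, where c = 0]) (rule d)
  fix z assume "z \<in> coord ` G"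
  then show "dir_deriv v (dir_deriv v f) z
        + dir_deriv (\<lambda>i. \<i> * v i) (dir_deriv (\<lambda>i. \<i> * v i) f) z = 0"
    unfolding iv unfolding v using dd by auto
qed

text \<open>The derivatives of a function of Re \<gamma> in the direction \<i> vanish, so the
  Laplace condition for the direction 1 says that the second derivative of F is 0 on an
  interval.\<close>

lemma pluriharmonic_Re_affine:
  assumes pl: "pluriharmonic_Cn 1 (coord ` ball \<gamma>0 \<delta>) f" and \<delta>: "0 < \<delta>"
    and f: "\<And>\<gamma>. \<gamma> \<in> ball \<gamma>0 \<delta> \<Longrightarrow> f (coord \<gamma>) = F (Re \<gamma>)"
  shows "\<exists>\<alpha> \<beta>. \<forall>x. \<bar>x - Re \<gamma>0\<bar> < \<delta> \<longrightarrow> F x = \<alpha> * x + \<beta>"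
proof -
  let ?G = "ball \<gamma>0 \<delta>" and ?d = "dir_deriv (coord 1) f" and ?e = "dir_deriv (coord \<i>) f"
  let ?I = "{x. \<bar>x - Re \<gamma>0\<bar> < \<delta>}"
  have shift: "((\<lambda>t. H (Re (\<gamma> + of_real t * 1))) has_field_derivative D) (at 0)
      \<longleftrightarrow> (H has_field_derivative D) (at (Re \<gamma>))" for H :: "real \<Rightarrow> real" and \<gamma> D
    using DERIV_shift[of H D 0 "Re \<gamma>"] by (simp add: add.commute)
  have D1: "(along f (coord 1) (coord \<gamma>) has_field_derivative D) (at 0) \<longleftrightarrow> (F has_field_derivative D) (at (Re \<gamma>))"
    if "\<gamma> \<in> ?G" for \<gamma> D
    unfolding shift[symmetric] by (rule DERIV_along[where G = ?G]) (use that f in auto)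
  have d: "?d (coord \<gamma>) = deriv F (Re \<gamma>)" if "\<gamma> \<in> ?G" for \<gamma>
    unfolding dir_deriv_def by (rule deriv_eq_if_DERIV_iff[OF D1[OF that]])
  have D2: "(along ?d (coord 1) (coord \<gamma>) has_field_derivative D) (at 0)
      \<longleftrightarrow> (deriv F has_field_derivative D) (at (Re \<gamma>))" if "\<gamma> \<in> ?G" for \<gamma> D
    unfolding shift[symmetric] by (rule DERIV_along[where G = ?G]) (use that d in auto)
  have dd: "dir_deriv (coord 1) ?d (coord \<gamma>) = deriv (deriv F) (Re \<gamma>)" if "\<gamma> \<in> ?G" for \<gamma>
    unfolding dir_deriv_def[of _ ?d] by (rule deriv_eq_if_DERIV_iff[OF D2[OF that]])
  have e: "?e (coord \<gamma>) = 0" if "\<gamma> \<in> ?G" for \<gamma>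
  proof -
    have "(along f (coord \<i>) (coord \<gamma>) has_field_derivative 0) (at 0)"
      by (subst DERIV_along[where G = ?G and g = "\<lambda>\<gamma>. F (Re \<gamma>)"]) (use that f in auto)
    then show ?thesis unfolding dir_deriv_def by (rule DERIV_imp_deriv)
  qed
  have ee: "dir_deriv (coord \<i>) ?e (coord \<gamma>) = 0" if "\<gamma> \<in> ?G" for \<gamma>
    by (rule C1_const(2)[OF open_ball _ that, where c = 0]) (rule e)
  have icoord: "(\<lambda>i. \<i> * coord 1 i) = coord \<i>" by (auto simp: coord_def)
  have pt: "\<exists>\<gamma>\<in>?G. Re \<gamma> = x" if "x \<in> ?I" for x
    using that by (intro bexI[of _ "\<gamma>0 + of_real (x - Re \<gamma>0)"])
      (auto simp: dist_norm norm_minus_commute simp del: of_real_diff)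
  have C1: "C1_Cn 1 (coord ` ?G) f" "C1_Cn 1 (coord ` ?G) ?d"
    using pl unfolding pluriharmonic_Cn_def C2_Cn_def by auto
  have FD: "(F has_field_derivative deriv F x) (at x)" if x: "x \<in> ?I" for x
  proof -
    obtain \<gamma> where \<gamma>: "\<gamma> \<in> ?G" "Re \<gamma> = x" using pt[OF x] by blast
    have "along f (coord 1) (coord \<gamma>) differentiable at 0"
      using C1(1) \<gamma>(1) unfolding C1_Cn_def by auto
    then obtain D where "(along f (coord 1) (coord \<gamma>) has_field_derivative D) (at 0)"
      unfolding real_differentiable_def by blast
    then have "(F has_field_derivative D) (at x)" using D1[OF \<gamma>(1)] \<gamma>(2) by simp
    then show ?thesis using DERIV_imp_deriv by metis
  qed
  have FDD: "(deriv F has_field_derivative 0) (at x)" if x: "x \<in> ?I" for x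
  proof -
    obtain \<gamma> where \<gamma>: "\<gamma> \<in> ?G" "Re \<gamma> = x" using pt[OF x] by blast
    have "along ?d (coord 1) (coord \<gamma>) differentiable at 0"
      using C1(2) \<gamma>(1) unfolding C1_Cn_def by auto
    then obtain D where "(along ?d (coord 1) (coord \<gamma>) has_field_derivative D) (at 0)"
      unfolding real_differentiable_def by blast
    then have D: "(deriv F has_field_derivative D) (at x)" using D2[OF \<gamma>(1)] \<gamma>(2) by simp
    have "\<forall>z\<in>coord ` ?G. \<forall>v\<in>Cspace 1.
        dir_deriv v (dir_deriv v f) z + dir_deriv (\<lambda>i. \<i> * v i) (dir_deriv (\<lambda>i. \<i> * v i) f) z = 0"
      using pl unfolding pluriharmonic_Cn_def by (rule conjunct2)
    from this[THEN bspec, THEN bspec, of "coord \<gamma>" "coord 1"]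
    have "dir_deriv (coord 1) ?d (coord \<gamma>) + dir_deriv (coord \<i>) ?e (coord \<gamma>) = 0"
      using \<gamma>(1) unfolding icoord by simp
    then have "deriv (deriv F) x = 0" using dd[OF \<gamma>(1)] ee[OF \<gamma>(1)] \<gamma>(2) by simp
    then show ?thesis using D DERIV_imp_deriv[OF D] by simp
  qed
  have conv: "convex ?I"
  proof -
    have "?I = ball (Re \<gamma>0) \<delta>" by (auto simp: dist_real_def abs_minus_commute)
    then show ?thesis by simp
  qed
  obtain \<alpha> where \<alpha>: "\<And>x. x \<in> ?I \<Longrightarrow> deriv F x = \<alpha>"
    using has_field_derivative_zero_constant[OF conv, of "deriv F"] FDD has_field_derivative_at_within by metis
  have D0: "((\<lambda>x. F x - \<alpha> * x) has_field_derivative 0) (at x within ?I)" if "x \<in> ?I" for x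
  proof -
    have "((\<lambda>x. F x - \<alpha> * x) has_field_derivative deriv F x - \<alpha>) (at x)"
      by (rule DERIV_diff[OF FD[OF that] DERIV_cmult_Id])
    then show ?thesis unfolding \<alpha>[OF that] by (simp add: has_field_derivative_at_within)
  qed
  from has_field_derivative_zero_constant[OF conv D0]
  obtain \<beta> where "\<forall>x\<in>?I. F x - \<alpha> * x = \<beta>" by (rule exE)
  then show ?thesis by (intro exI[of _ \<alpha>] exI[of _ \<beta>]) (auto simp: algebra_simps)
qed

lemma NPHH_discI:
  assumes h: "\<And>\<gamma>. \<gamma> \<in> ball 0 1 \<Longrightarrow> h_dim X (\<Phi> \<gamma>) = F (Re \<gamma>)" and \<gamma>0: "\<gamma>0 \<in> ball 0 1"
    and na: "\<And>\<alpha> \<beta> \<delta>. 0 < \<delta> \<Longrightarrow> \<exists>x. \<bar>x - Re \<gamma>0\<bar> < \<delta> \<and> F x \<noteq> \<alpha> * x + \<beta>"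
  shows "\<gamma>0 \<in> NPHH X disc \<Phi>"
proof -
  have "\<not> pluriharmonic_on disc G (\<lambda>\<gamma>. h_dim X (\<Phi> \<gamma>))"
    if G: "openin (mtop disc) G" "\<gamma>0 \<in> G" for G
  proof
    assume "pluriharmonic_on disc G (\<lambda>\<gamma>. h_dim X (\<Phi> \<gamma>))"
    then have pl: "pluriharmonic_Cn 1 (coord ` (ball 0 1 \<inter> G)) ((\<lambda>\<gamma>. h_dim X (\<Phi> \<gamma>)) \<circ> inv_into (ball 0 1) coord)"
      by (simp add: pluriharmonic_on_def)
    have G': "openin (top_of_set (ball 0 1)) G" using G(1) by simp
    obtain \<delta> where \<delta>: "\<delta> > 0" "ball \<gamma>0 \<delta> \<subseteq> G" using openin_disc_ball(1)[OF G' G(2)] by blast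
    have sub: "ball \<gamma>0 \<delta> \<subseteq> ball 0 1" using \<delta>(2) openin_disc_ball(2)[OF G' G(2)] by (rule order_trans)
    have cs: "coord ` ball \<gamma>0 \<delta> \<subseteq> coord ` (ball 0 1 \<inter> G)" using \<delta>(2) sub by (intro image_mono) simp
    have "C1_Cn 1 (coord ` ball \<gamma>0 \<delta>) f" if "C1_Cn 1 (coord ` (ball 0 1 \<inter> G)) f" for f
      using that subsetD[OF cs] continuous_on_subset[OF _ cs] unfolding C1_Cn_def by fast
    then have "pluriharmonic_Cn 1 (coord ` ball \<gamma>0 \<delta>) ((\<lambda>\<gamma>. h_dim X (\<Phi> \<gamma>)) \<circ> inv_into (ball 0 1) coord)"
      using pl subsetD[OF cs] unfolding pluriharmonic_Cn_def C2_Cn_def by fast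
    moreover have "((\<lambda>\<gamma>. h_dim X (\<Phi> \<gamma>)) \<circ> inv_into (ball 0 1) coord) (coord \<gamma>) = F (Re \<gamma>)"
      if "\<gamma> \<in> ball \<gamma>0 \<delta>" for \<gamma>
    proof -
      have "\<gamma> \<in> ball 0 1" using sub that by (rule subsetD)
      then show ?thesis using h by simp
    qed
    ultimately obtain \<alpha> \<beta> where ab: "\<forall>x. \<bar>x - Re \<gamma>0\<bar> < \<delta> \<longrightarrow> F x = \<alpha> * x + \<beta>"
      using pluriharmonic_Re_affine[OF _ \<delta>(1)] by metis
    obtain x where "\<bar>x - Re \<gamma>0\<bar> < \<delta>" "F x \<noteq> \<alpha> * x + \<beta>" using na[OF \<delta>(1)] by blast
    then show False using ab by simp
  qed
  then show ?thesis using \<gamma>0 by (simp add: NPHH_def)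
qed

lemma not_NPHH_disc:
  assumes G: "openin (mtop disc) G" "\<gamma>0 \<in> G" and h: "\<And>\<gamma>. \<gamma> \<in> G \<Longrightarrow> h_dim X (\<Phi> \<gamma>) = c"
  shows "\<gamma>0 \<notin> NPHH X disc \<Phi>"
proof -
  have G': "openin (top_of_set (ball 0 1)) G" using G(1) by simp
  then have "open G" by (simp add: openin_open_eq)
  have sub: "G \<subseteq> ball 0 1" by (rule openin_disc_ball(2)[OF G' G(2)])
  have "pluriharmonic_Cn 1 (coord ` G) ((\<lambda>\<gamma>. h_dim X (\<Phi> \<gamma>)) \<circ> inv_into (ball 0 1) coord)"
  proof (rule pluriharmonic_const[OF \<open>open G\<close>, where c = c])
    fix \<gamma> assume "\<gamma> \<in> G"
    moreover from this have "\<gamma> \<in> ball 0 1" using sub by (rule subsetD[rotated])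
    ultimately show "((\<lambda>\<gamma>. h_dim X (\<Phi> \<gamma>)) \<circ> inv_into (ball 0 1) coord) (coord \<gamma>) = c"
      using h by simp
  qed
  moreover have "ball 0 1 \<inter> G = G" using sub by (rule Int_absorb1)
  ultimately have "pluriharmonic_on disc G (\<lambda>\<gamma>. h_dim X (\<Phi> \<gamma>))"
    by (simp add: pluriharmonic_on_def)
  then show ?thesis using G unfolding NPHH_def by blast
qed

text \<open>p and n are the truth values of Q on the right and on the left. Off the imaginary axis Q
  is locally constant; on the axis it fails, but it holds arbitrarily near, on a side whose value is
  true.\<close>

lemma frontier_disc:
  assumes pos: "\<And>x. 0 < x \<Longrightarrow> Q x \<longleftrightarrow> p" and neg: "\<And>x. x < 0 \<Longrightarrow> Q x \<longleftrightarrow> n" and "\<not> Q 0" "p \<or> n"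
  shows "mtop disc frontier_of {\<gamma>\<in>ball 0 1. Q (Re \<gamma>)} = {\<gamma>\<in>ball 0 1. Re \<gamma> = 0}"
proof (intro equalityI subsetI)
  let ?S = "{\<gamma>\<in>ball 0 1. Q (Re \<gamma>)}"
  fix \<gamma> assume fr: "\<gamma> \<in> mtop disc frontier_of ?S"
  then have \<gamma>: "\<gamma> \<in> ball 0 1" using frontier_of_subset_topspace[of "mtop disc" ?S] by auto
  have cl: "\<exists>y. y \<in> ?S \<and> y \<in> T" "\<exists>y. y \<in> topspace (mtop disc) - ?S \<and> y \<in> T"
    if "\<gamma> \<in> T" "openin (mtop disc) T" for T
    using fr that unfolding frontier_of_closures Int_iff in_closure_of by blast+
  have "Re \<gamma> = 0"
  proof (rule ccontr)
    assume nz: "Re \<gamma> \<noteq> 0"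
    \<comment> \<open>The open half of the disc that contains \<gamma>, selected by the sign of its
      real part.\<close>
    define T where "T = ball 0 1 \<inter> {y. 0 < Re y * sgn (Re \<gamma>)}"
    have "open {y. 0 < Re y * sgn (Re \<gamma>)}" by (intro open_Collect_less continuous_intros)
    then have T: "openin (mtop disc) T" unfolding T_def by (simp add: openin_open_Int)
    have "\<gamma> \<in> T" using \<gamma> nz by (auto simp: T_def sgn_if)
    obtain y where y: "y \<in> ?S" "y \<in> T" using cl(1)[OF \<open>\<gamma> \<in> T\<close> T] by blast
    obtain y' where y': "y' \<in> ball 0 1 - ?S" "y' \<in> T" using cl(2)[OF \<open>\<gamma> \<in> T\<close> T] by auto
    have "Q (Re y) \<longleftrightarrow> Q (Re y')"
      using y(2) y'(2) nz pos neg by (cases "0 < Re \<gamma>") (auto simp: T_def sgn_if zero_less_mult_iff split: if_splits)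
    then show False using y(1) y'(1) by auto
  qed
  then show "\<gamma> \<in> {\<gamma>\<in>ball 0 1. Re \<gamma> = 0}" using \<gamma> by simp
next
  let ?S = "{\<gamma>\<in>ball 0 1. Q (Re \<gamma>)}"
  fix \<gamma> :: complex assume \<gamma>: "\<gamma> \<in> {\<gamma>\<in>ball 0 1. Re \<gamma> = 0}"
  have "\<exists>y\<in>?S. y \<in> T" if T: "\<gamma> \<in> T" "openin (mtop disc) T" for T
  proof -
    have T': "openin (top_of_set (ball 0 1)) T" using T(2) by simp
    obtain \<delta> where \<delta>: "\<delta> > 0" "ball \<gamma> \<delta> \<subseteq> T" using openin_disc_ball(1)[OF T' T(1)] by blast
    define y where "y = \<gamma> + of_real (if p then \<delta> / 2 else - \<delta> / 2)"
    have "y \<in> T" using \<delta> by (auto simp: y_def dist_norm norm_divide intro!: subsetD[OF \<delta>(2)])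
    moreover have "y \<in> ball 0 1" using openin_disc_ball(2)[OF T' T(1)] calculation by (rule subsetD)
    moreover have "Q (Re y)" using \<gamma> \<delta>(1) assms by (auto simp: y_def)
    ultimately show ?thesis by blast
  qed
  moreover have "\<gamma> \<in> ball 0 1 - ?S" using \<gamma> assms(3) by auto
  ultimately show "\<gamma> \<in> mtop disc frontier_of ?S"
    using \<gamma> unfolding frontier_of_closures Int_iff in_closure_of by auto
qed

section \<open>Analytic families of similarities\<close>

text \<open>The discs are lined up from p to the right, each touching the next: a centre lies beyond
  the diameters of all earlier discs by its own radius. The total diameter bounds how far they
  reach.\<close>

lemma disjoint_discs_on_segment:
  fixes p :: complex and r :: "nat \<Rightarrow> real"
  assumes r: "\<And>i. 0 < r i" "summable r" "2 * suminf r \<le> \<rho>"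
  defines "b \<equiv> \<lambda>i. p + of_real (2 * sum r {..<i} + r i)"
  shows "ball (b i) (r i) \<subseteq> ball p \<rho>" and "i \<noteq> j \<Longrightarrow> ball (b i) (r i) \<inter> ball (b j) (r j) = {}"
proof -
  have part: "sum r {..<i} + r i \<le> suminf r" for i
    using sum_le_suminf[OF r(2), of "{..<Suc i}"] r(1) by (auto intro: less_imp_le)
  have nn: "0 \<le> sum r {..<i}" for i by (intro sum_nonneg less_imp_le r(1))
  show "ball (b i) (r i) \<subseteq> ball p \<rho>"
  proof
    fix y assume "y \<in> ball (b i) (r i)"
    moreover have "dist p (b i) = 2 * sum r {..<i} + r i"
      using nn[of i] r(1)[of i] by (simp add: b_def dist_norm del: of_real_add)
    ultimately show "y \<in> ball p \<rho>"
      using dist_triangle[of p y "b i"] part[of i] r(3) by simp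
  qed
  have ord: "ball (b i) (r i) \<inter> ball (b j) (r j) = {}" if "i < j" for i j
  proof -
    have "sum r {..<Suc i} \<le> sum r {..<j}"
      using that r(1) by (intro sum_mono2) (auto intro: less_imp_le)
    then have le: "2 * sum r {..<i} + r i + (r i + r j) \<le> 2 * sum r {..<j} + r j" by simp
    moreover have "dist (b i) (b j) = \<bar>(2 * sum r {..<i} + r i) - (2 * sum r {..<j} + r j)\<bar>"
      unfolding b_def by (simp only: dist_add_cancel dist_of_real dist_real_def)
    ultimately have "r i + r j \<le> dist (b i) (b j)" by simp
    then show ?thesis by (rule disjoint_ballI)
  qed
  show "ball (b i) (r i) \<inter> ball (b j) (r j) = {}" if "i \<noteq> j"
    using ord[of i j] ord[of j i] that by (cases "i < j") (auto simp: Int_commute)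
qed

text \<open>\<open>3 * R * s i\<close> bounds the radius of the image of \<open>ball 0 R\<close>
  under a similarity of ratio at most \<open>3 * s i\<close>; the factor 3 is there to absorb
  \<open>exp 1\<close>.\<close>

lemma discs_in_cifs_space:
  assumes "cifs_space X"
  shows "\<exists>R \<epsilon>. 0 < R \<and> 0 < \<epsilon> \<and> \<epsilon> \<le> 1 / 6 \<and> X \<subseteq> ball 0 R \<and>
    (\<forall>s::nat \<Rightarrow> real. (\<forall>i. 0 < s i) \<longrightarrow> summable s \<longrightarrow> suminf s \<le> \<epsilon> \<longrightarrow>
      (\<exists>b. (\<forall>i. ball (b i) (3 * R * s i) \<subseteq> interior X) \<and>
           (\<forall>i j. i \<noteq> j \<longrightarrow> ball (b i) (3 * R * s i) \<inter> ball (b j) (3 * R * s j) = {})))"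
proof -
  have X: "X \<noteq> {}" "compact X" "X = closure (interior X)" using assms by (auto simp: cifs_space_def)
  then obtain p where "p \<in> interior X" by (metis closure_empty ex_in_conv)
  then obtain \<rho> where \<rho>: "0 < \<rho>" "ball p \<rho> \<subseteq> interior X"
    using open_contains_ball[of "interior X"] by auto
  obtain B where B: "\<And>x. x \<in> X \<Longrightarrow> norm x \<le> B" using compact_imp_bounded[OF X(2)] bounded_iff by metis
  define R where "R = max 1 (B + 1)"
  have R: "0 < R" "X \<subseteq> ball 0 R" using B by (auto simp: R_def max_def) (smt (verit, best) B)+
  \<comment> \<open>1/6 turns \<open>3 * s i\<close> into a contraction ratio of at most 1/2;
    \<open>\<rho> / (6 * R)\<close> bounds the sum of all diameters by \<rho>.\<close>
  define \<epsilon> where "\<epsilon> = min (1/6) (\<rho> / (6 * R))"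
  have \<epsilon>: "0 < \<epsilon>" "\<epsilon> \<le> 1/6" "6 * R * \<epsilon> \<le> \<rho>"
    using \<rho> R by (auto simp: \<epsilon>_def min_def field_simps)
  have "\<exists>b. (\<forall>i. ball (b i) (3 * R * s i) \<subseteq> interior X) \<and>
           (\<forall>i j. i \<noteq> j \<longrightarrow> ball (b i) (3 * R * s i) \<inter> ball (b j) (3 * R * s j) = {})"
    if s: "\<forall>i. 0 < s i" "summable s" "suminf s \<le> \<epsilon>" for s :: "nat \<Rightarrow> real"
  proof -
    have r: "\<And>i. 0 < 3 * R * s i" "summable (\<lambda>i. 3 * R * s i)" using s R by (auto intro: summable_mult)
    have "suminf (\<lambda>i. 3 * R * s i) = 3 * R * suminf s" by (rule suminf_mult[OF s(2)])
    then have "2 * suminf (\<lambda>i. 3 * R * s i) \<le> 6 * R * \<epsilon>" using s(3) R(1) by simp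
    then have "2 * suminf (\<lambda>i. 3 * R * s i) \<le> \<rho>" using \<epsilon>(3) by simp
    note d = disjoint_discs_on_segment[where r = "\<lambda>i. 3 * R * s i" and p = p, OF r this]
    show ?thesis
      by (rule exI[of _ "\<lambda>i. p + of_real (2 * (\<Sum>i<i. 3 * R * s i) + 3 * R * s i)"])
        (intro conjI allI impI order_trans[OF d(1) \<rho>(2)] d(2))
  qed
  then show ?thesis using R \<epsilon> by (intro exI[of _ R] exI[of _ \<epsilon>] conjI allI impI)
qed

lemma norm_exp_diff_le:
  assumes "norm z \<le> 1" "norm w \<le> 1"
  shows "norm (exp z - exp w) \<le> exp 1 * norm (z - w :: complex)"
proof (rule field_differentiable_bound[of "cball 0 1"])
  show "(exp has_field_derivative exp x) (at x within cball 0 1)" for x :: complex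
    by (auto intro!: derivative_eq_intros)
  show "norm (exp x) \<le> exp 1" if "x \<in> cball 0 1" for x :: complex
  proof -
    have "Re x \<le> 1" using that complex_Re_le_cmod[of x] by simp
    then show ?thesis by simp
  qed
qed (use assms in auto)

text \<open>The discs do not depend on the parameter and leave room for every ratio that occurs, so
  inclusion in X and disjointness hold for all parameters at once.\<close>

locale similarity_family =
  fixes X :: "complex set" and R :: real and b :: "nat \<Rightarrow> complex" and s \<kappa> :: "nat \<Rightarrow> real"
  assumes X: "cifs_space X" and X_subset: "X \<subseteq> ball 0 R"
    and s_pos: "\<And>i. 0 < s i" and s_le: "\<And>i. s i \<le> 1 / 6" and \<kappa>_le: "\<And>i. \<bar>\<kappa> i\<bar> \<le> 1"
    and discs_in: "\<And>i. ball (b i) (3 * R * s i) \<subseteq> interior X"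
    and discs_disj: "\<And>i j. i \<noteq> j \<Longrightarrow> ball (b i) (3 * R * s i) \<inter> ball (b j) (3 * R * s j) = {}"
begin

definition coef :: "complex \<Rightarrow> nat \<Rightarrow> complex" where
  "coef \<gamma> i = of_real (s i) * exp (of_real (\<kappa> i) * \<gamma>)"

definition \<Phi> :: "complex \<Rightarrow> system" where
  "\<Phi> \<gamma> = affine_system X (coef \<gamma>) b"

text \<open>Written as an exponential so that its logarithm is visibly affine in x.\<close>

definition ratio :: "real \<Rightarrow> nat \<Rightarrow> real" where
  "ratio x i = exp (ln (s i) + \<kappa> i * x)"

lemma norm_coef: "norm (coef \<gamma> i) = ratio (Re \<gamma>) i"
  using s_pos[of i] by (simp add: coef_def ratio_def norm_mult exp_add)

lemma Re_ball: "\<gamma> \<in> ball 0 1 \<Longrightarrow> \<bar>Re \<gamma>\<bar> < 1"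
  using abs_Re_le_cmod[of \<gamma>] by simp

lemma ratio_le:
  assumes "\<bar>x\<bar> < 1"
  shows "ratio x i \<le> 3 * s i" and "ratio x i \<le> 1 / 2"
proof -
  have "\<kappa> i * x \<le> \<bar>\<kappa> i\<bar> * \<bar>x\<bar>" by (metis abs_ge_self abs_mult)
  also have "\<dots> \<le> 1 * 1" using \<kappa>_le assms by (intro mult_mono) auto
  finally have "exp (\<kappa> i * x) \<le> exp 1" by simp
  also have "\<dots> \<le> 3" by (rule exp_le)
  finally show 1: "ratio x i \<le> 3 * s i" using s_pos[of i] by (simp add: ratio_def exp_add)
  show "ratio x i \<le> 1 / 2" using 1 s_le[of i] by simp
qed

lemma affine_ifs_coef:
  assumes \<gamma>: "\<gamma> \<in> ball 0 1"
  shows "affine_ifs X R (1/2) (coef \<gamma>) b"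
proof -
  have in_disc: "coef \<gamma> i * x + b i \<in> ball (b i) (3 * R * s i)" if x: "x \<in> ball 0 R" for x i
  proof -
    have "dist (b i) (coef \<gamma> i * x + b i) = ratio (Re \<gamma>) i * norm x"
      by (simp add: dist_norm norm_mult norm_coef)
    also have "\<dots> \<le> 3 * s i * norm x" using ratio_le(1)[OF Re_ball[OF \<gamma>]] by (rule mult_right_mono) simp
    also have "\<dots> < 3 * s i * R" using x s_pos[of i] by simp
    finally show ?thesis by (simp add: mult.commute mult.left_commute)
  qed
  show ?thesis
  proof
    show "coef \<gamma> i \<noteq> 0" for i using s_pos[of i] by (simp add: coef_def)
    show "norm (coef \<gamma> i) \<le> 1 / 2" for i using ratio_le(2)[OF Re_ball[OF \<gamma>]] by (simp add: norm_coef)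
    show "coef \<gamma> i * x + b i \<in> interior X" if "x \<in> ball 0 R" for i x
      using in_disc[OF that] discs_in by (rule subsetD[rotated])
    show "coef \<gamma> i * x + b i \<noteq> coef \<gamma> j * y + b j" if "i \<noteq> j" "x \<in> ball 0 R" "y \<in> ball 0 R" for i j x y
    proof
      assume "coef \<gamma> i * x + b i = coef \<gamma> j * y + b j"
      then have "coef \<gamma> i * x + b i \<in> ball (b i) (3 * R * s i) \<inter> ball (b j) (3 * R * s j)"
        using in_disc[OF that(2), of i] in_disc[OF that(3), of j] by simp
      then show False unfolding discs_disj[OF that(1)] by simp
    qed
  qed (use X X_subset in auto)
qed

lemma analytic_family: "analytic_family X disc \<Phi>"
  unfolding analytic_family_def
proof (intro conjI ballI)
  show "connected_complex_manifold disc" by (rule connected_complex_manifold_disc)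
  show "\<Phi> \<gamma> \<in> HIFS X" if "\<gamma> \<in> topspace (mtop disc)" for \<gamma>
    unfolding \<Phi>_def using that by (intro affine_ifs.in_HIFS[OF affine_ifs_coef]) simp
next
  let ?e = "\<lambda>i \<gamma> x. coef \<gamma> i * x + b i"
  have ext: "\<forall>x\<in>X. ?e i \<gamma> x = \<Phi> \<gamma> i x" for i \<gamma> by (simp add: \<Phi>_def affine_system_def)
  have diffeo: "holomorphic_diffeo_into (ball 0 R) (?e i \<gamma>)" if "\<gamma> \<in> topspace (mtop disc)" for i \<gamma>
    using affine_ifs.holomorphic_diffeo_f[OF affine_ifs_coef, of \<gamma> i] that by simp
  have hol: "holomorphic_on_product disc (ball 0 1) (ball 0 R) (?e i)" for i
  proof (rule holomorphic_on_product_disc[OF order_refl])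
    fix \<gamma> x :: complex
    have "((\<lambda>z. of_real (\<kappa> i) * fst z) has_derivative (\<lambda>h. of_real (\<kappa> i) * fst h)) (at (\<gamma>, x))"
      by (auto intro!: derivative_eq_intros)
    from has_derivative_compose[OF this, of exp "(*) (exp (of_real (\<kappa> i) * \<gamma>))"]
    have E: "((\<lambda>z. exp (of_real (\<kappa> i) * fst z)) has_derivative
        (\<lambda>h. exp (of_real (\<kappa> i) * \<gamma>) * (of_real (\<kappa> i) * fst h))) (at (\<gamma>, x))"
      using DERIV_exp[of "of_real (\<kappa> i) * \<gamma>"] by (simp add: has_field_derivative_def)
    show "((\<lambda>(\<gamma>, x). coef \<gamma> i * x + b i) has_derivative
        (\<lambda>(u, v). (of_real (\<kappa> i) * coef \<gamma> i * x) * u + coef \<gamma> i * v)) (at (\<gamma>, x))"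
      unfolding coef_def case_prod_unfold
      by (rule has_derivative_eq_rhs, rule has_derivative_add[OF has_derivative_mult[OF
            has_derivative_mult_right[OF E] has_derivative_snd[OF has_derivative_ident]] has_derivative_const])
        (auto simp: fun_eq_iff algebra_simps)
  qed
  show "\<exists>G V e. openin (mtop disc) G \<and> \<gamma>\<^sub>0 \<in> G \<and>
        open V \<and> connected V \<and> bounded V \<and> X \<subseteq> V \<and>
        (\<forall>i. \<forall>\<gamma>\<in>topspace (mtop disc).
           (\<forall>x\<in>X. e i \<gamma> x = \<Phi> \<gamma> i x) \<and> holomorphic_diffeo_into V (e i \<gamma>)) \<and>
        (\<forall>i. holomorphic_on_product disc G V (e i))" if "\<gamma>\<^sub>0 \<in> topspace (mtop disc)" for \<gamma>\<^sub>0
  \<comment> \<open>The same choice serves every base point: the whole disc of parameters and the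
    whole of \<open>ball 0 R\<close>.\<close>
  proof (rule exI[of _ "ball 0 1"], rule exI[of _ "ball 0 R"], rule exI[of _ ?e], intro conjI allI ballI)
    show "openin (mtop disc) (ball 0 1)" by simp
    show "\<gamma>\<^sub>0 \<in> ball 0 1" using that by simp
  qed (use ext diffeo hol X_subset in \<open>auto simp: convex_connected\<close>)
qed

section \<open>Continuity with respect to the lambda-topology\<close>

lemma rho_infty_le:
  assumes \<gamma>: "\<gamma> \<in> ball 0 1" "\<gamma>' \<in> ball 0 1"
  shows "0 \<le> rho_infty X (\<Phi> \<gamma>') (\<Phi> \<gamma>)" and "rho_infty X (\<Phi> \<gamma>') (\<Phi> \<gamma>) \<le> (R + 1) * dist \<gamma>' \<gamma>"
proof -
  interpret A: affine_ifs X R "1/2" "coef \<gamma>" b by (rule affine_ifs_coef[OF \<gamma>(1)])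
  interpret B: affine_ifs X R "1/2" "coef \<gamma>'" b by (rule affine_ifs_coef[OF \<gamma>(2)])
  obtain x0 where "x0 \<in> X" using A.X_ne by blast
  then have R: "0 < R" using X_subset by (metis norm_ge_zero le_less_trans mem_ball_0 subsetD)
  define D where "D = dist \<gamma>' \<gamma>"
  \<comment> \<open>exp has Lipschitz constant at most \<open>exp 1 \<le> 3\<close> on the unit
    disc, and \<open>s i \<le> 1/6\<close> brings the product below 1.\<close>
  have cd: "norm (coef \<gamma>' i - coef \<gamma> i) \<le> D" for i
  proof -
    have n: "norm (of_real (\<kappa> i) * z) \<le> norm z" for z :: complex
      using \<kappa>_le[of i] mult_right_mono[of "\<bar>\<kappa> i\<bar>" 1 "norm z"] by (simp add: norm_mult)
    have "norm (exp (of_real (\<kappa> i) * \<gamma>') - exp (of_real (\<kappa> i) * \<gamma>))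
        \<le> exp 1 * norm (of_real (\<kappa> i) * \<gamma>' - of_real (\<kappa> i) * \<gamma>)"
      using \<gamma> n[of \<gamma>] n[of \<gamma>'] by (intro norm_exp_diff_le) auto
    also have "\<dots> \<le> exp 1 * D"
      using n[of "\<gamma>' - \<gamma>"] by (simp add: D_def dist_norm right_diff_distrib)
    also have "\<dots> \<le> 3 * D" using exp_le by (intro mult_right_mono) (auto simp: D_def)
    finally have e: "norm (exp (of_real (\<kappa> i) * \<gamma>') - exp (of_real (\<kappa> i) * \<gamma>)) \<le> 3 * D" .
    have "norm (coef \<gamma>' i - coef \<gamma> i) = s i * norm (exp (of_real (\<kappa> i) * \<gamma>') - exp (of_real (\<kappa> i) * \<gamma>))"
      using s_pos[of i] by (simp add: coef_def norm_mult flip: right_diff_distrib)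
    also have "\<dots> \<le> (1/6) * (3 * D)" using e s_le[of i] s_pos[of i] by (intro mult_mono) (auto simp: D_def)
    also have "\<dots> \<le> D" by (simp add: D_def)
    finally show ?thesis .
  qed
  define T where "T i = (SUP x\<in>X. norm (\<Phi> \<gamma>' i x - \<Phi> \<gamma> i x)) +
               (SUP x\<in>X. onorm (\<lambda>v. deriv_on X (\<Phi> \<gamma>' i) x v - deriv_on X (\<Phi> \<gamma> i) x v))" for i
  have val: "norm (\<Phi> \<gamma>' i x - \<Phi> \<gamma> i x) = norm (coef \<gamma>' i - coef \<gamma> i) * norm x" if "x \<in> X" for i x
    using that by (simp add: \<Phi>_def A.\<phi>_eq B.\<phi>_eq left_diff_distrib flip: norm_mult)
  have der: "onorm (\<lambda>v. deriv_on X (\<Phi> \<gamma>' i) x v - deriv_on X (\<Phi> \<gamma> i) x v) = norm (coef \<gamma>' i - coef \<gamma> i)"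
    if "x \<in> X" for i x
  proof -
    have "deriv_on X (\<Phi> \<gamma>' i) x = (\<lambda>v. coef \<gamma>' i * v)" "deriv_on X (\<Phi> \<gamma> i) x = (\<lambda>v. coef \<gamma> i * v)"
      unfolding \<Phi>_def
      by (rule deriv_on_affine[OF A.X_cone that B.\<phi>_eq], simp, rule deriv_on_affine[OF A.X_cone that A.\<phi>_eq], simp)
    then show ?thesis by (simp add: onorm_complex_mult flip: left_diff_distrib)
  qed
  have T: "0 \<le> T i \<and> T i \<le> (R + 1) * D" for i
  proof -
    have le: "norm (\<Phi> \<gamma>' i x - \<Phi> \<gamma> i x) \<le> R * D" if "x \<in> X" for x
    proof -
      have "norm x \<le> R" using that X_subset by (auto simp: subset_iff less_imp_le)
      then have "norm (coef \<gamma>' i - coef \<gamma> i) * norm x \<le> D * R" using cd by (intro mult_mono) (auto simp: D_def)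
      then show ?thesis using val[OF that] by (simp add: mult.commute)
    qed
    have "(SUP x\<in>X. norm (\<Phi> \<gamma>' i x - \<Phi> \<gamma> i x)) \<le> R * D" by (rule cSUP_least[OF A.X_ne le])
    moreover have "norm (\<Phi> \<gamma>' i x0 - \<Phi> \<gamma> i x0) \<le> (SUP x\<in>X. norm (\<Phi> \<gamma>' i x - \<Phi> \<gamma> i x))"
      using le by (intro cSUP_upper[OF \<open>x0 \<in> X\<close>] bdd_aboveI2)
    then have "0 \<le> (SUP x\<in>X. norm (\<Phi> \<gamma>' i x - \<Phi> \<gamma> i x))" by (rule order_trans[OF norm_ge_zero])
    moreover have "(SUP x\<in>X. onorm (\<lambda>v. deriv_on X (\<Phi> \<gamma>' i) x v - deriv_on X (\<Phi> \<gamma> i) x v)) = norm (coef \<gamma>' i - coef \<gamma> i)"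
      using A.X_ne der by simp
    ultimately show ?thesis using cd[of i] unfolding T_def by (simp add: distrib_right)
  qed
  \<comment> \<open>The weights sum to 1, so a bound on the terms that is uniform in i passes to the
    metric unchanged.\<close>
  have half: "(\<lambda>i. (1/2) ^ Suc i * ((R + 1) * D)) sums (1 * ((R + 1) * D))"
    by (rule sums_mult2[OF power_half_series])
  have summand: "0 \<le> (1/2) ^ Suc i * min 1 (T i) \<and> (1/2) ^ Suc i * min 1 (T i) \<le> (1/2) ^ Suc i * ((R + 1) * D)" for i
    using T[of i] by (auto intro!: mult_left_mono mult_nonneg_nonneg)
  have sm: "summable (\<lambda>i. (1/2) ^ Suc i * min 1 (T i))"
    by (rule summable_comparison_test'[OF sums_summable[OF half], of 0]) (use summand in auto)
  have rho: "rho_infty X (\<Phi> \<gamma>') (\<Phi> \<gamma>) = (\<Sum>i. (1/2) ^ Suc i * min 1 (T i))"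
    unfolding rho_infty_def T_def ..
  show "0 \<le> rho_infty X (\<Phi> \<gamma>') (\<Phi> \<gamma>)" unfolding rho using sm summand by (intro suminf_nonneg) auto
  have "(\<Sum>i. (1/2) ^ Suc i * min 1 (T i)) \<le> (\<Sum>i. (1/2) ^ Suc i * ((R + 1) * D))"
    using summand by (intro suminf_le sm sums_summable[OF half]) auto
  then show "rho_infty X (\<Phi> \<gamma>') (\<Phi> \<gamma>) \<le> (R + 1) * dist \<gamma>' \<gamma>"
    unfolding rho using sums_unique[OF half] by (simp add: D_def)
qed

lemma lambda_converges:
  assumes \<gamma>: "\<gamma> \<in> ball 0 1" "\<And>n. g n \<in> ball 0 1" "g \<longlonglongrightarrow> \<gamma>"
  shows "lambda_converges X (\<lambda>n. \<Phi> (g n)) (\<Phi> \<gamma>)"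
  unfolding lambda_converges_def
proof
  show "(\<lambda>n. rho_infty X (\<Phi> (g n)) (\<Phi> \<gamma>)) \<longlonglongrightarrow> 0"
  proof (rule tendsto_sandwich[OF _ _ tendsto_const])
    have "(\<lambda>n. (R + 1) * dist (g n) \<gamma>) \<longlonglongrightarrow> (R + 1) * dist \<gamma> \<gamma>" by (intro tendsto_intros \<gamma>(3))
    then show "(\<lambda>n. (R + 1) * dist (g n) \<gamma>) \<longlonglongrightarrow> 0" by simp
  qed (use rho_infty_le[OF \<gamma>(1,2)] in auto)
  have D: "ln (deriv_sup_norm X (\<Phi> \<gamma>' i)) = ln (s i) + \<kappa> i * Re \<gamma>'" if "\<gamma>' \<in> ball 0 1" for \<gamma>' i
    unfolding \<Phi>_def affine_ifs.deriv_sup_norm_\<phi>[OF affine_ifs_coef[OF that]] norm_coef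
    by (simp add: ratio_def)
  \<comment> \<open>\<open>ln (s i)\<close> cancels, leaving the difference of two numbers of
    modulus at most 1, uniformly in i.\<close>
  have "\<bar>ln (deriv_sup_norm X (\<Phi> \<gamma> i)) - ln (deriv_sup_norm X (\<Phi> (g n) i))\<bar> \<le> 2" for i n
  proof -
    have k: "\<bar>\<kappa> i * Re \<gamma>'\<bar> \<le> 1" if "\<gamma>' \<in> ball 0 1" for \<gamma>'
      using mult_mono[of "\<bar>\<kappa> i\<bar>" 1 "\<bar>Re \<gamma>'\<bar>" 1] \<kappa>_le[of i] Re_ball[OF that] by (simp add: abs_mult)
    show ?thesis unfolding D[OF \<gamma>(1)] D[OF \<gamma>(2)] using k[OF \<gamma>(1)] k[OF \<gamma>(2)[of n]] by linarith
  qed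
  then show "\<exists>C>0. \<exists>N. \<forall>i. \<forall>n\<ge>N.
        \<bar>ln (deriv_sup_norm X (\<Phi> \<gamma> i)) - ln (deriv_sup_norm X (\<Phi> (g n) i))\<bar> \<le> C"
    by (intro exI[of _ 2]) auto
qed

lemma in_CIFS: "\<gamma> \<in> ball 0 1 \<Longrightarrow> \<Phi> \<gamma> \<in> CIFS X"
  unfolding \<Phi>_def by (rule affine_ifs.in_CIFS[OF affine_ifs_coef])

text \<open>Closed sets of the target are defined by sequences and closures in the disc are
  described by sequences, so it is enough that convergent parameters give \<lambda>-converging
  systems.\<close>

lemma continuous_map_\<Phi>: "continuous_map (mtop disc) (lambda_topology X) \<Phi>"
  unfolding continuous_map_closedin topspace_lambda_topology
proof (intro conjI ballI allI impI)
  show "\<Phi> \<in> topspace (mtop disc) \<rightarrow> CIFS X" using in_CIFS by auto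
  fix F assume "closedin (lambda_topology X) F"
  then have F: "lambda_closed X F" by (simp add: closedin_lambda_topology)
  let ?S = "{\<gamma> \<in> ball 0 1. \<Phi> \<gamma> \<in> F}"
  have seq: "l \<in> ?S" if l: "l \<in> ball 0 1" and x: "\<forall>n. x n \<in> ?S" "x \<longlonglongrightarrow> l" for x l
  proof -
    have "lambda_converges X (\<lambda>n. \<Phi> (x n)) (\<Phi> l)" using l x by (intro lambda_converges) auto
    then have "(\<forall>n. \<Phi> (x n) \<in> F) \<and> \<Phi> l \<in> CIFS X \<and> lambda_converges X (\<lambda>n. \<Phi> (x n)) (\<Phi> l)"
      using x in_CIFS[OF l] by simp
    then have "\<Phi> l \<in> F" using F[unfolded lambda_closed_def, THEN conjunct2, rule_format, of "\<lambda>n. \<Phi> (x n)" "\<Phi> l"]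
      by simp
    then show ?thesis using l by simp
  qed
  have "closure ?S \<inter> ball 0 1 \<subseteq> ?S"
  proof
    fix l assume l: "l \<in> closure ?S \<inter> ball 0 1"
    then obtain x where "\<forall>n. x n \<in> ?S" "x \<longlonglongrightarrow> l"
      unfolding Int_iff closure_sequential by (elim conjE exE)
    then show "l \<in> ?S" using l by (intro seq) auto
  qed
  then have "?S = ball 0 1 \<inter> closure ?S" using closure_subset[of ?S] by blast
  then show "closedin (mtop disc) {\<gamma> \<in> topspace (mtop disc). \<Phi> \<gamma> \<in> F}"
    using closedin_closed[of "ball 0 1" ?S] by auto
qed

end

section \<open>The dimension as a root of the Moran equation\<close>

locale similarity_family_finite = similarity_family +
  fixes \<theta> :: real
  assumes \<theta>: "0 \<le> \<theta>" and summable_above: "\<And>t. \<theta> < t \<Longrightarrow> summable (\<lambda>i. s i powr t)"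
begin

lemma ratio_powr: "ratio x i powr t = exp (t * (ln (s i) + \<kappa> i * x))"
  by (simp add: ratio_def exp_powr_real mult.commute)

text \<open>On the unit disc the ratios differ from \<open>s i\<close> by factors between
  \<open>exp (- 1)\<close> and \<open>exp 1\<close>, uniformly in i. Hence the exponents of
  convergence do not depend on the parameter.\<close>

lemma summable_ratio_iff:
  assumes x: "\<bar>x\<bar> < 1"
  shows "summable (\<lambda>i. ratio x i powr t) \<longleftrightarrow> summable (\<lambda>i. s i powr t)"
proof -
  have sp: "s i powr t = exp (t * ln (s i))" for i using s_pos[of i] by (simp add: powr_def)
  have k: "\<bar>t * (\<kappa> i * x)\<bar> \<le> \<bar>t\<bar>" for i
  proof -
    have "\<bar>\<kappa> i\<bar> * \<bar>x\<bar> \<le> 1 * 1" using \<kappa>_le x by (intro mult_mono) auto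
    then show ?thesis using mult_left_mono[of "\<bar>\<kappa> i\<bar> * \<bar>x\<bar>" 1 "\<bar>t\<bar>"] by (simp add: abs_mult)
  qed
  have 1: "ratio x i powr t \<le> exp \<bar>t\<bar> * s i powr t" for i
    using k[of i] unfolding ratio_powr sp by (simp add: distrib_left flip: exp_add)
  have 2: "s i powr t \<le> exp \<bar>t\<bar> * ratio x i powr t" for i
    using k[of i] unfolding ratio_powr sp by (simp add: distrib_left flip: exp_add)
  show ?thesis
  proof
    assume "summable (\<lambda>i. ratio x i powr t)"
    then have "summable (\<lambda>i. exp \<bar>t\<bar> * ratio x i powr t)" by (rule summable_mult)
    then show "summable (\<lambda>i. s i powr t)" by (rule summable_comparison_test'[where N = 0]) (use 2 in auto)
  next
    assume "summable (\<lambda>i. s i powr t)"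
    then have "summable (\<lambda>i. exp \<bar>t\<bar> * s i powr t)" by (rule summable_mult)
    then show "summable (\<lambda>i. ratio x i powr t)" by (rule summable_comparison_test'[where N = 0]) (use 1 in auto)
  qed
qed

definition H :: "real \<Rightarrow> real" where
  "H x = h_dim X (\<Phi> (of_real x))"

text \<open>The root is required strictly above \<theta>, where the Dirichlet series is holomorphic;
  a root equal to \<theta>, the critically regular case, does not count.\<close>

definition root :: "real \<Rightarrow> bool" where
  "root x \<longleftrightarrow> (\<exists>t>\<theta>. moran_sum (ratio x) UNIV t = 1)"

lemma h_dim_if_moran_sum_eq_1:
  assumes "\<gamma> \<in> ball 0 1" "0 \<le> t" "moran_sum (ratio (Re \<gamma>)) UNIV t = 1"
  shows "h_dim X (\<Phi> \<gamma>) = t"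
  unfolding \<Phi>_def using assms
  by (intro affine_ifs.h_dim_root[OF affine_ifs_coef]) (simp_all add: norm_coef)

lemma of_real_ball: "\<bar>x\<bar> < 1 \<Longrightarrow> complex_of_real x \<in> ball 0 1"
  by simp

lemma h_dim_if_root:
  assumes \<gamma>: "\<gamma> \<in> ball 0 1" and r: "root (Re \<gamma>)"
  shows "h_dim X (\<Phi> \<gamma>) = H (Re \<gamma>)"
proof -
  obtain t where t: "\<theta> < t" "moran_sum (ratio (Re \<gamma>)) UNIV t = 1" using r unfolding root_def by blast
  have "h_dim X (\<Phi> \<gamma>) = t" using \<gamma> t \<theta> by (intro h_dim_if_moran_sum_eq_1) auto
  moreover have "H (Re \<gamma>) = t"
    unfolding H_def using t \<theta> of_real_ball[OF Re_ball[OF \<gamma>]] by (intro h_dim_if_moran_sum_eq_1) auto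
  ultimately show ?thesis by simp
qed

lemma rootD:
  assumes x: "\<bar>x\<bar> < 1" and r: "root x"
  shows "\<theta> < H x" and "(\<lambda>i. exp (H x * (ln (s i) + \<kappa> i * x))) sums 1"
proof -
  obtain t where t: "\<theta> < t" "moran_sum (ratio x) UNIV t = 1" using r unfolding root_def by blast
  have Ht: "H x = t"
    unfolding H_def using t \<theta> of_real_ball[OF x] by (intro h_dim_if_moran_sum_eq_1) auto
  then show "\<theta> < H x" using t by simp
  have sm: "summable (\<lambda>i. ratio x i powr t)" using summable_ratio_iff[OF x] summable_above[OF t(1)] by simp
  from moran_sum_UNIV_eq[OF sm] t(2) have "(\<Sum>i. ratio x i powr t) = 1" by simp
  then have "(\<lambda>i. ratio x i powr t) sums 1" using summable_sums[OF sm] by simp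
  then show "(\<lambda>i. exp (H x * (ln (s i) + \<kappa> i * x))) sums 1" unfolding Ht ratio_powr .
qed

lemma log_ratio_le: "\<bar>x\<bar> < 1 \<Longrightarrow> ln (s i) + \<kappa> i * x \<le> - ln 2"
proof -
  assume "\<bar>x\<bar> < 1"
  then have "ln (ratio x i) \<le> ln (1 / 2)"
    using ratio_le(2)[of x i] by (subst ln_le_cancel_iff) (auto simp: ratio_def)
  then show ?thesis by (simp add: ratio_def ln_div)
qed

lemma H_Lipschitz:
  assumes "\<bar>x\<bar> < 1" "root x" "\<bar>x0\<bar> < 1" "root x0" and d: "\<bar>x - x0\<bar> \<le> ln 2 / 2"
  shows "\<bar>H x - H x0\<bar> \<le> 4 * H x0 / ln 2 * \<bar>x - x0\<bar>"
proof (rule root_Lipschitz[OF rootD(2)[OF assms(3,4)] rootD(2)[OF assms(1,2)]])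
  show "0 \<le> H x0" "0 \<le> H x" using rootD(1)[OF assms(3,4)] rootD(1)[OF assms(1,2)] \<theta> by auto
  show "\<bar>x0 - x\<bar> \<le> ln 2 / 2" using d by (simp add: abs_minus_commute)
qed (use \<kappa>_le log_ratio_le assms in auto)

text \<open>\<mu> is kept apart from \<open>ln (s i)\<close>: for ratios occurring in pairs it lists
  each value once, and f collects the two contributions of a pair.\<close>

lemma H_power_series:
  assumes r: "0 < r" "\<And>x. \<bar>x - x0\<bar> < r \<Longrightarrow> \<bar>x\<bar> < 1 \<and> root x"
    and \<mu>: "\<And>i. \<mu> i \<le> 0" "\<And>t. \<theta> < t \<Longrightarrow> summable (\<lambda>i. exp (t * \<mu> i))"
    and f: "f holomorphic_on UNIV" "deriv f (of_real (H x0 * x0)) \<noteq> 0"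
    and eq: "\<And>x t. \<bar>x - x0\<bar> < r \<Longrightarrow> \<theta> < t \<Longrightarrow> (\<lambda>i. exp (t * (ln (s i) + \<kappa> i * x))) sums 1 \<Longrightarrow>
        f (of_real (t * x)) * of_real (\<Sum>i. exp (t * \<mu> i)) = 1"
  shows "\<exists>c \<rho>. 0 < \<rho> \<and> (\<forall>x. \<bar>x - x0\<bar> < \<rho> \<longrightarrow> ((\<lambda>n. c n * (x - x0) ^ n) has_sum H x) UNIV)"
proof -
  have x0: "\<bar>x0\<bar> < 1" "root x0" using r by auto
  have H0: "\<theta> < H x0" by (rule rootD(1)[OF x0])
  have m: "0 < min r (ln 2 / 2)" using r by simp
  have K: "0 \<le> 4 * H x0 / ln 2" using H0 \<theta> by simp
  show ?thesis
  proof (rule power_series_of_root[where H = H and \<mu> = \<mu> and f = f and ?x0.0 = x0, OF \<mu> \<theta> H0 f _ _ m K])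
    fix x assume "\<bar>x - x0\<bar> < min r (ln 2 / 2)"
    then have x: "\<bar>x - x0\<bar> < r" "\<bar>x - x0\<bar> \<le> ln 2 / 2" by auto
    have rx: "\<bar>x\<bar> < 1" "root x" using r(2)[OF x(1)] by auto
    show "f (of_real (H x * x)) * of_real (\<Sum>i. exp (H x * \<mu> i)) = 1"
      by (rule eq[OF x(1) rootD[OF rx]])
    show "\<bar>H x - H x0\<bar> \<le> 4 * H x0 / ln 2 * \<bar>x - x0\<bar>" by (rule H_Lipschitz[OF rx x0 x(2)])
  qed
qed

lemma H_not_affine:
  assumes r: "0 < r" "\<And>x. \<bar>x - x0\<bar> < r \<Longrightarrow> \<bar>x\<bar> < 1 \<and> root x" and \<kappa>: "\<kappa> j \<noteq> 0" and \<delta>: "0 < \<delta>"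
  shows "\<exists>x. \<bar>x - x0\<bar> < \<delta> \<and> H x \<noteq> \<alpha> * x + \<beta>"
proof (rule ccontr)
  assume "\<not> ?thesis"
  then have aff: "H x = \<alpha> * x + \<beta>" if "\<bar>x - x0\<bar> < \<delta>" for x using that by blast
  have R: "\<bar>x\<bar> < 1" "root x" "H x = \<alpha> * x + \<beta>" if "\<bar>x - x0\<bar> < min r \<delta>" for x
    using r(2)[of x] aff[of x] that by auto
  have "\<kappa> j = 0"
  proof (rule affine_root_constant_coefficients[of x0 "min r \<delta>" \<alpha> \<beta> "\<lambda>i. ln (s i)" \<kappa> j])
    fix x assume x: "\<bar>x - x0\<bar> < min r \<delta>"
    show "(\<lambda>i. exp ((\<alpha> * x + \<beta>) * (ln (s i) + \<kappa> i * x))) sums 1"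
      using rootD(2)[OF R(1,2)[OF x]] R(3)[OF x] by simp
    show "0 < \<alpha> * x + \<beta>" using rootD(1)[OF R(1,2)[OF x]] R(3)[OF x] \<theta> by simp
    show "ln (s i) + \<kappa> i * x < 0" for i
    proof -
      have "- ln 2 < (0::real)" by simp
      then show ?thesis using log_ratio_le[OF R(1)[OF x], of i] by linarith
    qed
  qed (use r \<delta> in auto)
  then show False using \<kappa> by simp
qed

lemma \<Phi>_const: "(\<And>i. \<kappa> i = 0) \<Longrightarrow> \<Phi> \<gamma> = \<Phi> 0"
  by (simp add: \<Phi>_def coef_def[abs_def])

lemma RAH_const:
  assumes "\<And>i. \<kappa> i = 0"
  shows "RAH X disc \<Phi> = ball 0 1"
proof
  show "ball 0 1 \<subseteq> RAH X disc \<Phi>"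
  proof
    fix \<gamma> :: complex assume \<gamma>: "\<gamma> \<in> ball 0 1"
    show "\<gamma> \<in> RAH X disc \<Phi>"
    proof (rule RAH_discI[where T = UNIV and F = "\<lambda>_. h_dim X (\<Phi> 0)"])
      show "h_dim X (\<Phi> \<gamma>) = h_dim X (\<Phi> 0)" for \<gamma> using \<Phi>_const[OF assms, of \<gamma>] by simp
      show "\<exists>c \<rho>. 0 < \<rho> \<and> (\<forall>x. \<bar>x - x0\<bar> < \<rho> \<longrightarrow> ((\<lambda>n. c n * (x - x0) ^ n) has_sum h_dim X (\<Phi> 0)) UNIV)"
        for x0 :: real
        using has_sum_constant_series
        by (intro exI[of _ "\<lambda>n. if n = 0 then h_dim X (\<Phi> 0) else 0"] exI[of _ 1]) simp
    qed (use \<gamma> in auto)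
  qed
qed (auto simp: RAH_def)

text \<open>With \<kappa> = 1 throughout, the factor \<open>exp (t * x)\<close> comes out of the
  sum, so f is exp, whose derivative never vanishes.\<close>

lemma RAH_exp:
  assumes \<kappa>: "\<And>i. \<kappa> i = 1" and T: "open T" "\<And>x. x \<in> T \<Longrightarrow> \<bar>x\<bar> < 1 \<Longrightarrow> root x"
    and \<gamma>: "\<gamma> \<in> ball 0 1" "Re \<gamma> \<in> T"
  shows "\<gamma> \<in> RAH X disc \<Phi>"
proof (rule RAH_discI[where T = T and F = H])
  show "h_dim X (\<Phi> \<gamma>) = H (Re \<gamma>)" if "\<gamma> \<in> ball 0 1" "Re \<gamma> \<in> T" for \<gamma>
    using that T(2) Re_ball by (intro h_dim_if_root) auto
  fix x0 :: real assume x0: "x0 \<in> T" "\<bar>x0\<bar> < 1"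
  have "open (T \<inter> ball 0 1)" using T(1) by auto
  moreover have "x0 \<in> T \<inter> ball 0 1" using x0 by (simp add: dist_real_def)
  ultimately obtain r where r: "0 < r" "ball x0 r \<subseteq> T \<inter> ball 0 1" using open_contains_ball by metis
  have sp: "s i powr t = exp (t * ln (s i))" for i t using s_pos[of i] by (simp add: powr_def)
  show "\<exists>c \<rho>. 0 < \<rho> \<and> (\<forall>x. \<bar>x - x0\<bar> < \<rho> \<longrightarrow> ((\<lambda>n. c n * (x - x0) ^ n) has_sum H x) UNIV)"
  proof (rule H_power_series[where f = exp and \<mu> = "\<lambda>i. ln (s i)", OF r(1)])
    show "\<bar>x\<bar> < 1 \<and> root x" if "\<bar>x - x0\<bar> < r" for x
    proof -
      have "x \<in> T \<inter> ball 0 1" using that by (intro subsetD[OF r(2)]) (simp add: dist_real_def abs_minus_commute)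
      then show ?thesis using T(2)[of x] by (simp add: dist_real_def)
    qed
    show "ln (s i) \<le> 0" for i using s_pos[of i] s_le[of i] by simp
    show "summable (\<lambda>i. exp (t * ln (s i)))" if "\<theta> < t" for t
      using summable_above[OF that] unfolding sp .
    show "deriv exp (complex_of_real (H x0 * x0)) \<noteq> 0"
      by (subst DERIV_imp_deriv[OF DERIV_exp]) simp
    fix x t assume t: "\<theta> < t" "(\<lambda>i. exp (t * (ln (s i) + \<kappa> i * x))) sums 1"
    have "summable (\<lambda>i. exp (t * ln (s i)))" using summable_above[OF t(1)] unfolding sp .
    then have "(\<lambda>i. exp (t * x) * exp (t * ln (s i))) sums (exp (t * x) * (\<Sum>i. exp (t * ln (s i))))"
      by (intro sums_mult summable_sums)
    moreover have "exp (t * x) * exp (t * ln (s i)) = exp (t * (ln (s i) + \<kappa> i * x))" for i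
      using \<kappa> by (simp add: distrib_left add.commute flip: exp_add)
    ultimately have "exp (t * x) * (\<Sum>i. exp (t * ln (s i))) = 1" using t(2) sums_unique2 by fastforce
    then have "complex_of_real (exp (t * x) * (\<Sum>i. exp (t * ln (s i)))) = 1" by (simp only: of_real_1)
    then show "exp (complex_of_real (t * x)) * complex_of_real (\<Sum>i. exp (t * ln (s i))) = 1"
      unfolding exp_of_real by (simp only: of_real_mult)
  qed (auto intro!: holomorphic_intros)
qed (use T \<gamma> in auto)

end

locale similarity_family_cofinitely_regular = similarity_family_finite X R b s \<kappa> 0
  for X R b s \<kappa>
begin

lemma cofinitely_regular:
  assumes \<gamma>: "\<gamma> \<in> ball 0 1"
  shows "\<Phi> \<gamma> \<in> CFR X" and "root (Re \<gamma>)" and "theta X (\<Phi> \<gamma>) = 0"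
proof -
  have fin: "moran_sum (\<lambda>i. norm (coef \<gamma> i)) UNIV t < \<infinity>" if "0 < t" for t
    unfolding norm_coef moran_sum_UNIV_finite_iff summable_ratio_iff[OF Re_ball[OF \<gamma>]]
    using that by (rule summable_above)
  note reg = affine_ifs.cofinitely_regular[OF affine_ifs_coef[OF \<gamma>] fin]
  show "\<Phi> \<gamma> \<in> CFR X" "theta X (\<Phi> \<gamma>) = 0" using reg(1,3) unfolding \<Phi>_def by auto
  show "root (Re \<gamma>)" using reg(2) unfolding root_def norm_coef by blast
qed

end

section \<open>Families with a finite sum at the critical exponent\<close>

locale similarity_family_critical = similarity_family X R b s \<kappa>
  for X R b s \<kappa> +
  fixes \<theta> :: real
  assumes \<theta>_pos: "0 < \<theta>" and not_summable_below: "\<And>t. t < \<theta> \<Longrightarrow> \<not> summable (\<lambda>i. s i powr t)"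
    and summable_crit: "summable (\<lambda>i. s i powr \<theta>)"
begin

sublocale similarity_family_finite X R b s \<kappa> \<theta>
proof
  show "0 \<le> \<theta>" using \<theta>_pos by simp
  show "summable (\<lambda>i. s i powr t)" if "\<theta> < t" for t
  proof (rule summable_comparison_test'[OF summable_crit, of 0])
    show "norm (s n powr t) \<le> s n powr \<theta>" for n
      using that s_pos[of n] s_le[of n] powr_mono'[of \<theta> t "s n"] by simp
  qed
qed

definition crit :: "real \<Rightarrow> real" where
  "crit x = (\<Sum>i. exp (\<theta> * (ln (s i) + \<kappa> i * x)))"

lemma moran_sum_crit: "\<bar>x\<bar> < 1 \<Longrightarrow> moran_sum (ratio x) UNIV \<theta> = ennreal (crit x)"
  using summable_ratio_iff[of x \<theta>] summable_crit unfolding crit_def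
  by (subst moran_sum_UNIV_eq) (auto simp: ratio_powr)

lemma affine_ifs_critical_coef:
  assumes \<gamma>: "\<gamma> \<in> ball 0 1"
  shows "affine_ifs_critical X R (1/2) (coef \<gamma>) b \<theta>"
proof -
  interpret affine_ifs X R "1/2" "coef \<gamma>" b by (rule affine_ifs_coef[OF \<gamma>])
  note iff = moran_sum_UNIV_finite_iff[of "ratio (Re \<gamma>)"] summable_ratio_iff[OF Re_ball[OF \<gamma>]]
  show ?thesis
  proof
    show "0 \<le> \<theta>" by (rule \<theta>)
    show "moran_sum (\<lambda>i. norm (coef \<gamma> i)) UNIV t = \<infinity>" if "t < \<theta>" for t
      using not_summable_below[OF that] iff[of t] unfolding norm_coef by (simp add: not_less top_unique)
    show "moran_sum (\<lambda>i. norm (coef \<gamma> i)) UNIV \<theta> < \<infinity>"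
      using summable_crit iff[of \<theta>] unfolding norm_coef by simp
  qed
qed

lemma classes:
  assumes \<gamma>: "\<gamma> \<in> ball 0 1"
  shows "\<Phi> \<gamma> \<in> IR X \<longleftrightarrow> crit (Re \<gamma>) < 1" and "\<Phi> \<gamma> \<in> CR X \<longleftrightarrow> crit (Re \<gamma>) = 1"
    and "\<Phi> \<gamma> \<in> FSR X \<longleftrightarrow> 1 < crit (Re \<gamma>)" and "\<Phi> \<gamma> \<notin> CFR X" and "theta X (\<Phi> \<gamma>) = \<theta>"
    and "1 < crit (Re \<gamma>) \<Longrightarrow> root (Re \<gamma>)" and "crit (Re \<gamma>) \<le> 1 \<Longrightarrow> h_dim X (\<Phi> \<gamma>) = \<theta>"
proof -
  interpret A: affine_ifs_critical X R "1/2" "coef \<gamma>" b \<theta> by (rule affine_ifs_critical_coef[OF \<gamma>])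
  have Z: "moran_sum (\<lambda>i. norm (coef \<gamma> i)) UNIV \<theta> = ennreal (crit (Re \<gamma>))"
    unfolding norm_coef by (rule moran_sum_crit[OF Re_ball[OF \<gamma>]])
  show "\<Phi> \<gamma> \<in> IR X \<longleftrightarrow> crit (Re \<gamma>) < 1" unfolding \<Phi>_def A.in_IR_iff Z by simp
  show "\<Phi> \<gamma> \<in> CR X \<longleftrightarrow> crit (Re \<gamma>) = 1" unfolding \<Phi>_def A.in_CR_iff Z by simp
  show "\<Phi> \<gamma> \<in> FSR X \<longleftrightarrow> 1 < crit (Re \<gamma>)" unfolding \<Phi>_def A.in_FSR_iff Z by simp
  show "\<Phi> \<gamma> \<notin> CFR X" unfolding \<Phi>_def by (rule A.not_in_CFR)
  show "theta X (\<Phi> \<gamma>) = \<theta>" unfolding \<Phi>_def by (rule A.theta_eq)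
  show "h_dim X (\<Phi> \<gamma>) = \<theta>" if "crit (Re \<gamma>) \<le> 1"
    unfolding \<Phi>_def by (rule A.h_dim_critical) (use that Z in simp)
  show "root (Re \<gamma>)" if "1 < crit (Re \<gamma>)"
  proof -
    have "1 < moran_sum (\<lambda>i. norm (coef \<gamma> i)) UNIV \<theta>" unfolding Z using that by simp
    from A.h_dim_supercritical[OF this] show ?thesis unfolding root_def norm_coef by blast
  qed
qed

lemma h_dim_eq_H:
  assumes \<gamma>: "\<gamma> \<in> ball 0 1"
  shows "h_dim X (\<Phi> \<gamma>) = H (Re \<gamma>)"
proof (cases "1 < crit (Re \<gamma>)")
  case True
  then show ?thesis using \<gamma> classes(6)[OF \<gamma>] by (intro h_dim_if_root) auto
next
  case False
  then show ?thesis
    using classes(7)[OF \<gamma>] classes(7)[OF of_real_ball[OF Re_ball[OF \<gamma>]]] by (simp add: H_def)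
qed

lemma H_subcritical: "\<bar>x\<bar> < 1 \<Longrightarrow> crit x \<le> 1 \<Longrightarrow> H x = \<theta>"
  using classes(7)[OF of_real_ball, of x] by (simp add: H_def)

lemma root_if_supercritical: "\<bar>x\<bar> < 1 \<Longrightarrow> 1 < crit x \<Longrightarrow> root x"
  using classes(6)[OF of_real_ball, of x] by simp

lemma H_supercritical: "\<bar>x\<bar> < 1 \<Longrightarrow> 1 < crit x \<Longrightarrow> \<theta> < H x"
  by (rule rootD(1)[OF _ root_if_supercritical])

end

section \<open>The eight types\<close>

lemma params_disc: "params disc \<Phi> S = {\<gamma>\<in>ball 0 1. \<Phi> \<gamma> \<in> S}"
  by (simp add: params_def)

lemma disc_points:
  "{\<gamma>\<in>ball 0 1. Re \<gamma> = 0} \<noteq> {}" "{\<gamma>\<in>ball 0 1. 0 < Re \<gamma>} \<noteq> {}" "{\<gamma>\<in>ball 0 1. Re \<gamma> < 0} \<noteq> {}"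
proof -
  have "0 \<in> {\<gamma>\<in>ball 0 1. Re \<gamma> = 0}" "1/2 \<in> {\<gamma>\<in>ball 0 1. 0 < Re \<gamma>}" "- 1/2 \<in> {\<gamma>\<in>ball 0 1. Re \<gamma> < 0}"
    by auto
  then show "{\<gamma>\<in>ball 0 1. Re \<gamma> = 0} \<noteq> {}" "{\<gamma>\<in>ball 0 1. 0 < Re \<gamma>} \<noteq> {}" "{\<gamma>\<in>ball 0 1. Re \<gamma> < 0} \<noteq> {}"
    by blast+
qed

text \<open>An interval of positive numbers close to a given point, which may be 0. It serves to
  approach the critical line from its supercritical side.\<close>

lemma right_interval:
  fixes x \<delta> :: real
  assumes "0 \<le> x" "x < 1" "0 < \<delta>"
  shows "\<exists>x0 r. 0 < r \<and> (\<forall>y. \<bar>y - x0\<bar> < r \<longrightarrow> \<bar>y - x\<bar> < \<delta> \<and> 0 < y \<and> y < 1)"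
proof (intro exI conjI allI impI)
  define r where "r = min \<delta> (1 - x) / 2"
  have r: "0 < r" "2 * r \<le> \<delta>" "2 * r \<le> 1 - x" using assms by (auto simp: r_def)
  show "0 < min \<delta> (1 - x) / 2" using r(1) by (simp add: r_def)
  fix y assume "\<bar>y - (x + min \<delta> (1 - x) / 2)\<bar> < min \<delta> (1 - x) / 2"
  then have "\<bar>y - (x + r)\<bar> < r" by (simp add: r_def)
  then show "\<bar>y - x\<bar> < \<delta>" "0 < y" "y < 1" using r assms by (auto simp: abs_less_iff)
qed

lemma abs_near: "\<bar>x - x0\<bar> < 1 - \<bar>x0\<bar> \<Longrightarrow> \<bar>x\<bar> < (1::real)"
  by linarith

context similarity_family_finite
begin

text \<open>The ratio \<open>g j\<close> occurs at the index 2 * j with sign +1 and at 2 * j + 1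
  with sign -1, so each pair contributes \<open>2 * cosh (t * x)\<close> times the power of
  \<open>g j\<close>.\<close>

lemma sums_paired:
  assumes s: "\<And>i. s i = g (i div 2)" and \<kappa>: "\<And>i. \<kappa> i = (if even i then 1 else - 1)"
    and S: "(\<lambda>j. exp (t * ln (g j))) sums S"
  shows "(\<lambda>i. exp (t * (ln (s i) + \<kappa> i * x))) sums ((exp (t * x) + exp (- (t * x))) * S)"
proof -
  have "(\<lambda>i. if even i then exp (t * x) * exp (t * ln (g (i div 2)))
        else exp (- (t * x)) * exp (t * ln (g ((i - 1) div 2)))) sums (exp (- (t * x)) * S + exp (t * x) * S)"
    by (rule sums_if[OF sums_mult[OF S] sums_mult[OF S]])
  moreover have "(if even i then exp (t * x) * exp (t * ln (g (i div 2)))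
        else exp (- (t * x)) * exp (t * ln (g ((i - 1) div 2)))) = exp (t * (ln (s i) + \<kappa> i * x))" for i
  proof (cases "even i")
    case False
    then have "(i - 1) div 2 = i div 2" by presburger
    then show ?thesis using False by (simp add: s \<kappa> algebra_simps flip: exp_add)
  qed (simp add: s \<kappa> algebra_simps flip: exp_add)
  ultimately show ?thesis by (simp add: algebra_simps)
qed

text \<open>Here f is \<open>exp z + exp (- z)\<close>, whose derivative vanishes at 0. So the
  method gives analyticity off the line Re \<gamma> = 0, where \<open>H x0 * x0\<close> is
  nonzero.\<close>

lemma RAH_paired:
  assumes s: "\<And>i. s i = g (i div 2)" and \<kappa>: "\<And>i. \<kappa> i = (if even i then 1 else - 1)"
    and T: "\<And>x. \<bar>x\<bar> < 1 \<Longrightarrow> x \<noteq> 0 \<Longrightarrow> root x"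
    and \<gamma>: "\<gamma> \<in> ball 0 1" "Re \<gamma> \<noteq> 0"
  shows "\<gamma> \<in> RAH X disc \<Phi>"
proof (rule RAH_discI[where T = "- {0}" and F = H])
  show "h_dim X (\<Phi> \<gamma>) = H (Re \<gamma>)" if "\<gamma> \<in> ball 0 1" "Re \<gamma> \<in> - {0}" for \<gamma>
    using that T Re_ball by (intro h_dim_if_root) auto
  fix x0 :: real assume x0: "x0 \<in> - {0}" "\<bar>x0\<bar> < 1"
  have g2: "g j = s (2 * j)" for j by (simp add: s)
  have sm: "summable (\<lambda>j. exp (t * ln (g j)))" if "\<theta> < t" for t
  proof -
    have "summable ((\<lambda>i. s i powr t) \<circ> (\<lambda>j. 2 * j))"
      by (rule summable_reindex[OF summable_above[OF that]]) (auto simp: inj_def)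
    moreover have "exp (t * ln (g j)) = ((\<lambda>i. s i powr t) \<circ> (\<lambda>j. 2 * j)) j" for j
      using s_pos[of "2 * j"] by (simp add: g2 powr_def)
    ultimately show ?thesis by (simp add: o_def)
  qed
  define r where "r = min (1 - \<bar>x0\<bar>) \<bar>x0\<bar>"
  have near: "\<bar>x\<bar> < 1 \<and> root x" if "\<bar>x - x0\<bar> < r" for x
  proof -
    have "\<bar>x\<bar> < 1" "x \<noteq> 0" using that by (auto simp: r_def)
    then show ?thesis using T by blast
  qed
  have r: "0 < r" using x0 by (simp add: r_def)
  have H0: "0 < H x0" using rootD(1)[of x0] near[of x0] r \<theta> by simp
  show "\<exists>c \<rho>. 0 < \<rho> \<and> (\<forall>x. \<bar>x - x0\<bar> < \<rho> \<longrightarrow> ((\<lambda>n. c n * (x - x0) ^ n) has_sum H x) UNIV)"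
  proof (rule H_power_series[where f = "\<lambda>z. exp z + exp (- z)" and \<mu> = "\<lambda>j. ln (g j)", OF r near _ sm])
    show "ln (g j) \<le> 0" for j using s_pos[of "2 * j"] s_le[of "2 * j"] unfolding g2 by simp
    show "(\<lambda>z::complex. exp z + exp (- z)) holomorphic_on UNIV" by (intro holomorphic_intros)
    have D: "((\<lambda>z::complex. exp z + exp (- z)) has_field_derivative exp y - exp (- y)) (at y)" for y
      by (auto intro!: derivative_eq_intros)
    have "deriv (\<lambda>z::complex. exp z + exp (- z)) (of_real y) = of_real (exp y - exp (- y))" for y :: real
      unfolding DERIV_imp_deriv[OF D] of_real_minus[symmetric] exp_of_real by simp
    moreover have "exp (H x0 * x0) - exp (- (H x0 * x0)) \<noteq> 0" using H0 x0(1) by simp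
    ultimately show "deriv (\<lambda>z::complex. exp z + exp (- z)) (of_real (H x0 * x0)) \<noteq> 0" by (metis of_real_eq_0_iff)
    fix x t assume t: "\<theta> < t" "(\<lambda>i. exp (t * (ln (s i) + \<kappa> i * x))) sums 1"
    have "(exp (t * x) + exp (- (t * x))) * (\<Sum>j. exp (t * ln (g j))) = 1"
      using sums_unique2[OF sums_paired[OF s \<kappa> summable_sums[OF sm[OF t(1)]]] t(2)] .
    then have "complex_of_real ((exp (t * x) + exp (- (t * x))) * (\<Sum>j. exp (t * ln (g j)))) = 1"
      by (simp only: of_real_1)
    then show "(exp (complex_of_real (t * x)) + exp (- complex_of_real (t * x))) * complex_of_real (\<Sum>j. exp (t * ln (g j))) = 1"
      unfolding of_real_minus[symmetric] exp_of_real by (simp only: of_real_mult of_real_add)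
  qed
qed (use \<gamma> in auto)

lemma NPHH_if_root:
  assumes T: "\<And>x. \<bar>x\<bar> < 1 \<Longrightarrow> root x" and \<kappa>: "\<kappa> j \<noteq> 0" and \<gamma>: "\<gamma> \<in> ball 0 1"
  shows "\<gamma> \<in> NPHH X disc \<Phi>"
proof (rule NPHH_discI[OF _ \<gamma>])
  show "h_dim X (\<Phi> \<gamma>) = H (Re \<gamma>)" if "\<gamma> \<in> ball 0 1" for \<gamma>
    using that T Re_ball by (intro h_dim_if_root) auto
  show "\<exists>x. \<bar>x - Re \<gamma>\<bar> < \<delta> \<and> H x \<noteq> \<alpha> * x + \<beta>" if "0 < \<delta>" for \<alpha> \<beta> \<delta>
    using T Re_ball[OF \<gamma>] abs_near
    by (intro H_not_affine[where r = "1 - \<bar>Re \<gamma>\<bar>" and j = j] \<kappa> that) auto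
qed

lemma RAH_subset: "RAH X disc \<Phi> \<subseteq> ball 0 1" and NPHH_subset: "NPHH X disc \<Phi> \<subseteq> ball 0 1"
  by (auto simp: RAH_def NPHH_def)

end

context similarity_family_cofinitely_regular
begin

lemma params_CFR: "params disc \<Phi> (CFR X) = ball 0 1"
  unfolding params_disc using cofinitely_regular(1) by auto

lemma root_all: "\<bar>x\<bar> < 1 \<Longrightarrow> root x"
  using cofinitely_regular(2)[OF of_real_ball, of x] by simp

lemma type_I:
  assumes \<kappa>: "\<And>i. \<kappa> i = 0"
  shows "is_of_type Type_I X disc \<Phi>"
proof -
  have "0 < h_dim X (\<Phi> 0)" using rootD(1)[of 0] root_all[of 0] by (simp add: H_def)
  moreover have "\<forall>\<gamma>\<in>topspace (mtop disc). theta X (\<Phi> \<gamma>) = 0 \<and> h_dim X (\<Phi> \<gamma>) = h_dim X (\<Phi> 0)"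
    using cofinitely_regular(3) arg_cong[OF \<Phi>_const[OF \<kappa>], of "h_dim X"] by simp
  ultimately have "h_constant_above_theta X disc \<Phi>"
    unfolding h_constant_above_theta_def by (intro exI conjI)
  then show ?thesis using params_CFR RAH_const[OF \<kappa>] by simp
qed

lemma type_II:
  assumes \<kappa>: "\<And>i. \<kappa> i = 1"
  shows "is_of_type Type_II X disc \<Phi>"
proof -
  have "ball 0 1 \<subseteq> RAH X disc \<Phi>"
    using RAH_exp[OF \<kappa> open_UNIV root_all] by auto
  moreover have "ball 0 1 \<subseteq> NPHH X disc \<Phi>"
    using NPHH_if_root[OF root_all, of 0] \<kappa> by auto
  ultimately show ?thesis using params_CFR RAH_subset NPHH_subset by auto
qed

end

context similarity_family_critical
begin

lemma params_classes:
  "params disc \<Phi> (IR X) = {\<gamma>\<in>ball 0 1. crit (Re \<gamma>) < 1}"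
  "params disc \<Phi> (CR X) = {\<gamma>\<in>ball 0 1. crit (Re \<gamma>) = 1}"
  "params disc \<Phi> (FSR X) = {\<gamma>\<in>ball 0 1. 1 < crit (Re \<gamma>)}"
  "params disc \<Phi> (CFR X) = {}"
  unfolding params_disc using classes(1-4) by auto

lemma crit_const: "(\<And>i. \<kappa> i = 0) \<Longrightarrow> crit x = (\<Sum>i. s i powr \<theta>)"
  using s_pos by (simp add: crit_def powr_def less_imp_neq[OF s_pos, symmetric])

lemma crit_exp:
  assumes \<kappa>: "\<And>i. \<kappa> i = 1"
  shows "crit x = exp (\<theta> * x) * (\<Sum>i. s i powr \<theta>)"
proof -
  have "exp (\<theta> * (ln (s i) + \<kappa> i * x)) = exp (\<theta> * x) * s i powr \<theta>" for i
    using s_pos[of i] by (simp add: \<kappa> powr_def distrib_left exp_add mult.commute)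
  then show ?thesis unfolding crit_def using suminf_mult[OF summable_crit] by simp
qed

lemma type_III:
  assumes \<kappa>: "\<And>i. \<kappa> i = 0" and gr: "1 < (\<Sum>i. s i powr \<theta>)"
  shows "is_of_type Type_III X disc \<Phi>"
proof -
  have cr: "1 < crit x" for x using gr crit_const[OF \<kappa>] by simp
  have "\<theta> < h_dim X (\<Phi> 0)" using H_supercritical[of 0] cr by (simp add: H_def)
  moreover have "\<forall>\<gamma>\<in>topspace (mtop disc). theta X (\<Phi> \<gamma>) = \<theta> \<and> h_dim X (\<Phi> \<gamma>) = h_dim X (\<Phi> 0)"
    using classes(5) arg_cong[OF \<Phi>_const[OF \<kappa>], of "h_dim X"] by simp
  ultimately have "h_constant_above_theta X disc \<Phi>"
    unfolding h_constant_above_theta_def by (intro exI conjI)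
  moreover have "params disc \<Phi> (FSR X) = ball 0 1" unfolding params_classes using cr by auto
  ultimately show ?thesis using RAH_const[OF \<kappa>] by simp
qed

lemma type_IV:
  assumes \<kappa>: "\<And>i. \<kappa> i = 1" and cr: "\<And>x. \<bar>x\<bar> < 1 \<Longrightarrow> 1 < crit x"
  shows "is_of_type Type_IV X disc \<Phi>"
proof -
  have root: "root x" if "\<bar>x\<bar> < 1" for x using root_if_supercritical[OF that cr[OF that]] .
  have "ball 0 1 \<subseteq> RAH X disc \<Phi>"
    using RAH_exp[OF \<kappa> open_UNIV root] by auto
  moreover have "ball 0 1 \<subseteq> NPHH X disc \<Phi>"
    using NPHH_if_root[OF root, of 0] \<kappa> by auto
  moreover have "params disc \<Phi> (FSR X) = ball 0 1" unfolding params_classes using cr Re_ball by auto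
  ultimately show ?thesis using RAH_subset NPHH_subset by auto
qed

lemma h_equals_theta:
  assumes "\<And>x. crit x \<le> 1"
  shows "h_equals_theta X disc \<Phi>"
  unfolding h_equals_theta_def using classes(5,7) assms by (intro exI[of _ \<theta>]) auto

lemma type_VI:
  assumes \<kappa>: "\<And>i. \<kappa> i = 0" and eq: "(\<Sum>i. s i powr \<theta>) = 1"
  shows "is_of_type Type_VI X disc \<Phi>"
proof -
  have cr: "crit x = 1" for x using eq crit_const[OF \<kappa>] by simp
  then have "params disc \<Phi> (CR X) = ball 0 1" unfolding params_classes by auto
  then show ?thesis using RAH_const[OF \<kappa>] h_equals_theta cr by simp
qed

lemma type_VIII:
  assumes \<kappa>: "\<And>i. \<kappa> i = 0" and less: "(\<Sum>i. s i powr \<theta>) < 1"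
  shows "is_of_type Type_VIII X disc \<Phi>"
proof -
  have cr: "crit x < 1" for x using less crit_const[OF \<kappa>] by simp
  then have "params disc \<Phi> (IR X) = ball 0 1" unfolding params_classes by auto
  then show ?thesis using RAH_const[OF \<kappa>] h_equals_theta less_imp_le[OF cr] by simp
qed

text \<open>It covers points of the critical line, at which there is no root above \<theta>. An
  affine formula around such a point would hold on a supercritical interval nearby, where it is
  impossible.\<close>

lemma NPHH_near_supercritical:
  assumes \<gamma>: "\<gamma> \<in> ball 0 1" and \<kappa>: "\<kappa> j \<noteq> 0"
    and near: "\<And>\<delta>. 0 < \<delta> \<Longrightarrow> \<exists>x0 r. 0 < r \<and>
      (\<forall>x. \<bar>x - x0\<bar> < r \<longrightarrow> \<bar>x - Re \<gamma>\<bar> < \<delta> \<and> \<bar>x\<bar> < 1 \<and> 1 < crit x)"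
  shows "\<gamma> \<in> NPHH X disc \<Phi>"
proof (rule NPHH_discI[where F = H, OF _ \<gamma>])
  show "h_dim X (\<Phi> \<gamma>) = H (Re \<gamma>)" if "\<gamma> \<in> ball 0 1" for \<gamma> by (rule h_dim_eq_H[OF that])
next
  fix \<alpha> \<beta> \<delta> :: real assume "0 < \<delta>"
  then obtain x0 r where r: "0 < r" "\<And>x. \<bar>x - x0\<bar> < r \<Longrightarrow> \<bar>x - Re \<gamma>\<bar> < \<delta> \<and> \<bar>x\<bar> < 1 \<and> 1 < crit x"
    using near by metis
  have "\<exists>x. \<bar>x - x0\<bar> < r \<and> H x \<noteq> \<alpha> * x + \<beta>"
    using r root_if_supercritical by (intro H_not_affine[where r = r and j = j] \<kappa>) auto
  then show "\<exists>x. \<bar>x - Re \<gamma>\<bar> < \<delta> \<and> H x \<noteq> \<alpha> * x + \<beta>" using r(2) by blast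
qed

lemma type_V:
  assumes s: "\<And>i. s i = g (i div 2)" and \<kappa>: "\<And>i. \<kappa> i = (if even i then 1 else - 1)"
    and eq: "(\<lambda>j. g j powr \<theta>) sums (1 / 2)"
  shows "is_of_type Type_V X disc \<Phi>"
proof -
  \<comment> \<open>The sum 1/2 of the powers of g cancels the 2 in \<open>2 * cosh\<close>, so the
    minimum of \<open>crit\<close> is exactly 1.\<close>
  have cosh: "crit x = cosh (\<theta> * x)" for x
  proof -
    have "g j powr \<theta> = exp (\<theta> * ln (g j))" for j
      using s_pos[of "2 * j"] by (simp add: s powr_def)
    then have "(\<lambda>j. exp (\<theta> * ln (g j))) sums (1 / 2)" using eq by simp
    from sums_paired[OF s \<kappa> this, of x] show ?thesis
      unfolding crit_def cosh_def by (simp add: sums_unique[symmetric])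
  qed
  have gr: "1 < crit x" if "x \<noteq> 0" for x
    using that \<theta>_pos cosh_real_ge_1[of "\<theta> * x"] cosh_real_one_iff[of "\<theta> * x"] unfolding cosh by (simp add: less_le)
  have c0: "crit x = 1 \<longleftrightarrow> x = 0" and c1: "1 < crit x \<longleftrightarrow> x \<noteq> 0" for x
    using gr[of x] cosh[of 0] by (cases "x = 0"; simp)+
  have FSR: "params disc \<Phi> (FSR X) = {\<gamma>\<in>ball 0 1. Re \<gamma> \<noteq> 0}" unfolding params_classes c1 ..
  have CR: "params disc \<Phi> (CR X) = {\<gamma>\<in>ball 0 1. Re \<gamma> = 0}" unfolding params_classes c0 ..
  have fr: "mtop disc frontier_of params disc \<Phi> (FSR X) = params disc \<Phi> (CR X)"
    unfolding FSR CR by (rule frontier_disc[where p = True and n = True]) auto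
  have "\<kappa> 0 \<noteq> 0" using \<kappa>[of 0] by simp
  then have "\<gamma> \<in> NPHH X disc \<Phi>" if \<gamma>: "\<gamma> \<in> ball 0 1" for \<gamma>
  proof (rule NPHH_near_supercritical[OF \<gamma>])
    fix \<delta> :: real assume "0 < \<delta>"
    \<comment> \<open>\<open>crit\<close> exceeds 1 on both sides of 0, so it suffices to work at
      \<open>\<bar>Re \<gamma>\<bar>\<close> and to reflect the interval when Re \<gamma> is
      negative.\<close>
    then obtain x0 r where r: "0 < r"
      "\<And>y. \<bar>y - x0\<bar> < r \<Longrightarrow> \<bar>y - \<bar>Re \<gamma>\<bar>\<bar> < \<delta> \<and> 0 < y \<and> y < 1"
      using right_interval[of "\<bar>Re \<gamma>\<bar>" \<delta>] Re_ball[OF \<gamma>] by auto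
    show "\<exists>x0 r. 0 < r \<and> (\<forall>x. \<bar>x - x0\<bar> < r \<longrightarrow> \<bar>x - Re \<gamma>\<bar> < \<delta> \<and> \<bar>x\<bar> < 1 \<and> 1 < crit x)"
    proof (cases "0 \<le> Re \<gamma>")
      case True
      have "\<bar>x - Re \<gamma>\<bar> < \<delta> \<and> \<bar>x\<bar> < 1 \<and> 1 < crit x" if "\<bar>x - x0\<bar> < r" for x
        using r(2)[OF that] True gr[of x] by simp
      then show ?thesis using r(1) by (intro exI[of _ x0] exI[of _ r] conjI allI impI) auto
    next
      case False
      have "\<bar>x - Re \<gamma>\<bar> < \<delta> \<and> \<bar>x\<bar> < 1 \<and> 1 < crit x" if "\<bar>x - - x0\<bar> < r" for x
      proof -
        have "\<bar>- x - x0\<bar> < r" using that by linarith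
        then have "\<bar>- x - \<bar>Re \<gamma>\<bar>\<bar> < \<delta>" "x < 0" "- 1 < x" using r(2)[of "- x"] by auto
        then show ?thesis using False gr[of x] by auto
      qed
      then show ?thesis using r(1) by (intro exI[of _ "- x0"] exI[of _ r] conjI allI impI) auto
    qed
  qed
  then have NPHH: "NPHH X disc \<Phi> = ball 0 1" using NPHH_subset by auto
  have RAH: "{\<gamma>\<in>ball 0 1. Re \<gamma> \<noteq> 0} \<subseteq> RAH X disc \<Phi>"
    using RAH_paired[OF s \<kappa> root_if_supercritical[OF _ gr]] by blast
  have "ball 0 1 = params disc \<Phi> (FSR X) \<union> params disc \<Phi> (CR X)" unfolding FSR CR by auto
  moreover have "params disc \<Phi> (FSR X) \<noteq> {}" "params disc \<Phi> (CR X) \<noteq> {}"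
    unfolding FSR CR using disc_points by auto
  moreover have "params disc \<Phi> (FSR X) \<subseteq> RAH X disc \<Phi>" unfolding FSR by (rule RAH)
  moreover have "topspace (mtop disc) = ball 0 1" by simp
  ultimately show ?thesis
    unfolding is_of_type.simps Let_def using NPHH fr by metis
qed

lemma type_VII:
  assumes \<kappa>: "\<And>i. \<kappa> i = 1" and eq: "(\<Sum>i. s i powr \<theta>) = 1"
  shows "is_of_type Type_VII X disc \<Phi>"
proof -
  have crit: "crit x = exp (\<theta> * x)" for x using eq crit_exp[OF \<kappa>] by simp
  have c: "crit x < 1 \<longleftrightarrow> x < 0" "crit x = 1 \<longleftrightarrow> x = 0" "1 < crit x \<longleftrightarrow> 0 < x" for x
    using \<theta>_pos by (auto simp: crit mult_less_0_iff zero_less_mult_iff)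
  note cl = params_classes[unfolded c]
  have frI: "mtop disc frontier_of {\<gamma>\<in>ball 0 1. Re \<gamma> < 0} = {\<gamma>\<in>ball 0 1. Re \<gamma> = 0}"
    by (rule frontier_disc[where p = False and n = True]) auto
  have frF: "mtop disc frontier_of {\<gamma>\<in>ball 0 1. 0 < Re \<gamma>} = {\<gamma>\<in>ball 0 1. Re \<gamma> = 0}"
    by (rule frontier_disc[where p = True and n = False]) auto
  have open_IR: "openin (mtop disc) {\<gamma>\<in>ball 0 1. Re \<gamma> < 0}"
  proof -
    have "open {\<gamma>. Re \<gamma> < 0}" by (rule open_halfspace_Re_lt)
    then have "openin (mtop disc) (ball 0 1 \<inter> {\<gamma>. Re \<gamma> < 0})" by (simp add: openin_open_Int)
    then show ?thesis by (simp add: Int_def)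
  qed
  have sub: "h_dim X (\<Phi> \<gamma>) = \<theta>" if "\<gamma> \<in> ball 0 1" "Re \<gamma> \<le> 0" for \<gamma>
    using classes(7)[OF that(1)] that(2) c(3)[of "Re \<gamma>"] by (simp add: not_less[symmetric])
  have RAH: "\<gamma> \<in> RAH X disc \<Phi>" if \<gamma>: "\<gamma> \<in> ball 0 1" "Re \<gamma> \<noteq> 0" for \<gamma>
  proof (cases "0 < Re \<gamma>")
    case True
    then show ?thesis
      using c(3) root_if_supercritical by (intro RAH_exp[OF \<kappa> open_greaterThan[of 0] _ \<gamma>(1)]) auto
  next
    case False
    show ?thesis
    proof (rule RAH_discI[where T = "{..<0}" and F = "\<lambda>_. \<theta>"])
      show "h_dim X (\<Phi> \<gamma>) = \<theta>" if "\<gamma> \<in> ball 0 1" "Re \<gamma> \<in> {..<0}" for \<gamma> using sub that by simp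
      show "\<exists>c \<rho>. 0 < \<rho> \<and> (\<forall>x. \<bar>x - x0\<bar> < \<rho> \<longrightarrow> ((\<lambda>n. c n * (x - x0) ^ n) has_sum \<theta>) UNIV)" for x0 :: real
        using has_sum_constant_series
        by (intro exI[of _ "\<lambda>n. if n = 0 then \<theta> else 0"] exI[of _ 1]) simp
    qed (use \<gamma> False in auto)
  qed
  \<comment> \<open>H equals \<theta> up to 0 and is larger beyond, which no power series at 0
    allows.\<close>
  have notRAH: "\<gamma> \<notin> RAH X disc \<Phi>" if "\<gamma> \<in> ball 0 1" "Re \<gamma> = 0" for \<gamma>
  proof (rule not_RAH_disc[where F = H and \<theta> = \<theta>, OF _ _ _ that])
    show "h_dim X (\<Phi> \<gamma>) = H (Re \<gamma>)" if "\<gamma> \<in> ball 0 1" for \<gamma> by (rule h_dim_eq_H[OF that])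
    show "H x = \<theta>" if "- 1 < x" "x \<le> 0" for x
      using that c(3)[of x] by (intro H_subcritical) (auto simp: not_less[symmetric])
    show "H x \<noteq> \<theta>" if "0 < x" "x < 1" for x
      using H_supercritical[of x] that c(3)[of x] by simp
  qed
  have NP: "\<gamma> \<in> NPHH X disc \<Phi>" if "\<gamma> \<in> ball 0 1" "0 \<le> Re \<gamma>" for \<gamma>
  proof (rule NPHH_near_supercritical[OF that(1), of 0])
    show "\<exists>x0 r. 0 < r \<and> (\<forall>x. \<bar>x - x0\<bar> < r \<longrightarrow> \<bar>x - Re \<gamma>\<bar> < \<delta> \<and> \<bar>x\<bar> < 1 \<and> 1 < crit x)"
      if "0 < \<delta>" for \<delta>
    proof -
      obtain x0 r where r: "0 < r"
        "\<And>y. \<bar>y - x0\<bar> < r \<Longrightarrow> \<bar>y - Re \<gamma>\<bar> < \<delta> \<and> 0 < y \<and> y < 1"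
        using right_interval[of "Re \<gamma>" \<delta>] \<open>0 < \<delta>\<close> \<open>0 \<le> Re \<gamma>\<close> Re_ball[OF \<open>\<gamma> \<in> ball 0 1\<close>] by auto
      then have "\<bar>x - Re \<gamma>\<bar> < \<delta> \<and> \<bar>x\<bar> < 1 \<and> 1 < crit x" if "\<bar>x - x0\<bar> < r" for x
        using r(2)[OF that] c(3)[of x] by simp
      then show ?thesis using r(1) by (intro exI[of _ x0] exI[of _ r] conjI allI impI) auto
    qed
  qed (simp add: \<kappa>)
  have PH: "\<gamma> \<notin> NPHH X disc \<Phi>" if "\<gamma> \<in> ball 0 1" "Re \<gamma> < 0" for \<gamma>
    by (rule not_NPHH_disc[OF open_IR, where c = \<theta>]) (use that sub in auto)
  have "NPHH X disc \<Phi> = {\<gamma>\<in>ball 0 1. 0 < Re \<gamma>} \<union> {\<gamma>\<in>ball 0 1. Re \<gamma> = 0}"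
  proof (intro equalityI subsetI)
    fix \<gamma> assume "\<gamma> \<in> NPHH X disc \<Phi>"
    then show "\<gamma> \<in> {\<gamma>\<in>ball 0 1. 0 < Re \<gamma>} \<union> {\<gamma>\<in>ball 0 1. Re \<gamma> = 0}"
      using PH[of \<gamma>] NPHH_subset by (cases "Re \<gamma>" "0::real" rule: linorder_cases) auto
  next
    fix \<gamma> assume "\<gamma> \<in> {\<gamma>\<in>ball 0 1. 0 < Re \<gamma>} \<union> {\<gamma>\<in>ball 0 1. Re \<gamma> = 0}"
    then show "\<gamma> \<in> NPHH X disc \<Phi>" using NP[of \<gamma>] by auto
  qed
  moreover have "{\<gamma>\<in>ball 0 1. 0 < Re \<gamma>} \<union> {\<gamma>\<in>ball 0 1. Re \<gamma> < 0} \<subseteq> RAH X disc \<Phi>" using RAH by auto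
  moreover have "{\<gamma>\<in>ball 0 1. Re \<gamma> = 0} \<subseteq> topspace (mtop disc) - RAH X disc \<Phi>" using notRAH by auto
  ultimately show ?thesis
    unfolding is_of_type.simps Let_def cl frI frF using disc_points by blast
qed

end

section \<open>Choice of the ratios and conclusion\<close>

lemma similarity_family_exists:
  assumes X: "cifs_space X"
  shows "\<exists>R \<epsilon>. 0 < \<epsilon> \<and> (\<forall>s \<kappa>. (\<forall>i. 0 < s i) \<longrightarrow> summable s \<longrightarrow> suminf s \<le> \<epsilon> \<longrightarrow> (\<forall>i. \<bar>\<kappa> i\<bar> \<le> 1) \<longrightarrow>
           (\<exists>b. similarity_family X R b s \<kappa>))"
proof -
  obtain R \<epsilon> where R: "0 < R" "0 < \<epsilon>" "\<epsilon> \<le> 1 / 6" "X \<subseteq> ball 0 R"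
    and b: "\<forall>s::nat \<Rightarrow> real. (\<forall>i. 0 < s i) \<longrightarrow> summable s \<longrightarrow> suminf s \<le> \<epsilon> \<longrightarrow>
      (\<exists>b. (\<forall>i. ball (b i) (3 * R * s i) \<subseteq> interior X) \<and>
           (\<forall>i j. i \<noteq> j \<longrightarrow> ball (b i) (3 * R * s i) \<inter> ball (b j) (3 * R * s j) = {}))"
    using discs_in_cifs_space[OF X] by (elim exE conjE)
  have "\<exists>b. similarity_family X R b s \<kappa>"
    if s: "\<forall>i. 0 < s i" "summable s" "suminf s \<le> \<epsilon>" "\<forall>i. \<bar>\<kappa> i\<bar> \<le> 1" for s \<kappa> :: "nat \<Rightarrow> real"
  proof -
    obtain b where b': "\<forall>i. ball (b i) (3 * R * s i) \<subseteq> interior X"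
      "\<forall>i j. i \<noteq> j \<longrightarrow> ball (b i) (3 * R * s i) \<inter> ball (b j) (3 * R * s j) = {}"
      using b[rule_format, of s] s by auto
    have "s i \<le> 1 / 6" for i
      using sum_le_suminf[OF s(2), of "{i}"] s(1,3) R(3) by (simp add: less_imp_le)
    then have "similarity_family X R b s \<kappa>"
      using X R(4) s b' by unfold_locales auto
    then show ?thesis by (rule exI[of _ b])
  qed
  then show ?thesis using R(2) by (intro exI[of _ R] exI[of _ \<epsilon>] conjI allI impI)
qed

text \<open>In the total one factor \<open>w i\<close> is estimated by \<epsilon> and the other is
  summed; at exponent 1/2 the square cancels and \<epsilon> drops out.\<close>

lemma weights_squared:
  fixes w :: "nat \<Rightarrow> real"
  assumes w: "\<And>i. 0 < w i" "\<And>i. w i \<le> \<epsilon>" "w sums 1" "\<forall>\<tau><1. \<not> summable (\<lambda>i. w i powr \<tau>)"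
    and c: "0 < c"
  shows "summable (\<lambda>i. c * (w i)\<^sup>2)" and "(\<Sum>i. c * (w i)\<^sup>2) \<le> c * \<epsilon>"
    and "\<And>t. t < 1 / 2 \<Longrightarrow> \<not> summable (\<lambda>i. (c * (w i)\<^sup>2) powr t)"
    and "(\<lambda>i. (c * (w i)\<^sup>2) powr (1 / 2)) sums sqrt c"
proof -
  have le: "c * (w i)\<^sup>2 \<le> c * \<epsilon> * w i" for i
    using w(1,2)[of i] c by (simp add: power2_eq_square)
  have s: "(\<lambda>i. c * \<epsilon> * w i) sums (c * \<epsilon> * 1)" by (rule sums_mult[OF w(3)])
  show sm: "summable (\<lambda>i. c * (w i)\<^sup>2)"
    by (rule summable_comparison_test'[OF sums_summable[OF s], of 0]) (use le c in auto)
  have "(\<Sum>i. c * (w i)\<^sup>2) \<le> (\<Sum>i. c * \<epsilon> * w i)"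
    by (rule suminf_le[OF le sm sums_summable[OF s]])
  then show "(\<Sum>i. c * (w i)\<^sup>2) \<le> c * \<epsilon>" using sums_unique[OF s] by simp
  have p: "(c * (w i)\<^sup>2) powr t = c powr t * w i powr (2 * t)" for i t
  proof -
    have "(w i)\<^sup>2 = w i powr 2" using w(1)[of i] by simp
    then show ?thesis using c w(1)[of i] by (simp only: powr_mult powr_powr less_imp_le powr_ge_zero)
  qed
  show "\<not> summable (\<lambda>i. (c * (w i)\<^sup>2) powr t)" if "t < 1 / 2" for t
  proof
    assume "summable (\<lambda>i. (c * (w i)\<^sup>2) powr t)"
    then have "summable (\<lambda>i. w i powr (2 * t))" unfolding p using c by (simp add: summable_cmult_iff)
    then show False using w(4) that by simp
  qed
  have "(c * (w i)\<^sup>2) powr (1 / 2) = sqrt c * w i" for i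
    unfolding p using c w(1)[of i] by (simp add: powr_half_sqrt)
  then show "(\<lambda>i. (c * (w i)\<^sup>2) powr (1 / 2)) sums sqrt c" using sums_mult[OF w(3), of "sqrt c"] by simp
qed

text \<open>Geometric ratios have a finite Moran sum for every t > 0, so their critical exponent is
  0.\<close>

lemma geometric_ratios:
  fixes \<epsilon> :: real
  assumes "0 < \<epsilon>"
  shows "summable (\<lambda>i. \<epsilon> * (1 / 2) ^ Suc i)" and "(\<Sum>i. \<epsilon> * (1 / 2) ^ Suc i) = \<epsilon>"
    and "\<And>t. 0 < t \<Longrightarrow> summable (\<lambda>i. (\<epsilon> * (1 / 2) ^ Suc i) powr t)"
proof -
  have s: "(\<lambda>i. \<epsilon> * (1 / 2) ^ Suc i) sums (\<epsilon> * 1)" by (rule sums_mult[OF power_half_series])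
  then show "summable (\<lambda>i. \<epsilon> * (1 / 2) ^ Suc i)" "(\<Sum>i. \<epsilon> * (1 / 2) ^ Suc i) = \<epsilon>"
    by (auto simp: sums_iff)
  fix t :: real assume t: "0 < t"
  have "(1 / 2) powr t < 1 powr t" using t by (intro powr_less_mono2) auto
  then have "norm ((1 / 2 :: real) powr t) < 1" by simp
  then have "summable (\<lambda>i. ((1 / 2 :: real) powr t) ^ i)" by (rule summable_geometric)
  then have "summable (\<lambda>i. \<epsilon> powr t * (1 / 2) powr t * ((1 / 2) powr t) ^ i)" by (rule summable_mult)
  moreover have "(\<epsilon> * (1 / 2) ^ Suc i) powr t = \<epsilon> powr t * (1 / 2) powr t * ((1 / 2) powr t) ^ i" for i
  proof -
    have "((1 / 2 :: real) ^ n) powr t = ((1 / 2) powr t) ^ n" for n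
      by (induction n) (simp_all only: power_0 power_Suc powr_mult powr_one_eq_one)
    then show ?thesis by (simp only: powr_mult power_Suc mult.assoc)
  qed
  ultimately show "summable (\<lambda>i. (\<epsilon> * (1 / 2) ^ Suc i) powr t)" by simp
qed

theorem proposition6p6:
  fixes X :: "complex set" and \<tau> :: family_type
  assumes "cifs_space X"
  shows "\<exists>(M :: complex cmanifold) (\<Phi> :: complex \<Rightarrow> system).
           analytic_family X M \<Phi> \<and>
           continuous_map (mtop M) (lambda_topology X) \<Phi> \<and>
           is_of_type \<tau> X M \<Phi>"
proof -
  let ?goal = "\<lambda>\<tau>. \<exists>(M :: complex cmanifold) (\<Phi> :: complex \<Rightarrow> system).
           analytic_family X M \<Phi> \<and> continuous_map (mtop M) (lambda_topology X) \<Phi> \<and> is_of_type \<tau> X M \<Phi>"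
  have goalI: "?goal \<tau>"
    if "similarity_family X R b s \<kappa>" "is_of_type \<tau> X disc (similarity_family.\<Phi> X b s \<kappa>)" for \<tau> R b s \<kappa>
    using similarity_family.analytic_family[OF that(1)] similarity_family.continuous_map_\<Phi>[OF that(1)] that(2)
    by (intro exI conjI)
  obtain R \<epsilon> where \<epsilon>: "0 < \<epsilon>"
    and fam: "\<And>s \<kappa>. (\<forall>i. 0 < s i) \<Longrightarrow> summable s \<Longrightarrow> suminf s \<le> \<epsilon> \<Longrightarrow> (\<forall>i. \<bar>\<kappa> i\<bar> \<le> 1) \<Longrightarrow>
           \<exists>b. similarity_family X R b s \<kappa>"
    using similarity_family_exists[OF assms] by blast
  have cfr: "\<exists>b. similarity_family_cofinitely_regular X R b (\<lambda>i. \<epsilon> * (1 / 2) ^ Suc i) \<kappa>"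
    if \<kappa>: "\<forall>i. \<bar>\<kappa> i\<bar> \<le> 1" for \<kappa>
  proof -
    have "\<exists>b. similarity_family X R b (\<lambda>i. \<epsilon> * (1 / 2) ^ Suc i) \<kappa>"
      using \<epsilon> geometric_ratios[OF \<epsilon>] by (intro fam \<kappa>) auto
    then obtain b where "similarity_family X R b (\<lambda>i. \<epsilon> * (1 / 2) ^ Suc i) \<kappa>" ..
    then have "similarity_family_cofinitely_regular X R b (\<lambda>i. \<epsilon> * (1 / 2) ^ Suc i) \<kappa>"
      unfolding similarity_family_cofinitely_regular_def similarity_family_finite_def
        similarity_family_finite_axioms_def
      using geometric_ratios(3)[OF \<epsilon>] by simp
    then show ?thesis by (rule exI[of _ b])
  qed
  \<comment> \<open>The factors c used below are at most 4; weights up to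
    \<open>\<epsilon> / 4\<close> then keep the total of the ratios within \<epsilon>.\<close>
  obtain w :: "nat \<Rightarrow> real" where "(\<forall>i. 0 < w i \<and> w i \<le> \<epsilon> / 4) \<and> w sums 1 \<and> (\<forall>\<tau><1. \<not> summable (\<lambda>i. w i powr \<tau>))"
    using critical_weights[of "\<epsilon> / 4"] \<epsilon> by auto
  then have w: "\<And>i. 0 < w i" "\<And>i. w i \<le> \<epsilon> / 4" "w sums 1" "\<forall>\<tau><1. \<not> summable (\<lambda>i. w i powr \<tau>)"
    by auto
  have critI: "similarity_family_critical X R b s \<kappa> (1/2)"
    if "similarity_family X R b s \<kappa>" "\<And>t. t < 1 / 2 \<Longrightarrow> \<not> summable (\<lambda>i. s i powr t)" "summable (\<lambda>i. s i powr (1 / 2))"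
    for b s \<kappa>
    unfolding similarity_family_critical_def similarity_family_critical_axioms_def using that by simp
  have crit: "\<exists>b. similarity_family_critical X R b (\<lambda>i. c * (w i)\<^sup>2) \<kappa> (1/2)"
    if c: "0 < c" "c \<le> 4" and \<kappa>: "\<forall>i. \<bar>\<kappa> i\<bar> \<le> 1" for c \<kappa>
  proof -
    note ws = weights_squared[OF w c(1)]
    have "c * (\<epsilon> / 4) \<le> \<epsilon>" using c \<epsilon> by simp
    then have "\<exists>b. similarity_family X R b (\<lambda>i. c * (w i)\<^sup>2) \<kappa>"
      using ws(1,2) c(1) less_imp_neq[OF w(1)] by (intro fam \<kappa>) auto
    then obtain b where "similarity_family X R b (\<lambda>i. c * (w i)\<^sup>2) \<kappa>" ..
    then have "similarity_family_critical X R b (\<lambda>i. c * (w i)\<^sup>2) \<kappa> (1/2)"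
      using ws(3) sums_summable[OF ws(4)] by (rule critI)
    then show ?thesis by (rule exI[of _ b])
  qed
  have S: "(\<Sum>i. (c * (w i)\<^sup>2) powr (1 / 2)) = sqrt c" if "0 < c" for c
    using weights_squared(4)[OF w that] by (simp add: sums_iff)
  have sq4: "sqrt 4 = 2" "sqrt (1 / 4) = 1 / 2" by (simp_all add: real_sqrt_divide)
  show ?thesis
  proof (cases \<tau>)
    case Type_I
    obtain b where "similarity_family_cofinitely_regular X R b (\<lambda>i. \<epsilon> * (1 / 2) ^ Suc i) (\<lambda>_. 0)"
      using cfr[of "\<lambda>_. 0"] by auto
    then interpret similarity_family_cofinitely_regular X R b "\<lambda>i. \<epsilon> * (1 / 2) ^ Suc i" "\<lambda>_. 0" .
    show ?thesis unfolding Type_I by (rule goalI[OF similarity_family_axioms type_I]) simp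
  next
    case Type_II
    obtain b where "similarity_family_cofinitely_regular X R b (\<lambda>i. \<epsilon> * (1 / 2) ^ Suc i) (\<lambda>_. 1)"
      using cfr[of "\<lambda>_. 1"] by auto
    then interpret similarity_family_cofinitely_regular X R b "\<lambda>i. \<epsilon> * (1 / 2) ^ Suc i" "\<lambda>_. 1" .
    show ?thesis unfolding Type_II by (rule goalI[OF similarity_family_axioms type_II]) simp
  next
    case Type_III
    \<comment> \<open>c = 4 makes the sum at the critical exponent equal to 2.\<close>
    obtain b where "similarity_family_critical X R b (\<lambda>i. 4 * (w i)\<^sup>2) (\<lambda>_. 0) (1/2)"
      using crit[of 4 "\<lambda>_. 0"] by auto
    then interpret similarity_family_critical X R b "\<lambda>i. 4 * (w i)\<^sup>2" "\<lambda>_. 0" "1/2" .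
    show ?thesis unfolding Type_III
      by (rule goalI[OF similarity_family_axioms type_III]) (use S[of 4] sq4 in auto)
  next
    case Type_IV
    obtain b where "similarity_family_critical X R b (\<lambda>i. 4 * (w i)\<^sup>2) (\<lambda>_. 1) (1/2)"
      using crit[of 4 "\<lambda>_. 1"] by auto
    then interpret similarity_family_critical X R b "\<lambda>i. 4 * (w i)\<^sup>2" "\<lambda>_. 1" "1/2" .
    \<comment> \<open>The sum at \<theta> is \<open>2 * exp (x / 2)\<close>, which stays above 1 on
      the whole disc.\<close>
    have "1 < crit x" if "\<bar>x\<bar> < 1" for x
    proof -
      have "1 / 2 < 1 + x / 2" using that by (simp add: abs_less_iff)
      then have "1 / 2 < exp (x / 2)" using exp_ge_add_one_self[of "x / 2"] by linarith
      then show ?thesis using crit_exp[of x] S[of 4] sq4 by simp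
    qed
    then show ?thesis unfolding Type_IV
      by (intro goalI[OF similarity_family_axioms type_IV]) auto
  next
    case Type_V
    \<comment> \<open>c = 1/4 gives the sum \<open>sqrt (1 / 4) = 1 / 2\<close> over one member of
      each pair. Repeating every ratio doubles the total, which still is within \<epsilon>.\<close>
    let ?g = "\<lambda>j. 1 / 4 * (w j)\<^sup>2" and ?\<kappa> = "\<lambda>i. if even i then 1 else - 1 :: real"
    have pos: "0 < (1 / 4 :: real)" by simp
    note ws = weights_squared[OF w pos]
    have dup: "(\<lambda>i. h (i div 2)) sums (2 * A)" if "h sums A" for h :: "nat \<Rightarrow> real" and A
    proof -
      have "(\<lambda>i. if even i then h (i div 2) else h ((i - 1) div 2)) sums (A + A)"
        by (rule sums_if[OF that that])
      moreover have "(if even i then h (i div 2) else h ((i - 1) div 2)) = h (i div 2)" for i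
        by (cases "even i") (auto elim!: oddE)
      ultimately show ?thesis by simp
    qed
    have d1: "(\<lambda>i. ?g (i div 2)) sums (2 * suminf ?g)" by (rule dup[OF summable_sums[OF ws(1)]])
    have "\<exists>b. similarity_family X R b (\<lambda>i. ?g (i div 2)) ?\<kappa>"
      using d1 ws(2) \<epsilon> less_imp_neq[OF w(1)] by (intro fam) (auto simp: sums_iff)
    then obtain b where fb: "similarity_family X R b (\<lambda>i. ?g (i div 2)) ?\<kappa>" ..
    have "\<not> summable (\<lambda>i. ?g (i div 2) powr t)" if "t < 1 / 2" for t
    proof
      assume "summable (\<lambda>i. ?g (i div 2) powr t)"
      then have "summable ((\<lambda>i. ?g (i div 2) powr t) \<circ> (\<lambda>j. 2 * j))"
        by (rule summable_reindex) (auto simp: inj_def)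
      then show False using ws(3)[OF that] by (simp add: o_def)
    qed
    moreover have "summable (\<lambda>i. ?g (i div 2) powr (1 / 2))"
      by (rule sums_summable[OF dup[OF ws(4)]])
    ultimately have "similarity_family_critical X R b (\<lambda>i. ?g (i div 2)) ?\<kappa> (1/2)"
      using fb by (intro critI)
    then interpret similarity_family_critical X R b "\<lambda>i. ?g (i div 2)" ?\<kappa> "1/2" .
    show ?thesis unfolding Type_V
      by (rule goalI[OF similarity_family_axioms type_V[where g = ?g]]) (use ws(4) sq4 in auto)
  next
    case Type_VI
    obtain b where "similarity_family_critical X R b (\<lambda>i. 1 * (w i)\<^sup>2) (\<lambda>_. 0) (1/2)"
      using crit[of 1 "\<lambda>_. 0"] by auto
    then interpret similarity_family_critical X R b "\<lambda>i. 1 * (w i)\<^sup>2" "\<lambda>_. 0" "1/2" .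
    show ?thesis unfolding Type_VI
      by (rule goalI[OF similarity_family_axioms type_VI]) (use S[of 1] in auto)
  next
    case Type_VII
    obtain b where "similarity_family_critical X R b (\<lambda>i. 1 * (w i)\<^sup>2) (\<lambda>_. 1) (1/2)"
      using crit[of 1 "\<lambda>_. 1"] by auto
    then interpret similarity_family_critical X R b "\<lambda>i. 1 * (w i)\<^sup>2" "\<lambda>_. 1" "1/2" .
    show ?thesis unfolding Type_VII
      by (rule goalI[OF similarity_family_axioms type_VII]) (use S[of 1] in auto)
  next
    case Type_VIII
    \<comment> \<open>c = 1/4 makes the sum at the critical exponent equal to 1/2, hence less than
      1.\<close>
    obtain b where "similarity_family_critical X R b (\<lambda>i. 1 / 4 * (w i)\<^sup>2) (\<lambda>_. 0) (1/2)"
      using crit[of "1/4" "\<lambda>_. 0"] by auto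
    then interpret similarity_family_critical X R b "\<lambda>i. 1 / 4 * (w i)\<^sup>2" "\<lambda>_. 0" "1/2" .
    show ?thesis unfolding Type_VIII
      by (rule goalI[OF similarity_family_axioms type_VIII]) (use S[of "1/4"] sq4 in auto)
  qed
qed

end
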